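(* Let $\Omega$ be an open, connected subset of $\mathbb{R}^n$, $n \geq 1$, let $\mathcal{U}$ be a non-empty open subset of $\bar\Omega \times \mathbb{R} \times \mathbb{R}^n \times \mathrm{Sym}_n$ and let $F\in C^0(\bar{\mathcal{U}})$ be such that $(F,\mathcal{U})$ satisfies conditions (F1)--(F4) listed in the context. Assume that (i) $\psi_1 \in USC(\Omega;\mathbb{R} \cup\{-\infty\})$ and $\psi_2 \in LSC(\Omega;\mathbb{R} \cup \{\infty\})$ are a sub-solution and a super-solution to $F(x,\psi,\nabla\psi,\nabla^2\psi)=1$ in $\Omega$ in the viscosity sense, respectively, and (ii) $\psi_1 \leq \psi_2$ in $\Omega$. If one of $\psi_1$ and $\psi_2$ belongs to $C^{1,1}_{\rm loc}(\Omega)$, then either $\psi_1 \equiv \psi_2$ in $\Omega$ or $\psi_1 < \psi_2$ in $\Omega$.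
   Context: $\mathrm{Sym}_n$ is the space of real symmetric $n\times n$ matrices; $N \geq 0$ means $N$ is non-negative definite. $\mathcal{U}$ is open relative to $\bar\Omega \times \mathbb{R} \times \mathbb{R}^n \times \mathrm{Sym}_n$. For $x\in\bar\Omega$, $\mathcal{U}_x := \{(s,p,M) \in \mathbb{R}\times\mathbb{R}^n\times \mathrm{Sym}_n: (x,s,p,M)\in\mathcal{U}\}$. Write $J_2[\psi] = (\psi,\nabla\psi,\nabla^2\psi)$. $USC(\Omega;S)$ and $LSC(\Omega;S)$ denote the upper, respectively lower, semi-continuous functions on $\Omega$ with values in $S$. Conditions on $(F,\mathcal{U})$: (F1) (ellipticity) for all $(x,s,p,M) \in \mathcal{U}$ and $N \in \mathrm{Sym}_n$ with $N \geq 0$: $(x,s,p,M + N) \in \mathcal{U}$ and $F(x,s,p,M + N) \geq F(x,s,p,M)$. (F2) $F(x,s,p,M) < 1$ for all $x \in \bar\Omega$ and $(s,p,M) \in \partial \mathcal{U}_x$. (F3) (local strict ellipticity) for any compact subset $\mathcal{K}$ of $\mathcal{U}$ there is a constant $\delta(\mathcal{K}) > 0$ such that $F(x,s,p,M + N) - F(x, s, p,M) \geq \delta(\mathcal{K}) |N|$ for all $(x,s,p,M) \in \mathcal{K}$ and $N \in \mathrm{Sym}_n$ with $N \geq 0$. (F4) (local Lipschitz condition in $(s,p,M)$) for every compact subset $\mathcal{K}$ of $\mathcal{U}$ there exists $C(\mathcal{K}) > 0$ such that $|F(x, s, p, M) - F(x, s', p', M')| \leq C(\mathcal{K})(|s -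 s'| + |p - p'| + |M - M'|)$ for all $(x,s,p,M), (x,s',p',M') \in \mathcal{K}$. Viscosity sub-/super-solutions of $F(x,J_2[\psi])=1$ in $\Omega$: - $\psi \in USC(\Omega; \mathbb{R} \cup \{-\infty\})$ is a sub-solution ($F(x,J_2[\psi])\ge 1$ in the viscosity sense) if for any $x_0\in\Omega$ and $\varphi\in C^2(\Omega)$ with $(\psi-\varphi)(x_0)=0$ and $\psi-\varphi\leq 0$ near $x_0$, there holds $(x_0,J_2[\varphi](x_0)) \in \bar{\mathcal{U}}$ and $F(x_0, J_2[\varphi](x_0)) \geq 1$. - $\psi \in LSC(\Omega; \mathbb{R} \cup \{\infty\})$ is a super-solution ($F(x,J_2[\psi])\le 1$ in the viscosity sense) if for any $x_0\in\Omega$ and $\varphi\in C^2(\Omega)$ with $(\psi-\varphi)(x_0)=0$ and $\psi-\varphi\geq 0$ near $x_0$, either $(x_0,J_2[\varphi](x_0)) \notin \bar{\mathcal{U}}$ or $F(x_0, J_2[\varphi](x_0)) \leq 1$.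
   Formalization: In (F2), ∂U_x is taken as the slice at x of the boundary of U relative to Ω̄×ℝ×ℝⁿ×Sym_n, not as the boundary of the slice U_x; with the latter the claim fails (n=1, Ω=ℝ, U={x≠0}, F=1+x²M−2s, ψ₁=0, ψ₂=x²). *)

theory Defs
  imports "HOL-Analysis.Analysis"
begin

text \<open>Points \<open>(x, s, p, M)\<close>; the symmetry of \<open>M\<close> is imposed through \<open>Sym\<close> below.\<close>

type_synonym 'n jet = "(real^'n) \<times> real \<times> (real^'n) \<times> (real^'n^'n)"

definition Sym :: "(real^'n^'n) set" where
  "Sym = {M. transpose M = M}"

definition nonneg_def :: "real^'n^'n \<Rightarrow> bool" where
  "nonneg_def N \<longleftrightarrow> (\<forall>v. 0 \<le> v \<bullet> (N *v v))"

definition jet_space :: "(real^'n) set \<Rightarrow> 'n jet set" where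
  "jet_space \<Omega> = closure \<Omega> \<times> UNIV \<times> UNIV \<times> Sym"

abbreviation jet_top :: "(real^'n) set \<Rightarrow> 'n jet topology" where
  "jet_top \<Omega> \<equiv> top_of_set (jet_space \<Omega>)"

definition slice :: "'n jet set \<Rightarrow> real^'n \<Rightarrow> (real \<times> (real^'n) \<times> (real^'n^'n)) set" where
  "slice U x = {(s, p, M). (x, s, p, M) \<in> U}"

definition grad :: "(real^'n \<Rightarrow> real) \<Rightarrow> real^'n \<Rightarrow> real^'n" where
  "grad f x = (\<chi> i. frechet_derivative f (at x) (axis i 1))"

definition hessian :: "(real^'n \<Rightarrow> real) \<Rightarrow> real^'n \<Rightarrow> real^'n^'n" where
  "hessian f x = jacobian (grad f) (at x)"

definition J2 :: "(real^'n \<Rightarrow> real) \<Rightarrow> real^'n \<Rightarrow> real \<times> (real^'n) \<times> (real^'n^'n)" where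
  "J2 f x = (f x, grad f x, hessian f x)"

text \<open>The function spaces below are meant for open \<open>\<Omega>\<close>.\<close>

definition C2_on :: "(real^'n) set \<Rightarrow> (real^'n \<Rightarrow> real) \<Rightarrow> bool" where
  "C2_on \<Omega> f \<longleftrightarrow>
     (\<forall>x\<in>\<Omega>. f differentiable (at x)) \<and>
     (\<forall>x\<in>\<Omega>. grad f differentiable (at x)) \<and>
     continuous_on \<Omega> (hessian f)"

definition C11_loc_on :: "(real^'n) set \<Rightarrow> (real^'n \<Rightarrow> real) \<Rightarrow> bool" where
  "C11_loc_on \<Omega> f \<longleftrightarrow>
     (\<forall>x\<in>\<Omega>. f differentiable (at x)) \<and>
     (\<forall>K. compact K \<and> K \<subseteq> \<Omega> \<longrightarrow> (\<exists>L. L-lipschitz_on K (grad f)))"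

definition ereal_C11_loc_on :: "(real^'n) set \<Rightarrow> (real^'n \<Rightarrow> ereal) \<Rightarrow> bool" where
  "ereal_C11_loc_on \<Omega> \<psi> \<longleftrightarrow> (\<exists>f. C11_loc_on \<Omega> f \<and> (\<forall>x\<in>\<Omega>. \<psi> x = ereal (f x)))"

definition USC_on :: "(real^'n) set \<Rightarrow> (real^'n \<Rightarrow> ereal) \<Rightarrow> bool" where
  "USC_on \<Omega> \<psi> \<longleftrightarrow>
     (\<forall>x\<in>\<Omega>. \<psi> x \<noteq> \<infinity>) \<and>
     (\<forall>x\<in>\<Omega>. \<forall>c. \<psi> x < c \<longrightarrow> (\<forall>\<^sub>F y in at x within \<Omega>. \<psi> y < c))"

definition LSC_on :: "(real^'n) set \<Rightarrow> (real^'n \<Rightarrow> ereal) \<Rightarrow> bool" where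
  "LSC_on \<Omega> \<psi> \<longleftrightarrow>
     (\<forall>x\<in>\<Omega>. \<psi> x \<noteq> -\<infinity>) \<and>
     (\<forall>x\<in>\<Omega>. \<forall>c. c < \<psi> x \<longrightarrow> (\<forall>\<^sub>F y in at x within \<Omega>. c < \<psi> y))"

definition condF1 :: "(('n::finite) jet \<Rightarrow> real) \<Rightarrow> 'n jet set \<Rightarrow> bool" where
  "condF1 F U \<longleftrightarrow>
     (\<forall>x s p M N. (x, s, p, M) \<in> U \<and> N \<in> Sym \<and> nonneg_def N \<longrightarrow>
        (x, s, p, M + N) \<in> U \<and> F (x, s, p, M) \<le> F (x, s, p, M + N))"

text \<open>
  \<open>\<partial>U\<^sub>x\<close> is read as \<open>(\<partial>U)\<^sub>x\<close>, the slice at \<open>x\<close> of the relative boundary of \<open>U\<close>. This set contains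
  \<open>\<partial>(U\<^sub>x)\<close>, and the inclusion can be strict, because a slice of the closure of \<open>U\<close> can be
  larger than the closure of the slice. With \<open>\<partial>(U\<^sub>x)\<close> instead, the strong maximum principle
  fails: for \<open>n = 1\<close>, \<open>\<Omega> = \<real>\<close>, \<open>U = {x \<noteq> 0}\<close> and \<open>F = 1 + x\<^sup>2 M - 2 s\<close>, all the sets \<open>\<partial>(U\<^sub>x)\<close>
  are empty and the other hypotheses hold, but \<open>0\<close> and \<open>x\<^sup>2\<close> are solutions that touch only at \<open>0\<close>.
\<close>

definition condF2 :: "(real^'n) set \<Rightarrow> ('n jet \<Rightarrow> real) \<Rightarrow> 'n jet set \<Rightarrow> bool" where
  "condF2 \<Omega> F U \<longleftrightarrow>
     (\<forall>x\<in>closure \<Omega>. \<forall>(s, p, M) \<in> slice (jet_top \<Omega> frontier_of U) x. F (x, s, p, M) < 1)"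

definition condF3 :: "(('n::finite) jet \<Rightarrow> real) \<Rightarrow> 'n jet set \<Rightarrow> bool" where
  "condF3 F U \<longleftrightarrow>
     (\<forall>K. compact K \<and> K \<subseteq> U \<longrightarrow>
        (\<exists>\<delta>>0. \<forall>x s p M N. (x, s, p, M) \<in> K \<and> N \<in> Sym \<and> nonneg_def N \<longrightarrow>
           \<delta> * norm N \<le> F (x, s, p, M + N) - F (x, s, p, M)))"

definition condF4 :: "(('n::finite) jet \<Rightarrow> real) \<Rightarrow> 'n jet set \<Rightarrow> bool" where
  "condF4 F U \<longleftrightarrow>
     (\<forall>K. compact K \<and> K \<subseteq> U \<longrightarrow>
        (\<exists>C>0. \<forall>x s p M s' p' M'. (x, s, p, M) \<in> K \<and> (x, s', p', M') \<in> K \<longrightarrow>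
           \<bar>F (x, s, p, M) - F (x, s', p', M')\<bar> \<le> C * (\<bar>s - s'\<bar> + norm (p - p') + norm (M - M'))))"

definition visc_subsolution ::
  "(real^'n) set \<Rightarrow> ('n jet \<Rightarrow> real) \<Rightarrow> 'n jet set \<Rightarrow> (real^'n \<Rightarrow> ereal) \<Rightarrow> bool" where
  "visc_subsolution \<Omega> F U \<psi> \<longleftrightarrow> USC_on \<Omega> \<psi> \<and>
     (\<forall>x0\<in>\<Omega>. \<forall>\<phi>. C2_on \<Omega> \<phi> \<and> \<psi> x0 - ereal (\<phi> x0) = 0 \<and>
        (\<forall>\<^sub>F x in nhds x0. \<psi> x - ereal (\<phi> x) \<le> 0) \<longrightarrow>
        (x0, J2 \<phi> x0) \<in> closure U \<and> F (x0, J2 \<phi> x0) \<ge> 1)"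

definition visc_supersolution ::
  "(real^'n) set \<Rightarrow> ('n jet \<Rightarrow> real) \<Rightarrow> 'n jet set \<Rightarrow> (real^'n \<Rightarrow> ereal) \<Rightarrow> bool" where
  "visc_supersolution \<Omega> F U \<psi> \<longleftrightarrow> LSC_on \<Omega> \<psi> \<and>
     (\<forall>x0\<in>\<Omega>. \<forall>\<phi>. C2_on \<Omega> \<phi> \<and> \<psi> x0 - ereal (\<phi> x0) = 0 \<and>
        (\<forall>\<^sub>F x in nhds x0. \<psi> x - ereal (\<phi> x) \<ge> 0) \<longrightarrow>
        (x0, J2 \<phi> x0) \<notin> closure U \<or> F (x0, J2 \<phi> x0) \<le> 1)"

end

theory Submission
  imports Defs
begin

text \<open>
  If the two functions touch but do not coincide, an interior ball produces a contact point \<open>x0\<close>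
  on the boundary of a ball on which \<open>\<psi>1 < \<psi>2\<close> otherwise, and subtracting a small multiple of
  the Hopf barrier \<open>exp (- \<alpha> |x - z|\<^sup>2)\<close> from the upper function moves the touching to an interior
  maximum near \<open>x0\<close>. Regularising the merely semicontinuous function \<open>u\<close> by sup-convolution and
  tilting by a small linear function, one obtains a set of touching points that is not
  negligible: the slopes depend on the touching point in a locally Lipschitz way and fill a ball.
  By Rademacher's theorem, applied to the gradient of the \<open>C\<^sup>1\<^sup>,\<^sup>1\<close> function, one of these points has a
  second-order expansion, which gives quadratic test functions for both \<open>\<psi>1\<close> and \<open>\<psi>2\<close>.
  No second-order differentiability of \<open>u\<close> (Alexandrov's theorem) is needed. In the limit the two
  jets lie over the same point and differ by the jet of the barrier; (F3) and (F4) then contradict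
  each other if \<open>\<alpha>\<close> is large.
\<close>

section \<open>Lipschitz functions of one real variable\<close>

text \<open>(F4) compares jets over one and the same point, and \<open>F\<close> is merely
  continuous in \<open>x\<close>, whereas doubling the variables yields jets over two different
  points. So two limits are taken in turn. With \<alpha> and \<epsilon> fixed, \<kappa>
  \<rightarrow> 0 merges the base points; gradients and Hessians then differ by exactly \<epsilon>
  times those of the barrier. Only afterwards does \<epsilon> \<rightarrow> 0; by then every term of
  the comparison carries the factor \<epsilon> exp (- \<alpha> |x - z|^2), which cancels.

  The constants of (F3) and (F4) belong to a compact set, and that set must be known before \<alpha>
  is chosen in terms of them. This is why the bound \<open>B\<close> on the jets precedes \<alpha>
  in every statement. It comes from the Lipschitz constant of the gradient of the regular function,
  which bounds its Hessians wherever they exist; the jets of the other function are controlled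
  through their distance to these. (F2) keeps limits of jets with \<open>F \<ge> 1\<close> inside
  \<open>U\<close>, so that the compact set lies in \<open>U\<close>.\<close>

lemma emeasure_le_of_fine_intervals:
  fixes M M' :: "real measure" and S T :: "real set" and P :: "real \<Rightarrow> real \<Rightarrow> bool"
  assumes sets: "sets M = sets borel" "sets M' = sets borel"
    and null: "\<And>A. A \<in> sets borel \<Longrightarrow> negligible A \<Longrightarrow> emeasure M A = 0"
    and S: "S \<in> sets borel" "S \<subseteq> T" and T: "open T"
    and fine: "\<And>x d. x \<in> S \<Longrightarrow> 0 < d \<Longrightarrow> \<exists>s t. s < x \<and> x < t \<and> t - s < d \<and> P s t"
    and le: "\<And>s t. s < t \<Longrightarrow> P s t \<Longrightarrow> emeasure M {s<..<t} \<le> c * emeasure M' {s<..<t}"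
  shows "emeasure M S \<le> c * emeasure M' T"
proof -
  \<comment> \<open>Indexing the intervals by centre and radius turns the fine cover of
    \<open>S\<close> into one by balls, so Vitali's theorem extracts countably many disjoint ones
    that miss only a negligible part of \<open>S\<close>. That part is \<open>M\<close>-null by
    \<open>null\<close>, and \<open>le\<close> is summed over the disjoint intervals, all of which
    lie in \<open>T\<close>.\<close>
  define K where "K = {(m, r). 0 < r \<and> P (m - r) (m + r) \<and> ball m r \<subseteq> T}"
  have "\<exists>i. i \<in> K \<and> x \<in> ball (fst i) (snd i) \<and> snd i < d" if x: "x \<in> S" and d: "0 < d" for x d
  proof -
    obtain e where e: "e > 0" "ball x e \<subseteq> T"
      using x S(2) T openE by blast
    obtain s t where st: "s < x" "x < t" "t - s < min d e" "P s t"
      using fine[OF x, of "min d e"] d e by auto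
    have "ball ((s+t)/2) ((t-s)/2) = {s<..<t}"
      by (simp add: ball_eq_greaterThanLessThan field_simps)
    moreover have "{s<..<t} \<subseteq> ball x e"
      using st by (auto simp: dist_real_def)
    moreover have "(s+t)/2 - (t-s)/2 = s" "(s+t)/2 + (t-s)/2 = t"
      by (simp_all add: field_simps)
    ultimately have "((s+t)/2, (t-s)/2) \<in> K"
      using st e unfolding K_def by auto
    moreover have "x \<in> ball ((s+t)/2) ((t-s)/2)"
      using st \<open>ball _ _ = {s<..<t}\<close> by auto
    moreover have "(t-s)/2 < d"
      using st d by auto
    ultimately show ?thesis
      by (intro exI[of _ "((s+t)/2, (t-s)/2)"]) auto
  qed
  then obtain C where C: "countable C" "C \<subseteq> K"
    and disj: "pairwise (\<lambda>i j. disjnt (ball (fst i) (snd i)) (ball (fst j) (snd j))) C"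
    and neg: "negligible (S - (\<Union>i\<in>C. ball (fst i) (snd i)))"
    using Vitali_covering_theorem_balls[of S K fst snd] by blast
  let ?B = "\<lambda>i. ball (fst i) (snd i) :: real set"
  have dj: "disjoint_family_on ?B C"
    using disj by (auto simp: disjoint_family_on_def pairwise_def disjnt_def)
  have U: "(\<Union>i\<in>C. ?B i) \<in> sets borel"
    by (intro borel_open open_UN ballI open_ball)
  have "emeasure M S \<le> emeasure M ((S - (\<Union>i\<in>C. ?B i)) \<union> (\<Union>i\<in>C. ?B i))"
    using S(1) U by (intro emeasure_mono) (auto simp: sets)
  also have "\<dots> \<le> emeasure M (S - (\<Union>i\<in>C. ?B i)) + emeasure M (\<Union>i\<in>C. ?B i)"
    using S(1) U by (intro emeasure_subadditive) (auto simp: sets)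
  also have "emeasure M (S - (\<Union>i\<in>C. ?B i)) = 0"
    using S(1) U neg by (intro null) auto
  also have "emeasure M (\<Union>i\<in>C. ?B i) = (\<integral>\<^sup>+i. emeasure M (?B i) \<partial>count_space C)"
    using C dj by (intro emeasure_UN_countable) (auto simp: sets)
  also have "0 + \<dots> \<le> (\<integral>\<^sup>+i. c * emeasure M' (?B i) \<partial>count_space C)"
  proof -
    have "emeasure M (?B i) \<le> c * emeasure M' (?B i)" if "i \<in> C" for i
      using that C(2) le[of "fst i - snd i" "fst i + snd i"]
      by (auto simp: K_def ball_eq_greaterThanLessThan)
    then show ?thesis
      by (auto intro!: nn_integral_mono)
  qed
  also have "\<dots> = c * (\<integral>\<^sup>+i. emeasure M' (?B i) \<partial>count_space C)"
    by (intro nn_integral_cmult) auto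
  also have "(\<integral>\<^sup>+i. emeasure M' (?B i) \<partial>count_space C) = emeasure M' (\<Union>i\<in>C. ?B i)"
    using C dj by (intro emeasure_UN_countable[symmetric]) (auto simp: sets)
  also have "\<dots> \<le> emeasure M' T"
  proof (rule emeasure_mono)
    have "?B i \<subseteq> T" if "i \<in> C" for i
      using subsetD[OF C(2) that] by (simp add: K_def case_prod_beta)
    then show "(\<Union>i\<in>C. ?B i) \<subseteq> T" by (rule UN_least)
  qed (use T in \<open>simp add: sets\<close>)
  finally show ?thesis
    by (auto simp: mult_left_mono)
qed

text \<open>Let M(A) be the Lebesgue measure of g(A), the Stieltjes measure of \<open>g\<close>.
  Covering by flat intervals gives M(S) \<le> a |S|, covering by steep ones gives b |S| \<le> M(S);
  on bounded pieces |S| is finite, and a < b forces |S| = 0. The lower bound 1 on the slopes makes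
  \<open>g\<close> a homeomorphism with Lipschitz inverse \<open>h\<close>, so that \<open>M\<close>
  is the push-forward of Lebesgue measure under \<open>h\<close>.\<close>

lemma negligible_oscillating_slopes:
  fixes g :: "real \<Rightarrow> real"
  assumes lower: "\<And>s t. s \<le> t \<Longrightarrow> t - s \<le> g t - g s"
    and lip: "L-lipschitz_on UNIV g"
    and ab: "a < b"
  defines "S \<equiv> {x. \<forall>d>0. (\<exists>s t. s < x \<and> x < t \<and> t - s < d \<and> g t - g s < a * (t - s)) \<and>
                          (\<exists>s t. s < x \<and> x < t \<and> t - s < d \<and> b * (t - s) < g t - g s)}"
  shows "negligible S"
proof -
  have cont: "continuous_on A g" for A
    using lip lipschitz_on_continuous_on lipschitz_on_subset by blast
  have smono: "strict_mono g"
  proof (rule strict_monoI)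
    fix x y :: real assume "x < y"
    then show "g x < g y" using lower[of x y] by auto
  qed
  have inj: "inj g"
    using smono strict_mono_imp_inj_on by blast
  have surj: "surj g"
  proof -
    have "\<exists>x. g x = y" for y
    proof -
      let ?r = "\<bar>y - g 0\<bar>"
      have "g (-?r) \<le> y" "y \<le> g ?r"
        using lower[of "-?r" 0] lower[of 0 ?r] by auto
      then show ?thesis
        using IVT'[of g "-?r" y ?r] cont by auto
    qed
    then show ?thesis by (metis surj_def)
  qed
  define h where "h = inv g"
  have hg: "h (g x) = x" and gh: "g (h y) = y" for x y
    using inj surj by (auto simp: h_def surj_f_inv_f)
  have him: "h -` A = g ` A" for A
    using hg gh by (auto simp: image_iff) (metis gh)
  have "1-lipschitz_on UNIV h"
  proof (rule lipschitz_onI)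
    fix x y :: real
    show "dist (h x) (h y) \<le> 1 * dist x y"
      using lower[of "h x" "h y"] lower[of "h y" "h x"] gh
      by (cases "h x \<le> h y") (auto simp: dist_real_def)
  qed auto
  then have hcont: "continuous_on UNIV h"
    using lipschitz_on_continuous_on by blast
  then have hmeas [measurable]: "h \<in> borel_measurable borel"
    by (rule borel_measurable_continuous_onI)
  define M where "M = distr lborel borel h"
  have setsM: "sets M = sets borel" "sets M = sets lborel" by (auto simp: M_def)
  have emM: "emeasure M A = emeasure lborel (g ` A)" if "A \<in> sets borel" for A
    using that by (simp add: M_def emeasure_distr him)
  have gI: "g ` {s<..<t} = {g s<..<g t}" for s t
  proof -
    have "h y \<in> {s<..<t}" if "y \<in> {g s<..<g t}" for y
      using that gh[of y] smono by (metis greaterThanLessThan_iff strict_mono_less)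
    then show ?thesis
      using strict_mono_less[OF smono] gh by (auto simp: image_iff) (metis gh greaterThanLessThan_iff)
  qed
  have emI: "emeasure M {s<..<t} = ennreal (g t - g s)" if "s < t" for s t
    using that lower[of s t] by (simp add: emM gI)
  have null: "emeasure M A = 0" if "A \<in> sets borel" "negligible A" for A
  proof -
    have "negligible (g ` A)"
    proof (rule negligible_locally_Lipschitz_image[OF _ that(2)])
      fix x assume "x \<in> A"
      show "\<exists>T B. open T \<and> x \<in> T \<and> (\<forall>y\<in>A \<inter> T. norm (g y - g x) \<le> B * norm (y - x))"
        using lip by (intro exI[of _ UNIV] exI[of _ L]) (auto simp: lipschitz_on_def dist_norm)
    qed simp
    moreover have "g ` A \<in> sets borel"
      using that(1) hmeas him by (metis measurable_sets_borel)
    ultimately show ?thesis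
      using that(1) by (simp add: emM negligible_iff_emeasure0 emeasure_completion)
  qed
  \<comment> \<open>All slopes are at least 1, so an interval with slope below \<open>a\<close>
    forces \<open>1 < a < b\<close>; dividing by \<open>b\<close> is safe as soon as
    \<open>S\<close> has a point.\<close>
  have bpos: "1 < b" if x: "x \<in> S" for x
  proof -
    obtain s t where "s < t" "g t - g s < a * (t - s)"
      using x zero_less_one[where 'a=real] unfolding S_def mem_Collect_eq by (meson less_trans)
    then have "t - s < a * (t - s)" using lower[of s t] by linarith
    then have "0 < (a - 1) * (t - s)" by (simp add: algebra_simps)
    then have "1 < a" using \<open>s < t\<close> by (simp add: zero_less_mult_iff)
    then show ?thesis using ab by auto
  qed
  \<comment> \<open>Both families consist of open sets that shrink with \<open>d\<close>, so the
    radii \<open>1 / real (Suc n)\<close> exhibit \<open>S\<close> as a countable intersection of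
    open sets, hence as a Borel set.\<close>
  define O1 where "O1 d = \<Union>{{s<..<t} | s t. t - s < d \<and> g t - g s < a * (t - s)}" for d
  define O2 where "O2 d = \<Union>{{s<..<t} | s t. t - s < d \<and> b * (t - s) < g t - g s}" for d
  have opens: "open (O1 d)" "open (O2 d)" for d
    unfolding O1_def O2_def by auto
  have O1_iff: "x \<in> O1 d \<longleftrightarrow> (\<exists>s t. s < x \<and> x < t \<and> t - s < d \<and> g t - g s < a * (t - s))" for x d
    by (simp add: O1_def) (metis (mono_tags, lifting) greaterThanLessThan_iff)
  have O2_iff: "x \<in> O2 d \<longleftrightarrow> (\<exists>s t. s < x \<and> x < t \<and> t - s < d \<and> b * (t - s) < g t - g s)" for x d
    by (simp add: O2_def) (metis (mono_tags, lifting) greaterThanLessThan_iff)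
  have mono: "O1 d \<subseteq> O1 d'" "O2 d \<subseteq> O2 d'" if "d \<le> d'" for d d'
    using that by (auto simp: O1_iff O2_iff) (meson order_less_le_trans)+
  have "S = (\<Inter>d\<in>{0<..}. O1 d \<inter> O2 d)"
    by (auto simp: S_def O1_iff O2_iff)
  also have "\<dots> = (\<Inter>n. O1 (1 / real (Suc n)) \<inter> O2 (1 / real (Suc n)))"
  proof (intro equalityI INT_greatest)
    fix d :: real assume "d \<in> {0<..}"
    then obtain n where "1 / real (Suc n) < d"
      using nat_approx_posE by auto
    then show "(\<Inter>n. O1 (1 / real (Suc n)) \<inter> O2 (1 / real (Suc n))) \<subseteq> O1 d \<inter> O2 d"
      using mono[of "1 / real (Suc n)" d] by fastforce
  next
    show "(\<Inter>d\<in>{0<..}. O1 d \<inter> O2 d) \<subseteq> O1 (1 / real (Suc n)) \<inter> O2 (1 / real (Suc n))" for n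
      by (rule INT_lower) simp
  qed
  finally have S_eq: "S = (\<Inter>n. O1 (1 / real (Suc n)) \<inter> O2 (1 / real (Suc n)))" .
  have Sb: "S \<in> sets borel"
    unfolding S_eq using opens by auto
  have "negligible (S \<inter> box (-n) n)" for n :: real
  proof (cases "S \<inter> box (-n) n = {}")
    case False
    then have b1: "1 < b" using bpos by blast
    let ?S = "S \<inter> box (-n) n"
    have SS: "?S \<in> sets borel" using Sb by auto
    have fin: "emeasure lborel ?S < \<infinity>"
      by (rule le_less_trans[OF emeasure_mono[of _ "box (-n) n"]]) (use emeasure_bounded_finite[OF bounded_box, of "-n" n] in auto)
    have A: "emeasure lborel ?S \<le> ennreal (1/b) * emeasure M T" if T: "open T" "?S \<subseteq> T" for T
    proof (rule emeasure_le_of_fine_intervals[where P="\<lambda>s t. b * (t - s) < g t - g s", OF _ setsM(1) _ SS T(2,1)])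
      fix s t :: real assume st: "s < t" "b * (t - s) < g t - g s"
      have "t - s \<le> 1/b * (g t - g s)" using st b1 by (simp add: field_simps)
      then show "emeasure lborel {s<..<t} \<le> ennreal (1/b) * emeasure M {s<..<t}"
        using st b1 lower[of s t] by (simp add: emI ennreal_mult[symmetric] ennreal_leI)
    next
      fix A :: "real set" assume "A \<in> sets borel" "negligible A"
      then show "emeasure lborel A = 0"
        by (simp add: negligible_iff_emeasure0 emeasure_completion)
    qed (auto simp: S_def)
    have B: "emeasure M ?S \<le> ennreal a * emeasure lborel T" if T: "open T" "?S \<subseteq> T" for T
    proof (rule emeasure_le_of_fine_intervals[where P="\<lambda>s t. g t - g s < a * (t - s)", OF setsM(1) _ null SS T(2,1)])
      fix s t :: real assume st: "s < t" "g t - g s < a * (t - s)"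
      then have "0 < a" using lower[of s t] by (smt (verit) mult_nonneg_nonneg mult_less_0_iff mult_le_0_iff)
      then show "emeasure M {s<..<t} \<le> ennreal a * emeasure lborel {s<..<t}"
        using st by (simp add: emI ennreal_mult[symmetric] ennreal_leI)
    qed (auto simp: S_def)
    have b_pos: "0 < a"
    proof -
      obtain x where x: "x \<in> S" using False by auto
      obtain s t where st: "s < t" "g t - g s < a * (t - s)"
        using x zero_less_one[where 'a=real] unfolding S_def mem_Collect_eq by (meson less_trans)
      then show ?thesis using lower[of s t] by (smt (verit) mult_less_0_iff mult_nonneg_nonneg mult_nonpos_nonneg)
    qed
    define m where "m = measure lborel ?S"
    define \<nu> where "\<nu> = measure lborel (g ` ?S)"
    have mS: "emeasure lborel ?S = ennreal m"
      using fin by (simp add: m_def emeasure_eq_ennreal_measure)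
    have gS: "g ` ?S \<in> sets borel"
      using SS hmeas him by (metis measurable_sets_borel)
    \<comment> \<open>The covering lemma only bounds by the measure of an open superset, which costs
      an error of order \<open>e\<close>. For the steep intervals the superset is the preimage under
      \<open>g\<close> of an open \<open>V\<close> slightly larger than the image of
      \<open>?S\<close>; its \<open>M\<close>-measure is the Lebesgue measure of
      \<open>V\<close>.\<close>
    have est: "\<nu> \<le> a * m + a * e \<and> b * m \<le> \<nu> + e" if e: "e > 0" for e
    proof
      have "?S \<in> sets lebesgue" using SS by auto
      then obtain T where T: "open T" "?S \<subseteq> T" "emeasure lebesgue (T - ?S) < e"
        using sets_lebesgue_outer_open[OF _ e, of ?S] by metis
      have "emeasure lborel T \<le> emeasure lborel ((T - ?S) \<union> ?S)"
        using T SS by (intro emeasure_mono) auto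
      also have "\<dots> \<le> emeasure lborel (T - ?S) + emeasure lborel ?S"
        using T SS by (intro emeasure_subadditive) auto
      also have "\<dots> \<le> ennreal e + ennreal m"
        using T SS mS by (intro add_mono) (auto simp: emeasure_completion less_imp_le)
      finally have TT: "emeasure lborel T \<le> ennreal (e + m)"
        using e by (simp add: m_def ennreal_plus[symmetric] del: ennreal_plus)
      have "emeasure lborel (g ` ?S) \<le> ennreal a * emeasure lborel T"
        using B[OF T(1,2)] SS by (simp add: emM)
      also have "\<dots> \<le> ennreal a * ennreal (e + m)"
        using TT by (intro mult_left_mono) auto
      also have "\<dots> = ennreal (a * (e + m))"
        using e b_pos by (simp add: ennreal_mult m_def)
      finally have le: "emeasure lborel (g ` ?S) \<le> ennreal (a * (e + m))" .
      then have "ennreal \<nu> \<le> ennreal (a * (e + m))"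
        unfolding \<nu>_def using emeasure_eq_ennreal_measure[of lborel "g ` ?S"] by (metis ennreal_less_top le_less_trans less_top)
      then show "\<nu> \<le> a * m + a * e"
        using e b_pos by (subst (asm) ennreal_le_iff) (auto simp: m_def algebra_simps)
      have fin2: "emeasure lborel (g ` ?S) = ennreal \<nu>"
        unfolding \<nu>_def using le by (metis emeasure_eq_ennreal_measure ennreal_less_top le_less_trans less_top)
      have "g ` ?S \<in> sets lebesgue" using gS by auto
      then obtain V where V: "open V" "g ` ?S \<subseteq> V" "emeasure lebesgue (V - g ` ?S) < e"
        using sets_lebesgue_outer_open[OF _ e, of "g ` ?S"] by metis
      have gV: "g ` (g -` V) = V" using surj by auto
      have oV: "open (g -` V)"
        using V(1) cont[of UNIV] by (simp add: continuous_on_open_vimage)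
      have "emeasure lborel ?S \<le> ennreal (1/b) * emeasure M (g -` V)"
        using V(2) oV by (intro A) auto
      also have "emeasure M (g -` V) = emeasure lborel V"
        using emM[of "g -` V"] oV gV by simp
      also have "emeasure lborel V \<le> ennreal e + ennreal \<nu>"
      proof -
        have "emeasure lborel V \<le> emeasure lborel ((V - g ` ?S) \<union> g ` ?S)"
          using V gS by (intro emeasure_mono) auto
        also have "\<dots> \<le> emeasure lborel (V - g ` ?S) + emeasure lborel (g ` ?S)"
          using V gS by (intro emeasure_subadditive) auto
        also have "\<dots> \<le> ennreal e + ennreal \<nu>"
          using V gS fin2 by (intro add_mono) (auto simp: emeasure_completion less_imp_le)
        finally show ?thesis .
      qed
      also have "ennreal e + ennreal \<nu> = ennreal (e + \<nu>)"
        using e by (simp add: \<nu>_def)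
      finally have "ennreal m \<le> ennreal (1/b) * ennreal (e + \<nu>)"
        unfolding mS by (simp add: mult_left_mono)
      also have "\<dots> = ennreal (1/b * (e + \<nu>))"
        by (rule ennreal_mult[symmetric]) (use e b1 in \<open>auto simp: \<nu>_def\<close>)
      finally have "m \<le> 1/b * (e + \<nu>)"
        using e b1 by (subst (asm) ennreal_le_iff) (auto simp: \<nu>_def)
      then show "b * m \<le> \<nu> + e" using b1 by (simp add: field_simps)
    qed
    have *: "(b - a) * m \<le> (a + 1) * e" if "e > 0" for e
    proof -
      have "b * m \<le> a * m + a * e + e" using est[OF that] by linarith
      then show ?thesis by (simp add: algebra_simps)
    qed
    have "(b - a) * m \<le> 0"
    proof (rule field_le_epsilon)
      fix e :: real assume "e > 0"
      then show "(b - a) * m \<le> 0 + e" using *[of "e / (a+1)"] b_pos by auto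
    qed
    moreover have "0 \<le> m" by (simp add: m_def)
    ultimately have "m = 0" using ab by (simp add: mult_le_0_iff)
    then show ?thesis using SS mS
      by (simp add: negligible_iff_emeasure0 emeasure_completion)
  qed simp
  then have "negligible (\<Union>n::nat. S \<inter> box (- real n) (real n))"
    by (intro negligible_countable_Union) auto
  moreover have "S \<subseteq> (\<Union>n::nat. S \<inter> box (- real n) (real n))"
  proof
    fix x assume "x \<in> S"
    moreover obtain n :: nat where "\<bar>x\<bar> < real n" using reals_Archimedean2 by blast
    ultimately show "x \<in> (\<Union>n::nat. S \<inter> box (- real n) (real n))"
      by (auto intro!: exI[of _ n])
  qed
  ultimately show ?thesis by (rule negligible_subset)
qed

text \<open>A difference quotient at \<open>x\<close> belongs to an interval that has
  \<open>x\<close> as an endpoint, while the covering argument needs \<open>x\<close> strictly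
  inside. Continuity of \<open>g\<close> and openness of \<open>P\<close> allow that endpoint to be
  moved slightly beyond \<open>x\<close>.\<close>

lemma frequently_extend_interval:
  fixes g :: "real \<Rightarrow> real"
  assumes cont: "isCont g x" and freq: "\<exists>\<^sub>F y in at x. P ((g y - g x) / (y - x))"
    and P: "open {q. P q}" and d: "0 < d"
  shows "\<exists>s t. s < x \<and> x < t \<and> t - s < d \<and> P ((g t - g s) / (t - s))"
proof -
  have "\<exists>\<^sub>F y in at x. P ((g y - g x) / (y - x)) \<and> y \<noteq> x \<and> dist y x < d"
    by (rule frequently_rev_mp[OF freq]) (use d in \<open>auto simp: eventually_at\<close>)
  then obtain y where y: "P ((g y - g x) / (y - x))" "y \<noteq> x" "dist y x < d"
    using frequently_ex by blast
  have "((\<lambda>z. (g y - g z) / (y - z)) \<longlongrightarrow> (g y - g x) / (y - x)) (at x)"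
    using cont y(2) by (intro tendsto_intros) (auto simp: isCont_def)
  then have ev1: "\<forall>\<^sub>F z in at x. P ((g y - g z) / (y - z))"
    using P y(1) unfolding tendsto_def by auto
  have "((\<lambda>z. dist y z) \<longlongrightarrow> dist y x) (at x)" by (intro tendsto_intros)
  then have ev2: "\<forall>\<^sub>F z in at x. dist y z < d"
    using y(3) by (simp add: order_tendsto_iff)
  show ?thesis
  proof (cases "x < y")
    case True
    have "\<forall>\<^sub>F z in at_left x. z < x \<and> P ((g y - g z) / (y - z)) \<and> dist y z < d"
      using ev1 ev2
      by (intro eventually_conj) (auto simp: eventually_at_filter elim: eventually_mono)
    then obtain z where "z < x" "P ((g y - g z) / (y - z))" "dist y z < d"
      using eventually_happens'[OF trivial_limit_at_left_real] by blast
    then show ?thesis using True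
      by (intro exI[of _ z] exI[of _ y]) (auto simp: dist_real_def)
  next
    case False
    then have "y < x" using y(2) by auto
    have "\<forall>\<^sub>F z in at_right x. x < z \<and> P ((g y - g z) / (y - z)) \<and> dist y z < d"
      using ev1 ev2
      by (intro eventually_conj) (auto simp: eventually_at_filter elim: eventually_mono)
    then obtain z where z: "x < z" "P ((g y - g z) / (y - z))" "dist y z < d"
      using eventually_happens'[OF trivial_limit_at_right_real] by blast
    moreover have "(g y - g z) / (y - z) = (g z - g y) / (z - y)"
      by (metis minus_diff_eq minus_divide_divide)
    ultimately show ?thesis using \<open>y < x\<close>
      by (intro exI[of _ y] exI[of _ z]) (auto simp: dist_real_def)
  qed
qed

text \<open>Where the bounded difference quotient has no limit, its lower limit is less than its
  upper limit. Rationals \<open>a < b\<close> strictly between them put the point into one of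
  countably many negligible sets of oscillating slopes.\<close>

lemma negligible_not_differentiable_real:
  fixes f :: "real \<Rightarrow> real"
  assumes lip: "L-lipschitz_on UNIV f"
  shows "negligible {x. \<not> f differentiable at x}"
proof -
  \<comment> \<open>Slopes of \<open>f\<close> lie in [-L, L]; adding \<open>L + 1\<close> moves
    them into [1, 2 L + 1] without affecting differentiability.\<close>
  define g where "g x = f x + (L + 1) * x" for x
  have fl: "\<bar>f t - f s\<bar> \<le> L * \<bar>t - s\<bar>" for s t
    using lip by (auto simp: lipschitz_on_def dist_real_def)
  have L: "0 \<le> L" using lip by (simp add: lipschitz_on_def)
  have lower: "t - s \<le> g t - g s" if "s \<le> t" for s t
    using fl[of t s] that by (simp add: g_def algebra_simps)
  have glip: "(2 * L + 1)-lipschitz_on UNIV g"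
  proof (rule lipschitz_onI)
    fix x y
    have "\<bar>g x - g y\<bar> \<le> \<bar>f x - f y\<bar> + \<bar>(L + 1) * (x - y)\<bar>"
      by (simp add: g_def algebra_simps)
    also have "\<dots> \<le> L * \<bar>x - y\<bar> + (L + 1) * \<bar>x - y\<bar>"
      using fl[of x y] L by (simp add: abs_mult)
    finally show "dist (g x) (g y) \<le> (2 * L + 1) * dist x y"
      by (simp add: dist_real_def algebra_simps)
  qed (use L in auto)
  have gcont: "isCont g x" for x
    using lipschitz_on_continuous_on[OF glip] by (simp add: continuous_on_eq_continuous_at)
  define S where "S a b = {x. \<forall>d>0. (\<exists>s t. s < x \<and> x < t \<and> t - s < d \<and> g t - g s < a * (t - s)) \<and>
                          (\<exists>s t. s < x \<and> x < t \<and> t - s < d \<and> b * (t - s) < g t - g s)}" for a b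
  have neg: "negligible (S a b)" if "a < b" for a b
    unfolding S_def by (rule negligible_oscillating_slopes[OF lower glip that])
  have "negligible (\<Union>(a,b)\<in>{(a,b)\<in>\<rat>\<times>\<rat>. a < b}. S a b)"
  proof (rule negligible_countable_Union[OF countable_image])
    show "countable {(a,b)\<in>\<rat>\<times>\<rat>. (a::real) < b}"
      by (rule countable_subset[of _ "\<rat>\<times>\<rat>"]) (auto intro: countable_rat)
  qed (auto intro: neg)
  moreover have "{x. \<not> f differentiable at x} \<subseteq> (\<Union>(a,b)\<in>{(a,b)\<in>\<rat>\<times>\<rat>. a < b}. S a b)"
  proof
    fix x assume "x \<in> {x. \<not> f differentiable at x}"
    then have nf: "\<not> f differentiable at x" by simp
    define q where "q y = (g y - g x) / (y - x)" for y
    \<comment> \<open>At \<open>y = x\<close> division by zero makes \<open>q\<close> vanish, so the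
      bounds hold for every \<open>y\<close> and pass to the lower and upper limits.\<close>
    have qb: "q y \<le> 2 * L + 1 \<and> - (2 * L + 1) \<le> q y" for y
    proof (cases "y = x")
      case False
      have "\<bar>g y - g x\<bar> \<le> (2 * L + 1) * \<bar>y - x\<bar>"
        using glip by (auto simp: lipschitz_on_def dist_real_def)
      then have "\<bar>q y\<bar> \<le> 2 * L + 1" using False by (simp add: q_def abs_divide divide_le_eq)
      then show ?thesis by linarith
    qed (use L in \<open>simp add: q_def\<close>)
    have nq: "\<not> (q \<longlongrightarrow> l) (at x)" for l
    proof
      assume "(q \<longlongrightarrow> l) (at x)"
      then have "(g has_field_derivative l) (at x)"
        by (simp add: has_field_derivative_iff q_def[abs_def])
      then have "((\<lambda>x. g x - (L + 1) * x) has_field_derivative l - (L + 1)) (at x)"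
        by (auto intro!: derivative_eq_intros)
      then show False using nf
        by (auto simp: g_def[abs_def] has_field_derivative_def differentiable_def)
    qed
    let ?q = "\<lambda>y. ereal (q y)"
    have "Liminf (at x) ?q < Limsup (at x) ?q"
    proof (rule ccontr)
      assume "\<not> ?thesis"
      then have eq: "Liminf (at x) ?q = Limsup (at x) ?q"
        using Liminf_le_Limsup[of "at x" ?q] by auto
      then have lim: "(?q \<longlongrightarrow> Limsup (at x) ?q) (at x)"
        by (intro Liminf_eq_Limsup) auto
      moreover have "Limsup (at x) ?q \<le> ereal (2 * L + 1)"
        by (intro Limsup_bounded always_eventually) (use qb in auto)
      moreover have "ereal (- (2 * L + 1)) \<le> Liminf (at x) ?q"
        by (intro Liminf_bounded always_eventually) (use qb in \<open>simp only: ereal_less_eq(3) simp_thms\<close>)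
      ultimately show False using nq eq
        by (cases "Limsup (at x) ?q") auto
    qed
    then obtain b' where b': "Liminf (at x) ?q < ereal b'" "ereal b' < Limsup (at x) ?q"
      using ereal_dense2 by blast
    obtain a' where a': "Liminf (at x) ?q < ereal a'" "ereal a' < ereal b'"
      using ereal_dense2[OF b'(1)] by blast
    obtain c' where c': "ereal b' < ereal c'" "ereal c' < Limsup (at x) ?q"
      using ereal_dense2[OF b'(2)] by blast
    obtain a where a: "a \<in> \<rat>" "a' < a" "a < b'" using a' Rats_dense_in_real[of a' b'] by auto
    obtain b where b: "b \<in> \<rat>" "b' < b" "b < c'" using c' Rats_dense_in_real[of b' c'] by auto
    have f1: "\<exists>\<^sub>F y in at x. q y < a"
    proof (rule ccontr)
      assume "\<not> ?thesis"
      then have "\<forall>\<^sub>F y in at x. ereal a \<le> ?q y" by (simp add: not_frequently not_less)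
      then have "ereal a \<le> Liminf (at x) ?q" by (rule Liminf_bounded)
      also have "\<dots> < ereal a'" by (rule a')
      finally show False using a by auto
    qed
    have f2: "\<exists>\<^sub>F y in at x. b < q y"
    proof (rule ccontr)
      assume "\<not> ?thesis"
      then have "\<forall>\<^sub>F y in at x. ?q y \<le> ereal b" by (simp add: not_frequently not_less)
      then have "Limsup (at x) ?q \<le> ereal b" by (rule Limsup_bounded)
      then have "ereal c' < ereal b" using c'(2) by (rule less_le_trans[rotated])
      then show False using b by auto
    qed
    have "x \<in> S a b"
      unfolding S_def
    proof (intro CollectI allI impI conjI)
      fix d :: real assume d: "0 < d"
      have "open {q. q < a}" "open {q. b < q}"
        by (auto intro: open_Collect_less continuous_intros)
      with frequently_extend_interval[OF gcont f1[unfolded q_def] _ d]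
           frequently_extend_interval[OF gcont f2[unfolded q_def] _ d]
      obtain s t s' t' where
         "s < x" "x < t" "t - s < d" "(g t - g s) / (t - s) < a"
         "s' < x" "x < t'" "t' - s' < d" "b < (g t' - g s') / (t' - s')"
        by blast
      then show "\<exists>s t. s < x \<and> x < t \<and> t - s < d \<and> g t - g s < a * (t - s)"
         "\<exists>s t. s < x \<and> x < t \<and> t - s < d \<and> b * (t - s) < g t - g s"
        by (simp_all add: divide_less_eq less_divide_eq) blast+
    qed
    moreover have "a < b" using a b by auto
    ultimately show "x \<in> (\<Union>(a,b)\<in>{(a,b)\<in>\<rat>\<times>\<rat>. a < b}. S a b)"
      using a b by blast
  qed
  ultimately show ?thesis by (rule negligible_subset)
qed

section \<open>Rademacher's theorem\<close>

lemma nn_integral_lborel_translation: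
  fixes f :: "'a::euclidean_space \<Rightarrow> ennreal"
  assumes [measurable]: "f \<in> borel_measurable borel"
  shows "(\<integral>\<^sup>+x. f (x + c) \<partial>lborel) = (\<integral>\<^sup>+x. f x \<partial>lborel)"
proof -
  have "(\<integral>\<^sup>+x. f x \<partial>lborel) = (\<integral>\<^sup>+x. f x \<partial>distr lborel borel ((+) c))"
    by (simp add: lborel_distr_plus)
  also have "\<dots> = (\<integral>\<^sup>+x. f (c + x) \<partial>lborel)"
    by (subst nn_integral_distr) auto
  finally show ?thesis by (simp add: add.commute)
qed

lemma integral_lborel_translation:
  fixes f :: "'a::euclidean_space \<Rightarrow> real"
  assumes [measurable]: "f \<in> borel_measurable borel"
  shows "(\<integral>x. f (x + c) \<partial>lborel) = (\<integral>x. f x \<partial>lborel)"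
proof -
  have "(\<integral>x. f x \<partial>lborel) = (\<integral>x. f x \<partial>distr lborel borel ((+) c))"
    by (simp add: lborel_distr_plus)
  also have "\<dots> = (\<integral>x. f (c + x) \<partial>lborel)"
    by (subst integral_distr) auto
  finally show ?thesis by (simp add: add.commute)
qed

text \<open>Averaging the indicator of \<open>N\<close> over the translations by \<open>t *\<^sub>R v\<close>, \<open>0 \<le> t \<le> 1\<close>, replaces
  the usual decomposition of the space into lines parallel to \<open>v\<close>.\<close>

lemma null_set_of_null_on_lines:
  fixes N :: "'a::euclidean_space set"
  assumes N [measurable]: "N \<in> sets borel"
    and lines: "\<And>x. negligible {t::real. x + t *\<^sub>R v \<in> N}"
  shows "N \<in> null_sets lborel"
proof -
  let ?g = "\<lambda>x t. indicator {0..1::real} t * (indicator N (x + t *\<^sub>R v) :: ennreal)"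
  have "emeasure lborel N = (\<integral>\<^sup>+t. indicator {0..1::real} t * emeasure lborel N \<partial>lborel)"
    by (simp add: nn_integral_multc)
  also have "\<dots> = (\<integral>\<^sup>+t. (\<integral>\<^sup>+x. ?g x t \<partial>lborel) \<partial>lborel)"
  proof (rule nn_integral_cong)
    fix t :: real
    have "(\<integral>\<^sup>+x. indicator N (x + t *\<^sub>R v) \<partial>lborel) = emeasure lborel N"
      using nn_integral_lborel_translation[of "indicator N" "t *\<^sub>R v"] by simp
    then show "indicator {0..1::real} t * emeasure lborel N = (\<integral>\<^sup>+x. ?g x t \<partial>lborel)"
      by (subst nn_integral_cmult) auto
  qed
  also have "\<dots> = (\<integral>\<^sup>+x. (\<integral>\<^sup>+t. ?g x t \<partial>lborel) \<partial>lborel)"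
    by (rule lborel_pair.Fubini') measurable
  also have "\<dots> = (\<integral>\<^sup>+x. 0 \<partial>(lborel :: 'a measure))"
  proof (rule nn_integral_cong)
    fix x :: 'a
    have b: "{t::real. x + t *\<^sub>R v \<in> N} \<in> sets borel"
      by measurable
    then have "{t::real. x + t *\<^sub>R v \<in> N} \<in> null_sets lborel"
      using lines[of x] by (auto simp: null_sets_def negligible_iff_emeasure0 emeasure_completion)
    then have "AE t in lborel. ?g x t = 0"
      by (rule AE_I') (auto simp: indicator_def split: if_splits)
    then show "(\<integral>\<^sup>+t. ?g x t \<partial>lborel) = 0"
      by (subst nn_integral_0_iff_AE) auto
  qed
  finally show ?thesis by (auto simp: null_sets_def)
qed

text \<open>A signed density is turned into a positive one: \<open>1 + h / K\<close> with
  \<open>K = C + 1\<close> is nonnegative, and the measure with this density agrees with Lebesgue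
  measure on boxes, hence everywhere. Uniqueness of densities then gives
  \<open>1 + h / K = 1\<close> almost everywhere.\<close>

lemma AE_zero_if_box_integrals_zero:
  fixes h :: "'a::euclidean_space \<Rightarrow> real"
  assumes [measurable]: "h \<in> borel_measurable borel"
    and bound: "\<And>x. \<bar>h x\<bar> \<le> C"
    and zero: "\<And>l u. (\<integral>x. indicator (box l u) x * h x \<partial>lborel) = 0"
  shows "AE x in lborel. h x = 0"
proof -
  define K where "K = C + 1"
  have "0 \<le> C" using bound[of undefined] by linarith
  then have K: "0 < K" by (simp add: K_def)
  have nonneg: "0 \<le> 1 + h x / K" for x
    using bound[of x] K by (simp add: K_def field_simps abs_le_iff)
  define M where "M = density lborel (\<lambda>x. ennreal (1 + h x / K))"
  have "lborel = M"
  proof (rule lborel_eqI)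
    fix l u :: 'a assume lu: "\<And>b. b \<in> Basis \<Longrightarrow> l \<bullet> b \<le> u \<bullet> b"
    have i1: "integrable lborel (indicator (box l u) :: 'a \<Rightarrow> real)"
      by (simp add: emeasure_lborel_box_eq)
    have i2: "integrable lborel (\<lambda>x. indicator (box l u) x * h x)"
      by (rule Bochner_Integration.integrable_bound[OF integrable_mult_right[OF i1, of C]])
         (use bound in \<open>auto simp: abs_mult indicator_def intro!: AE_I2 order_trans[OF bound]\<close>)
    have i3: "integrable lborel (\<lambda>x. indicator (box l u) x + (indicator (box l u) x * h x) / K)"
      by (intro Bochner_Integration.integrable_add integrable_divide i1 i2)
    have "emeasure M (box l u) = (\<integral>\<^sup>+x. ennreal (1 + h x / K) * indicator (box l u) x \<partial>lborel)"
      unfolding M_def by (subst emeasure_density) auto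
    also have "\<dots> = (\<integral>\<^sup>+x. ennreal (indicator (box l u) x + (indicator (box l u) x * h x) / K) \<partial>lborel)"
      by (intro nn_integral_cong) (auto simp: indicator_def)
    also have "\<dots> = ennreal (\<integral>x. indicator (box l u) x + (indicator (box l u) x * h x) / K \<partial>lborel)"
      using nonneg by (intro nn_integral_eq_integral[OF i3] AE_I2) (auto simp: indicator_def)
    also have "(\<integral>x. indicator (box l u) x + (indicator (box l u) x * h x) / K \<partial>lborel)
        = measure lborel (box l u)"
      using i1 i2 zero by simp
    finally show "emeasure M (box l u) = (\<Prod>b\<in>Basis. (u - l) \<bullet> b)"
      using lu by (simp add: measure_lborel_box_eq)
  qed (simp add: M_def)
  then have "density lborel (\<lambda>x. 1) = density lborel (\<lambda>x. ennreal (1 + h x / K))"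
    by (simp add: M_def density_1)
  then have "AE x in lborel. 1 = ennreal (1 + h x / K)"
    by (subst (asm) sigma_finite_density_unique) (auto simp: density_1 sigma_finite_lborel)
  then show ?thesis
  proof eventually_elim
    case (elim x)
    then have "1 + h x / K = 1" using nonneg[of x] by (metis ennreal_eq_1)
    then show ?case using K by simp
  qed
qed

section \<open>Directional derivatives of a Lipschitz function\<close>

definition dir_quot :: "('a::real_vector \<Rightarrow> real) \<Rightarrow> 'a \<Rightarrow> real \<Rightarrow> 'a \<Rightarrow> real" where
  "dir_quot f v t x = (f (x + t *\<^sub>R v) - f x) / t"

text \<open>The limit is taken along one sequence, so that it is Borel measurable in
  \<open>x\<close>; where that sequence diverges the value is arbitrary. Almost everywhere it agrees
  with the full limit, by \<open>AE_tendsto_dir_deriv\<close>.\<close>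

definition dir_deriv :: "('a::real_vector \<Rightarrow> real) \<Rightarrow> 'a \<Rightarrow> 'a \<Rightarrow> real" where
  "dir_deriv f v x = lim (\<lambda>k. dir_quot f v (1 / real (Suc k)) x)"

lemma filterlim_inverse_Suc: "filterlim (\<lambda>k. 1 / real (Suc k)) (at 0) sequentially"
  unfolding filterlim_at using LIMSEQ_inverse_real_of_nat by (auto simp: inverse_eq_divide)

lemma dir_deriv_eqI:
  assumes "((\<lambda>t. dir_quot f v t x) \<longlongrightarrow> l) (at 0)"
  shows "dir_deriv f v x = l"
  unfolding dir_deriv_def
  by (rule limI) (rule filterlim_compose[OF assms filterlim_inverse_Suc])

context
  fixes f :: "'a::euclidean_space \<Rightarrow> real" and L :: real
  assumes lip: "L-lipschitz_on UNIV f"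
begin

lemma lipschitz_bound: "\<bar>f x - f y\<bar> \<le> L * norm (x - y)"
  using lip by (auto simp: lipschitz_on_def dist_norm)

lemma lipschitz_measurable [measurable]: "f \<in> borel_measurable borel"
  using lip lipschitz_on_continuous_on borel_measurable_continuous_onI by blast

lemma dir_quot_measurable [measurable]: "dir_quot f v t \<in> borel_measurable borel"
  unfolding dir_quot_def[abs_def] by measurable

lemma dir_deriv_measurable [measurable]: "dir_deriv f v \<in> borel_measurable borel"
  unfolding dir_deriv_def[abs_def] by measurable

lemma dir_quot_bound: "\<bar>dir_quot f v t x\<bar> \<le> L * norm v"
proof (cases "t = 0")
  case False
  then show ?thesis
    using lipschitz_bound[of "x + t *\<^sub>R v" x] by (simp add: dir_quot_def abs_divide divide_le_eq mult_ac)
next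
  case True
  then show ?thesis using lip by (simp add: dir_quot_def lipschitz_on_def)
qed

lemma AE_tendsto_dir_deriv:
  "AE x in lborel. ((\<lambda>t. dir_quot f v t x) \<longlongrightarrow> dir_deriv f v x) (at 0)"
proof -
  let ?q = "dir_quot f v"
  \<comment> \<open>The Cauchy condition for the quotients as t \<rightarrow> 0 over all real
    parameters. The non-strict inequality makes each condition closed in \<open>x\<close>, so even
    the uncountable intersections are closed and \<open>G\<close> is Borel. Its complement meets
    every line in direction \<open>v\<close> in points where the restriction of \<open>f\<close> is
    not differentiable, which the one-dimensional theorem shows to be negligible.\<close>
  define G where "G = (\<Inter>n. \<Union>m. \<Inter>s\<in>{s. s \<noteq> 0 \<and> \<bar>s\<bar> < 1 / real (Suc m)}. \<Inter>t\<in>{t. t \<noteq> 0 \<and> \<bar>t\<bar> < 1 / real (Suc m)}.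
      {x. \<bar>?q s x - ?q t x\<bar> \<le> 1 / real (Suc n)})"
  have cq: "continuous_on UNIV (?q t)" for t
  proof -
    have cf: "continuous_on A f" for A
      using lip lipschitz_on_continuous_on lipschitz_on_subset by blast
    have "continuous_on UNIV (\<lambda>x. f (x + t *\<^sub>R v))"
      by (rule continuous_on_compose2[OF cf[of UNIV]]) (auto intro: continuous_intros)
    then show ?thesis unfolding dir_quot_def[abs_def] divide_inverse
      by (intro continuous_intros cf)
  qed
  have "closed {x. \<bar>?q s x - ?q t x\<bar> \<le> e}" for s t e
    by (intro closed_Collect_le continuous_intros cq)
  then have "closed (\<Inter>s\<in>A. \<Inter>t\<in>A. {x. \<bar>?q s x - ?q t x\<bar> \<le> e})" for A e
    by blast
  then have G: "G \<in> sets borel"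
    unfolding G_def by (intro sets.countable_INT' sets.countable_UN' borel_closed) auto
  have conv: "((\<lambda>t. ?q t x) \<longlongrightarrow> dir_deriv f v x) (at 0)" if x: "x \<in> G" for x
  proof -
    have cauchy: "\<exists>d>0. \<forall>s t. s \<noteq> 0 \<and> \<bar>s\<bar> < d \<and> t \<noteq> 0 \<and> \<bar>t\<bar> < d \<longrightarrow> \<bar>?q s x - ?q t x\<bar> < e" if e: "e > 0" for e
    proof -
      obtain n where n: "1 / real (Suc n) < e" using nat_approx_posE[OF e] by auto
      obtain m where "\<forall>s t. s \<noteq> 0 \<and> \<bar>s\<bar> < 1 / real (Suc m) \<and> t \<noteq> 0 \<and> \<bar>t\<bar> < 1 / real (Suc m)
          \<longrightarrow> \<bar>?q s x - ?q t x\<bar> \<le> 1 / real (Suc n)"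
        using x unfolding G_def by fastforce
      then show ?thesis using n
        by (intro exI[of _ "1 / real (Suc m)"]) force
    qed
    let ?s = "\<lambda>k. ?q (1 / real (Suc k)) x"
    have small: "\<forall>\<^sub>F k in sequentially. 1 / real (Suc k) \<noteq> 0 \<and> \<bar>1 / real (Suc k)\<bar> < d" if "d > 0" for d
      using filterlim_inverse_Suc that
      by (auto simp: filterlim_at tendsto_iff dist_real_def)
    have "Cauchy ?s"
    proof (rule metric_CauchyI)
      fix e :: real assume e: "0 < e"
      obtain d where d: "d > 0" and
        *: "\<forall>s t. s \<noteq> 0 \<and> \<bar>s\<bar> < d \<and> t \<noteq> 0 \<and> \<bar>t\<bar> < d \<longrightarrow> \<bar>?q s x - ?q t x\<bar> < e"
        using cauchy[OF e] by metis
      obtain N where "\<And>k. k \<ge> N \<Longrightarrow> 1 / real (Suc k) \<noteq> 0 \<and> \<bar>1 / real (Suc k)\<bar> < d"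
        using small[OF d] unfolding eventually_sequentially by blast
      then show "\<exists>M. \<forall>m\<ge>M. \<forall>n\<ge>M. dist (?s m) (?s n) < e"
        unfolding dist_real_def by (intro exI[of _ N] allI impI *[rule_format] conjI) auto
    qed
    then have lim: "?s \<longlonglongrightarrow> dir_deriv f v x"
      unfolding dir_deriv_def by (simp add: Cauchy_convergent_iff convergent_LIMSEQ_iff)
    show ?thesis
    proof (rule tendstoI)
      fix e :: real assume e: "0 < e"
      then have e2: "0 < e / 2" by simp
      obtain d where d: "d > 0" and
        *: "\<forall>s t. s \<noteq> 0 \<and> \<bar>s\<bar> < d \<and> t \<noteq> 0 \<and> \<bar>t\<bar> < d \<longrightarrow> \<bar>?q s x - ?q t x\<bar> < e / 2"
        using cauchy[OF e2] by metis
      have "\<forall>\<^sub>F k in sequentially. dist (?s k) (dir_deriv f v x) < e/2"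
        using lim e2 by (rule tendstoD)
      from eventually_happens'[OF sequentially_bot eventually_conj[OF this small[OF d]]]
      obtain k where k: "\<bar>?s k - dir_deriv f v x\<bar> < e/2" "\<bar>1 / real (Suc k)\<bar> < d" "1 / real (Suc k) \<noteq> 0"
        unfolding dist_real_def by blast
      have "dist (?q t x) (dir_deriv f v x) < e" if "t \<noteq> 0" "\<bar>t\<bar> < d" for t
        using *[rule_format, of t "1 / real (Suc k)"] that k unfolding dist_real_def by argo
      then show "\<forall>\<^sub>F t in at 0. dist (?q t x) (dir_deriv f v x) < e"
        using d by (auto simp: eventually_at)
    qed
  qed
  have "- G \<in> null_sets lborel"
  proof (rule null_set_of_null_on_lines)
    fix x :: 'a
    let ?\<phi> = "\<lambda>t. f (x + t *\<^sub>R v)"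
    have "(L * norm v)-lipschitz_on UNIV ?\<phi>"
    proof (rule lipschitz_onI)
      fix s t :: real
      have "dist (?\<phi> s) (?\<phi> t) \<le> L * norm ((s - t) *\<^sub>R v)"
        using lipschitz_bound[of "x + s *\<^sub>R v" "x + t *\<^sub>R v"] by (simp add: dist_real_def algebra_simps)
      then show "dist (?\<phi> s) (?\<phi> t) \<le> L * norm v * dist s t"
        by (simp add: dist_real_def mult_ac)
    qed (use lip in \<open>simp add: lipschitz_on_def\<close>)
    then have "negligible {t. \<not> ?\<phi> differentiable at t}"
      by (rule negligible_not_differentiable_real)
    moreover have "x + t *\<^sub>R v \<in> G" if d: "?\<phi> differentiable at t" for t
    proof -
      obtain l where "(?\<phi> has_real_derivative l) (at t)"
        using d real_differentiable_def by blast
      then have lim: "((\<lambda>h. ?q h (x + t *\<^sub>R v)) \<longlongrightarrow> l) (at 0)"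
        by (simp add: DERIV_def dir_quot_def algebra_simps)
      show ?thesis
        unfolding G_def
      proof (intro INT_I)
        fix n :: nat
        have "\<forall>\<^sub>F h in at 0. dist (?q h (x + t *\<^sub>R v)) l < 1 / real (Suc n) / 2"
          using lim by (rule tendstoD) simp
        then obtain d where d: "d > 0" "\<And>h. h \<noteq> 0 \<Longrightarrow> \<bar>h\<bar> < d \<Longrightarrow> \<bar>?q h (x + t *\<^sub>R v) - l\<bar> < 1 / real (Suc n) / 2"
          by (auto simp: eventually_at dist_real_def)
        obtain m where m: "1 / real (Suc m) < d" using nat_approx_posE[OF d(1)] by auto
        have "\<bar>?q s (x + t *\<^sub>R v) - ?q s' (x + t *\<^sub>R v)\<bar> \<le> 1 / real (Suc n)"
          if "s \<noteq> 0" "\<bar>s\<bar> < 1 / real (Suc m)" "s' \<noteq> 0" "\<bar>s'\<bar> < 1 / real (Suc m)" for s s'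
        proof -
          have "\<bar>s\<bar> < d" "\<bar>s'\<bar> < d" using that m by linarith+
          moreover have "\<bar>p - r\<bar> < c / 2 \<Longrightarrow> \<bar>q - r\<bar> < c / 2 \<Longrightarrow> \<bar>p - q\<bar> \<le> c" for p q r c :: real
            by linarith
          ultimately show ?thesis using d(2) that(1,3) by blast
        qed
        then show "x + t *\<^sub>R v \<in> (\<Union>m. \<Inter>s\<in>{s. s \<noteq> 0 \<and> \<bar>s\<bar> < 1 / real (Suc m)}. \<Inter>t\<in>{t. t \<noteq> 0 \<and> \<bar>t\<bar> < 1 / real (Suc m)}.
          {x. \<bar>?q s x - ?q t x\<bar> \<le> 1 / real (Suc n)})"
          by blast
      qed
    qed
    ultimately show "negligible {t. x + t *\<^sub>R v \<in> - G}"
      by (elim negligible_subset) auto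
  qed (use G in auto)
  then show ?thesis
    by (rule AE_I') (use conv in auto)
qed

lemma AE_dir_deriv_bound: "AE x in lborel. \<bar>dir_deriv f v x\<bar> \<le> L * norm v"
  using AE_tendsto_dir_deriv[of v]
proof eventually_elim
  case (elim x)
  have "((\<lambda>t. \<bar>dir_quot f v t x\<bar>) \<longlongrightarrow> \<bar>dir_deriv f v x\<bar>) (at 0)"
    using elim by (intro tendsto_intros)
  then show ?case
    by (rule tendsto_upperbound) (auto simp: dir_quot_bound)
qed

text \<open>Dominated convergence. The weights may vary with \<open>k\<close>, because the indicator
  of a box is later translated by a vector that tends to 0.\<close>

lemma integral_dir_deriv_lim:
  fixes g :: "nat \<Rightarrow> 'a \<Rightarrow> real"
  assumes [measurable]: "\<And>k. g k \<in> borel_measurable borel" "g' \<in> borel_measurable borel"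
    and lim: "AE x in lborel. (\<lambda>k. g k x) \<longlonglongrightarrow> g' x"
    and bd: "\<And>k x. \<bar>g k x\<bar> \<le> indicator (cball 0 R) x"
  shows "(\<lambda>k. \<integral>x. g k x * dir_quot f v (1 / real (Suc k)) x \<partial>lborel) \<longlonglongrightarrow> (\<integral>x. g' x * dir_deriv f v x \<partial>lborel)"
proof (rule integral_dominated_convergence)
  show "AE x in lborel. (\<lambda>k. g k x * dir_quot f v (1 / real (Suc k)) x) \<longlonglongrightarrow> g' x * dir_deriv f v x"
    using lim AE_tendsto_dir_deriv[of v]
  proof eventually_elim
    case (elim x)
    show ?case
      by (intro tendsto_mult elim(1) filterlim_compose[OF elim(2) filterlim_inverse_Suc])
  qed
  show "AE x in lborel. norm (g k x * dir_quot f v (1 / real (Suc k)) x) \<le> indicator (cball 0 R) x * (L * norm v)" for k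
    by (intro AE_I2) (use bd dir_quot_bound in \<open>simp add: abs_mult mult_mono\<close>)
  show "integrable lborel (\<lambda>x. indicator (cball 0 R :: 'a set) x * (L * norm v))"
    by (intro integrable_mult_left integrable_real_indicator) (use emeasure_bounded_finite[OF bounded_cball, of 0 R] in auto)
qed measurable

text \<open>The increment along \<open>v + w\<close> is the increment along \<open>v\<close> from
  \<open>x\<close> plus the increment along \<open>w\<close> from \<open>x + t *\<^sub>R v\<close>.
  Integrated over a box, the displacement of the base point can be moved to the box by translation
  invariance, and it disappears in the limit. Hence the additivity defect has zero integral over
  every box.\<close>

lemma AE_dir_deriv_add:
  "AE x in lborel. dir_deriv f (v + w) x = dir_deriv f v x + dir_deriv f w x"
proof -
  let ?D = "dir_deriv f" and ?t = "\<lambda>k. 1 / real (Suc k)"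
  define h where "h x = ?D (v + w) x - ?D v x - ?D w x" for x
  define C where "C = L * norm (v + w) + L * norm v + L * norm w"
  \<comment> \<open>The bound on \<open>dir_deriv\<close> holds only almost everywhere, while
    \<open>AE_zero_if_box_integrals_zero\<close> asks for one everywhere; truncation changes
    \<open>h\<close> on a null set only.\<close>
  define h' where "h' x = max (- C) (min C (h x))" for x
  have [measurable]: "h \<in> borel_measurable borel" "h' \<in> borel_measurable borel"
    unfolding h_def[abs_def] h'_def[abs_def] by measurable
  have "0 \<le> C" using lip by (simp add: C_def lipschitz_on_def)
  have eq: "AE x in lborel. h' x = h x"
    using AE_dir_deriv_bound[of "v + w"] AE_dir_deriv_bound[of v] AE_dir_deriv_bound[of w]
    by eventually_elim (simp add: h'_def h_def C_def)
  have zero: "(\<integral>x. indicator (box l u) x * h' x \<partial>lborel) = 0" for l u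
  proof -
    let ?B = "box l u"
    obtain r where r: "?B \<subseteq> cball 0 r"
      using bounded_subset_ballD[OF bounded_box, of l u 0] ball_subset_cball by blast
    have int: "integrable lborel (\<lambda>x. indicator ?B x * ?D z x)" for z
    proof (rule Bochner_Integration.integrable_bound[where f="\<lambda>x. indicator ?B x * (L * norm z)"])
      show "AE x in lborel. norm (indicator ?B x * ?D z x) \<le> norm (indicator ?B x * (L * norm z))"
        using AE_dir_deriv_bound[of z] by eventually_elim (auto simp: indicator_def)
    qed (auto simp: emeasure_lborel_box_eq)
    have qint: "integrable lborel (\<lambda>x. indicator ?B x * dir_quot f z (?t k) (x + c))" for z k c
    proof (rule Bochner_Integration.integrable_bound[where f="\<lambda>x. indicator ?B x * (L * norm z)"])
      show "AE x in lborel. norm (indicator ?B x * dir_quot f z (?t k) (x + c)) \<le> norm (indicator ?B x * (L * norm z))"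
        by (intro AE_I2) (auto simp: indicator_def intro: order_trans[OF dir_quot_bound abs_ge_self])
    qed (auto simp: emeasure_lborel_box_eq)
    have base: "(\<lambda>k. \<integral>x. indicator ?B x * dir_quot f z (?t k) x \<partial>lborel) \<longlonglongrightarrow> (\<integral>x. indicator ?B x * ?D z x \<partial>lborel)" for z
      by (rule integral_dir_deriv_lim[where R=r]) (use r in \<open>auto simp: indicator_def\<close>)
    have shifted: "(\<lambda>k. \<integral>x. indicator ?B x * dir_quot f w (?t k) (x + ?t k *\<^sub>R v) \<partial>lborel) \<longlonglongrightarrow> (\<integral>x. indicator ?B x * ?D w x \<partial>lborel)"
    proof -
      have "(\<integral>x. indicator ?B x * dir_quot f w (?t k) (x + ?t k *\<^sub>R v) \<partial>lborel)
          = (\<integral>x. indicator ?B (x - ?t k *\<^sub>R v) * dir_quot f w (?t k) x \<partial>lborel)" for k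
        using integral_lborel_translation[of "\<lambda>x. indicator ?B (x - ?t k *\<^sub>R v) * dir_quot f w (?t k) x" "?t k *\<^sub>R v"]
        by (simp del: of_nat_Suc)
      moreover have "(\<lambda>k. \<integral>x. indicator ?B (x - ?t k *\<^sub>R v) * dir_quot f w (?t k) x \<partial>lborel) \<longlonglongrightarrow> (\<integral>x. indicator ?B x * ?D w x \<partial>lborel)"
      proof (rule integral_dir_deriv_lim[where R="r + norm v"])
        \<comment> \<open>Off the frontier of the box its indicator is locally constant, so the
          translated indicators converge there.\<close>
        have "negligible (frontier ?B)" by (simp add: negligible_convex_frontier)
        then have "frontier ?B \<in> null_sets lborel"
          by (auto simp: null_sets_def negligible_iff_emeasure0 emeasure_completion)
        then show "AE x in lborel. (\<lambda>k. indicator ?B (x - ?t k *\<^sub>R v)) \<longlonglongrightarrow> (indicator ?B x :: real)"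
        proof (rule AE_I', safe)
          fix x assume nc: "\<not> (\<lambda>k. indicator ?B (x - ?t k *\<^sub>R v)) \<longlonglongrightarrow> (indicator ?B x :: real)"
          show "x \<in> frontier ?B"
          proof (rule ccontr)
            assume "x \<notin> frontier ?B"
            then consider "x \<in> interior ?B" | "x \<in> interior (- ?B)"
              by (auto simp: frontier_def interior_complement)
            then have "\<forall>\<^sub>F y in nhds x. indicator ?B y = (indicator ?B x :: real)"
            proof cases
              case 1
              then show ?thesis
                using interior_subset by (intro eventually_nhds_in_open[THEN eventually_mono, OF open_interior 1]) (auto simp: indicator_def)
            next
              case 2
              then show ?thesis
                using interior_subset by (intro eventually_nhds_in_open[THEN eventually_mono, OF open_interior 2]) (auto simp: indicator_def)
            qed
            moreover have "(\<lambda>k. x - ?t k *\<^sub>R v) \<longlonglongrightarrow> x - 0 *\<^sub>R v"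
              using filterlim_inverse_Suc by (intro tendsto_intros) (simp add: filterlim_at)
            ultimately have "\<forall>\<^sub>F k in sequentially. indicator ?B (x - ?t k *\<^sub>R v) = (indicator ?B x :: real)"
              unfolding scaleR_zero_left diff_zero by (rule eventually_compose_filterlim)
            from tendsto_eventually[OF this] nc show False by (rule notE[rotated])
          qed
        qed
        fix k x
        show "\<bar>indicator ?B (x - ?t k *\<^sub>R v) :: real\<bar> \<le> indicator (cball 0 (r + norm v)) x"
        proof (cases "x - ?t k *\<^sub>R v \<in> ?B")
          case True
          then have "norm (x - ?t k *\<^sub>R v) \<le> r" using r by auto
          moreover have "norm (?t k *\<^sub>R v) \<le> norm v"
            by (simp add: divide_le_eq mult_le_cancel_left1 algebra_simps)
          ultimately have "norm x \<le> r + norm v"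
            using norm_triangle_sub[of x "?t k *\<^sub>R v"] by linarith
          then show ?thesis by (simp add: indicator_def)
        qed simp
      qed measurable
      ultimately show ?thesis by simp
    qed
    have "(\<integral>x. indicator ?B x * dir_quot f (v + w) (?t k) x \<partial>lborel) =
        (\<integral>x. indicator ?B x * dir_quot f v (?t k) x \<partial>lborel) +
        (\<integral>x. indicator ?B x * dir_quot f w (?t k) (x + ?t k *\<^sub>R v) \<partial>lborel)" for k
    proof -
      have "dir_quot f (v + w) (?t k) x = dir_quot f v (?t k) x + dir_quot f w (?t k) (x + ?t k *\<^sub>R v)" for x
        by (simp add: dir_quot_def add_divide_distrib[symmetric] algebra_simps del: of_nat_Suc)
      then show ?thesis
        using qint[of v k 0] qint[of w k "?t k *\<^sub>R v"]
        by (simp add: distrib_left del: of_nat_Suc)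
    qed
    then have "(\<integral>x. indicator ?B x * ?D (v + w) x \<partial>lborel) =
        (\<integral>x. indicator ?B x * ?D v x \<partial>lborel) + (\<integral>x. indicator ?B x * ?D w x \<partial>lborel)"
      using LIMSEQ_unique[OF base[of "v + w"]] tendsto_add[OF base[of v] shifted] by simp
    then have "(\<integral>x. indicator ?B x * h x \<partial>lborel) = 0"
      using int by (simp add: h_def right_diff_distrib)
    moreover have "(\<integral>x. indicator ?B x * h' x \<partial>lborel) = (\<integral>x. indicator ?B x * h x \<partial>lborel)"
      using eq by (intro integral_cong_AE) auto
    ultimately show ?thesis by simp
  qed
  have "AE x in lborel. h' x = 0"
    by (rule AE_zero_if_box_integrals_zero[where C=C]) (use zero \<open>0 \<le> C\<close> in \<open>auto simp: h'_def\<close>)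
  with eq show ?thesis
    by eventually_elim (simp add: h_def)
qed

lemma AE_dir_deriv_scale: "AE x in lborel. dir_deriv f (c *\<^sub>R v) x = c * dir_deriv f v x"
proof (cases "c = 0")
  case True
  then show ?thesis by (auto simp: dir_deriv_def dir_quot_def)
next
  case False
  show ?thesis
    using AE_tendsto_dir_deriv[of v]
  proof eventually_elim
    case (elim x)
    have "filterlim (\<lambda>t. c * t) (at 0) (at 0)"
      unfolding filterlim_at using False
      by (auto simp: eventually_at intro!: tendsto_eq_intros exI[of _ 1])
    then have "((\<lambda>t. c * dir_quot f v (c * t) x) \<longlongrightarrow> c * dir_deriv f v x) (at 0)"
      by (intro tendsto_mult tendsto_const filterlim_compose[OF elim])
    then have "((\<lambda>t. dir_quot f (c *\<^sub>R v) t x) \<longlongrightarrow> c * dir_deriv f v x) (at 0)"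
      using False by (simp add: dir_quot_def mult.commute)
    then show ?case by (rule dir_deriv_eqI)
  qed
qed

lemma AE_dir_deriv_linear:
  "AE x in lborel. dir_deriv f v x = (\<Sum>i\<in>Basis. dir_deriv f i x *\<^sub>R i) \<bullet> v"
proof -
  have "AE x in lborel. dir_deriv f (\<Sum>i\<in>S. (v \<bullet> i) *\<^sub>R i) x = (\<Sum>i\<in>S. (v \<bullet> i) * dir_deriv f i x)"
    if "finite S" for S
    using that
  proof (induction S)
    case empty
    then show ?case by (auto simp: dir_deriv_def dir_quot_def)
  next
    case (insert i S)
    show ?case
      using insert.IH AE_dir_deriv_scale[of "v \<bullet> i" i]
        AE_dir_deriv_add[of "(v \<bullet> i) *\<^sub>R i" "\<Sum>i\<in>S. (v \<bullet> i) *\<^sub>R i"]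
      by eventually_elim (use insert.hyps in simp)
  qed
  from this[OF finite_Basis] show ?thesis
  proof eventually_elim
    case (elim x)
    have "(\<Sum>i\<in>Basis. (v \<bullet> i) * dir_deriv f i x) = (\<Sum>i\<in>Basis. dir_deriv f i x *\<^sub>R i) \<bullet> v"
      by (simp add: inner_sum_left inner_commute[of v] mult.commute)
    with elim show ?case by (simp add: euclidean_representation)
  qed
qed

text \<open>Outside one null set the directional derivatives exist and are linear for all directions
  in a countable dense set. The difference quotients are Lipschitz in the direction, uniformly in
  \<open>t\<close>, so a finite net of directions upgrades this to a total derivative.\<close>

theorem rademacher: "negligible {x. \<not> f differentiable at x}"
proof -
  obtain Q :: "'a set" where Q: "countable Q" "\<And>X. open X \<Longrightarrow> X \<noteq> {} \<Longrightarrow> \<exists>d\<in>Q. d \<in> X"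
    using countable_dense_exists by metis
  have "AE x in lborel. \<forall>v\<in>Q. ((\<lambda>t. dir_quot f v t x) \<longlongrightarrow> dir_deriv f v x) (at 0) \<and>
      dir_deriv f v x = (\<Sum>i\<in>Basis. dir_deriv f i x *\<^sub>R i) \<bullet> v"
    using Q(1) AE_tendsto_dir_deriv AE_dir_deriv_linear by (subst AE_ball_countable) auto
  then have "AE x in lborel. f differentiable at x"
  proof eventually_elim
    case (elim x)
    define l where "l = (\<Sum>i\<in>Basis. dir_deriv f i x *\<^sub>R i)"
    have lim: "((\<lambda>t. dir_quot f v t x) \<longlongrightarrow> l \<bullet> v) (at 0)" if "v \<in> Q" for v
      using elim that by (metis l_def)
    have L: "0 \<le> L" using lip by (simp add: lipschitz_on_def)
    have "(f has_derivative (\<lambda>h. l \<bullet> h)) (at x)"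
      unfolding has_derivative_within_alt
    proof (intro conjI allI impI)
      fix e :: real assume e: "0 < e"
      \<comment> \<open>Three errors are to add up to \<open>e\<close>: replacing the direction
        \<open>u\<close> by the net point \<open>d\<close> in \<open>f\<close> costs
        \<open>L * e'\<close>, the quotient along \<open>d\<close> costs \<open>e'\<close>, and
        replacing \<open>d\<close> by \<open>u\<close> in the linear form costs
        \<open>norm l * e'\<close>.\<close>
      define e' where "e' = e / (L + 1 + norm l)"
      have e': "0 < e'" using e L by (simp add: e'_def add_nonneg_pos add_pos_nonneg)
      have cov: "cball (0::'a) 1 \<subseteq> (\<Union>d\<in>Q. ball d e')"
      proof
        fix u :: 'a
        obtain d where "d \<in> Q" "d \<in> ball u e'" using Q(2)[of "ball u e'"] e' by auto
        then show "u \<in> (\<Union>d\<in>Q. ball d e')" by (auto simp: dist_commute)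
      qed
      obtain Q0 where Q0: "Q0 \<subseteq> Q" "finite Q0" "cball (0::'a) 1 \<subseteq> (\<Union>d\<in>Q0. ball d e')"
        by (rule compactE_image[OF compact_cball _ cov]) auto
      have "\<forall>\<^sub>F t in at 0. \<forall>d\<in>Q0. dist (dir_quot f d t x) (l \<bullet> d) < e'"
        using Q0 lim e' by (intro eventually_ball_finite) (auto simp: tendsto_iff)
      then obtain \<delta> where \<delta>: "\<delta> > 0"
        "\<And>t d. t \<noteq> 0 \<Longrightarrow> \<bar>t\<bar> < \<delta> \<Longrightarrow> d \<in> Q0 \<Longrightarrow> \<bar>dir_quot f d t x - l \<bullet> d\<bar> < e'"
        by (auto simp: eventually_at dist_real_def)
      have "norm (f y - f x - l \<bullet> (y - x)) \<le> e * norm (y - x)" if y: "norm (y - x) < \<delta>" for y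
      proof (cases "y = x")
        case False
        define t where "t = norm (y - x)"
        define u where "u = (y - x) /\<^sub>R t"
        have t: "0 < t" using False by (simp add: t_def)
        have yx: "y = x + t *\<^sub>R u" using t by (simp add: u_def)
        have "norm u = 1" using t by (simp add: u_def t_def)
        then have "u \<in> (\<Union>d\<in>Q0. ball d e')"
          using Q0(3) by (intro subsetD[OF Q0(3)]) simp
        then obtain d where d: "d \<in> Q0" "norm (d - u) < e'"
          by (auto simp: dist_norm)
        have a: "\<bar>f (x + t *\<^sub>R u) - f (x + t *\<^sub>R d)\<bar> \<le> t * (L * e')"
        proof -
          have "\<bar>f (x + t *\<^sub>R u) - f (x + t *\<^sub>R d)\<bar> \<le> L * norm (t *\<^sub>R (d - u))"
            using lipschitz_bound[of "x + t *\<^sub>R u" "x + t *\<^sub>R d"]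
            by (simp add: scaleR_diff_right norm_minus_commute)
          also have "\<dots> \<le> L * (t * e')"
            using t d L by (intro mult_left_mono) auto
          finally show ?thesis by (simp add: mult_ac)
        qed
        have b: "\<bar>f (x + t *\<^sub>R d) - f x - t * (l \<bullet> d)\<bar> \<le> t * e'"
        proof -
          have "f (x + t *\<^sub>R d) - f x - t * (l \<bullet> d) = t * (dir_quot f d t x - l \<bullet> d)"
            using t by (simp add: dir_quot_def field_simps)
          then show ?thesis
            using \<delta>(2)[of t d] t y d by (simp add: abs_mult t_def)
        qed
        have c: "\<bar>t * (l \<bullet> d) - t * (l \<bullet> u)\<bar> \<le> t * (norm l * e')"
        proof -
          have "\<bar>t * (l \<bullet> d) - t * (l \<bullet> u)\<bar> = t * \<bar>l \<bullet> (d - u)\<bar>"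
            using t by (simp add: right_diff_distrib[symmetric] abs_mult inner_diff_right)
          also have "\<dots> \<le> t * (norm l * norm (d - u))"
            using t Cauchy_Schwarz_ineq2[of l "d - u"] by (intro mult_left_mono) auto
          also have "\<dots> \<le> t * (norm l * e')"
            using t d by (intro mult_left_mono) auto
          finally show ?thesis .
        qed
        have "\<bar>f y - f x - l \<bullet> (y - x)\<bar> \<le> t * (L * e') + t * e' + t * (norm l * e')"
          using a b c by (simp add: yx)
        also have "\<dots> = t * ((L + 1 + norm l) * e')" by (simp add: algebra_simps)
        also have "(L + 1 + norm l) * e' = e"
          using L norm_ge_zero[of l] by (simp add: e'_def add_nonneg_eq_0_iff)
        finally show ?thesis by (simp add: t_def mult.commute)
      qed simp
      with \<delta>(1) show "\<exists>d>0. \<forall>y\<in>UNIV. norm (y - x) < d \<longrightarrow> norm (f y - f x - l \<bullet> (y - x)) \<le> e * norm (y - x)"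
        by blast
    qed (rule bounded_linear_inner_right)
    then show ?case by (auto simp: differentiable_def)
  qed
  then obtain N where N: "N \<in> null_sets lborel" "{x. \<not> f differentiable at x} \<subseteq> N"
    by (auto elim!: AE_E simp: null_sets_def)
  then have "negligible N"
    by (auto simp: null_sets_def negligible_iff_emeasure0 emeasure_completion)
  then show ?thesis using N(2) by (rule negligible_subset)
qed

end

section \<open>Touching points of a tilted semicontinuous function\<close>

lemma eventually_nhds_add_open:
  fixes x :: "'a::real_normed_vector"
  assumes "open S" "x \<in> S"
  shows "\<forall>\<^sub>F h in nhds 0. x + h \<in> S"
proof -
  have "((\<lambda>h. x + h) \<longlongrightarrow> x + 0) (nhds 0)" by (intro tendsto_intros filterlim_ident)
  then show ?thesis using topological_tendstoD[OF _ assms(1)] assms(2) by force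
qed

section \<open>Real-valued upper semicontinuous functions on a set\<close>

definition usc_on :: "'a::topological_space set \<Rightarrow> ('a \<Rightarrow> real) \<Rightarrow> bool" where
  "usc_on S f \<longleftrightarrow> (\<forall>c. openin (top_of_set S) {x \<in> S. f x < c})"

lemma usc_onD:
  assumes "usc_on S f" "x \<in> S" "f x < c"
  shows "\<exists>T. open T \<and> x \<in> T \<and> (\<forall>y\<in>T \<inter> S. f y < c)"
proof -
  obtain T where T: "open T" "{x \<in> S. f x < c} = S \<inter> T"
    using assms(1) unfolding usc_on_def openin_open by metis
  then show ?thesis using assms by (intro exI[of _ T]) blast
qed

lemma usc_onI:
  assumes "\<And>x c. x \<in> S \<Longrightarrow> f x < c \<Longrightarrow> \<exists>T. open T \<and> x \<in> T \<and> (\<forall>y\<in>T \<inter> S. f y < c)"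
  shows "usc_on S f"
  unfolding usc_on_def
proof
  fix c
  show "openin (top_of_set S) {x \<in> S. f x < c}"
  proof (subst openin_subopen, clarify)
    fix x assume x: "x \<in> S" "f x < c"
    then obtain T where T: "open T" "x \<in> T" "\<forall>y\<in>T \<inter> S. f y < c"
      using assms by blast
    then show "\<exists>T. openin (top_of_set S) T \<and> x \<in> T \<and> T \<subseteq> {x \<in> S. f x < c}"
      using x by (intro exI[of _ "S \<inter> T"]) (auto simp: openin_open_Int)
  qed
qed

lemma usc_on_add_continuous:
  assumes f: "usc_on S f" and g: "continuous_on S g"
  shows "usc_on S (\<lambda>x. f x + g x)"
proof (rule usc_onI)
  fix x c assume x: "x \<in> S" "f x + g x < c"
  define e where "e = (c - f x - g x) / 2"
  have e: "0 < e" using x by (simp add: e_def)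
  have fx: "f x < f x + e" using e by simp
  obtain T1 where T1: "open T1" "x \<in> T1" "\<forall>y\<in>T1 \<inter> S. f y < f x + e"
    using usc_onD[OF f x(1) fx] by metis
  obtain T2 where T2: "open T2" "x \<in> T2" "\<And>y. y \<in> T2 \<Longrightarrow> y \<in> S \<Longrightarrow> g y < g x + e"
  proof -
    have "open {..<g x + e}" by simp
    then obtain T where T: "open T" "T \<inter> S = g -` {..<g x + e} \<inter> S"
      using g unfolding continuous_on_open_invariant by metis
    show ?thesis
    proof (rule that[OF T(1)])
      show "x \<in> T" using T(2) x(1) e by auto
      show "g y < g x + e" if "y \<in> T" "y \<in> S" for y
        using T(2) that by auto
    qed
  qed
  have "f y + g y < c" if "y \<in> T1 \<inter> T2" "y \<in> S" for y
  proof -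
    have "f y + g y < (f x + e) + (g x + e)"
      using T1(3) T2(3) that by (intro add_strict_mono) auto
    then show ?thesis by (simp add: e_def field_simps)
  qed
  then show "\<exists>T. open T \<and> x \<in> T \<and> (\<forall>y\<in>T \<inter> S. f y + g y < c)"
    using T1 T2 by (intro exI[of _ "T1 \<inter> T2"]) auto
qed

lemma usc_on_snd:
  assumes "usc_on B f"
  shows "usc_on (A \<times> B) (\<lambda>z. f (snd z))"
  unfolding usc_on_def
proof
  fix c
  have "{z \<in> A \<times> B. f (snd z) < c} = A \<times> {y \<in> B. f y < c}" by auto
  moreover have "openin (top_of_set (A \<times> B)) (A \<times> {y \<in> B. f y < c})"
    using assms by (intro openin_Times) (auto simp: usc_on_def)
  ultimately show "openin (top_of_set (A \<times> B)) {z \<in> A \<times> B. f (snd z) < c}" by simp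
qed

text \<open>Without a maximum the relatively open sets \<open>{x \<in> S. f x < f y}\<close> cover
  \<open>S\<close>. Among the finitely many indices of a subcover, one with the largest value is
  itself uncovered.\<close>

lemma usc_on_attains_sup:
  assumes S: "compact S" "S \<noteq> {}" and f: "usc_on S f"
  shows "\<exists>x\<in>S. \<forall>y\<in>S. f y \<le> f x"
proof (rule ccontr)
  assume "\<not> ?thesis"
  then have *: "\<forall>x\<in>S. \<exists>y\<in>S. f x < f y" by (auto simp: not_le)
  have "\<exists>T. open T \<and> S \<inter> T = {x \<in> S. f x < f y}" for y
    using f unfolding usc_on_def openin_open by metis
  then obtain T where T: "\<And>y. open (T y)" "\<And>y. S \<inter> T y = {x \<in> S. f x < f y}" by metis
  have "S \<subseteq> (\<Union>y\<in>S. T y)" using * T(2) by blast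
  then obtain D where D: "D \<subseteq> S" "finite D" "S \<subseteq> (\<Union>y\<in>D. T y)"
    using compactE_image[OF S(1), of S T] T(1) by metis
  have "D \<noteq> {}" using D S(2) by auto
  then obtain m where m: "m \<in> D" "\<forall>y\<in>D. f y \<le> f m"
    using obtains_MAX[OF D(2)] by (metis D(2) Max_ge finite_imageI imageI)
  then obtain y where "y \<in> D" "m \<in> T y" using D by blast
  then have "f m < f y" using T(2)[of y] m D by blast
  then show False using m \<open>y \<in> D\<close> by force
qed

section \<open>First- and second-order expansions\<close>

lemma gradient_first_order_bound:
  fixes W :: "'a::euclidean_space \<Rightarrow> real"
  assumes B: "convex B" and dW: "\<And>x. x \<in> B \<Longrightarrow> (W has_derivative (\<lambda>h. G x \<bullet> h)) (at x)"
    and lip: "K-lipschitz_on B G" and xz: "x \<in> B" "z \<in> B"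
  shows "\<bar>W z - W x - G x \<bullet> (z - x)\<bar> \<le> K * (norm (z - x))\<^sup>2"
proof -
  have sub: "closed_segment x z \<subseteq> B" using B xz by (simp add: closed_segment_subset)
  \<comment> \<open>The mean value inequality for \<open>W\<close> minus its linear part at
    \<open>x\<close>: on the segment the derivative of this difference is at most
    \<open>K * norm (z - x)\<close>.\<close>
  have "norm ((W z - G x \<bullet> z) - (W x - G x \<bullet> x)) \<le> (K * norm (z - x)) * norm (z - x)"
  proof (rule differentiable_bound[where S="closed_segment x z" and f="\<lambda>y. W y - G x \<bullet> y" and f'="\<lambda>y h. G y \<bullet> h - G x \<bullet> h"])
    fix y assume y: "y \<in> closed_segment x z"
    have yB: "y \<in> B" using y sub by auto
    show "((\<lambda>y. W y - G x \<bullet> y) has_derivative (\<lambda>h. G y \<bullet> h - G x \<bullet> h)) (at y within closed_segment x z)"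
      by (intro derivative_intros has_derivative_at_withinI[OF dW[OF yB]])
    show "onorm (\<lambda>h. G y \<bullet> h - G x \<bullet> h) \<le> K * norm (z - x)"
    proof (rule onorm_le)
      fix h
      have "\<bar>(G y - G x) \<bullet> h\<bar> \<le> norm (G y - G x) * norm h"
        by (rule Cauchy_Schwarz_ineq2)
      also have "norm (G y - G x) \<le> K * norm (y - x)"
        using lip yB xz by (auto simp: lipschitz_on_def dist_norm)
      also have "norm (y - x) \<le> norm (z - x)"
        using segment_bound(1)[OF y] by simp
      finally show "norm (G y \<bullet> h - G x \<bullet> h) \<le> K * norm (z - x) * norm h"
        using lip by (simp add: inner_diff_left mult_right_mono mult_left_mono lipschitz_on_def)
    qed
  qed auto
  then show ?thesis by (simp add: inner_diff_right power2_eq_square algebra_simps)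
qed

lemma second_order_taylor:
  fixes W :: "'a::euclidean_space \<Rightarrow> real"
  assumes dW: "\<forall>\<^sub>F y in nhds x. (W has_derivative (\<lambda>h. G y \<bullet> h)) (at y)"
    and dG: "(G has_derivative A) (at x)" and e: "0 < e"
  shows "\<forall>\<^sub>F h in nhds 0. \<bar>W (x + h) - W x - G x \<bullet> h - h \<bullet> A h / 2\<bar> \<le> e * (norm h)\<^sup>2"
proof -
  obtain d1 where d1: "d1 > 0" "\<And>y. dist y x < d1 \<Longrightarrow> (W has_derivative (\<lambda>h. G y \<bullet> h)) (at y)"
    using dW unfolding eventually_nhds_metric by blast
  obtain d2 where d2: "d2 > 0" "\<And>y. norm (y - x) < d2 \<Longrightarrow> norm (G y - G x - A (y - x)) \<le> e * norm (y - x)"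
    using dG e unfolding has_derivative_at_alt by blast
  have lin: "linear A" using dG has_derivative_linear by blast
  have "\<bar>W (x + h) - W x - G x \<bullet> h - h \<bullet> A h / 2\<bar> \<le> e * (norm h)\<^sup>2" if h: "norm h < min d1 d2" for h
  proof -
    define \<phi> where "\<phi> t = W (x + t *\<^sub>R h) - t * (G x \<bullet> h) - t\<^sup>2 / 2 * (h \<bullet> A h)" for t
    define \<phi>' where "\<phi>' t = (G (x + t *\<^sub>R h) - G x - A (t *\<^sub>R h)) \<bullet> h" for t
    have small: "norm (t *\<^sub>R h) < min d1 d2" if "0 \<le> t" "t \<le> 1" for t
      using that h mult_left_le_one_le[of "norm h" t] by auto
    have "(\<phi> has_real_derivative \<phi>' t) (at t)" if t: "0 \<le> t" "t \<le> 1" for t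
    proof -
      have "((\<lambda>t. W (x + t *\<^sub>R h)) has_derivative (\<lambda>s. G (x + t *\<^sub>R h) \<bullet> (s *\<^sub>R h))) (at t)"
        using small[OF t] by (intro has_derivative_compose[OF _ d1(2), of _ "\<lambda>s. s *\<^sub>R h"])
          (auto simp: dist_norm intro!: derivative_eq_intros)
      then have "((\<lambda>t. W (x + t *\<^sub>R h)) has_real_derivative G (x + t *\<^sub>R h) \<bullet> h) (at t)"
        by (simp add: has_field_derivative_def mult.commute[of _ "_ \<bullet> _"])
      then have "(\<phi> has_real_derivative G (x + t *\<^sub>R h) \<bullet> h - G x \<bullet> h - t * (h \<bullet> A h)) (at t)"
        unfolding \<phi>_def[abs_def] by (auto intro!: derivative_eq_intros)
      then show ?thesis
        by (simp add: \<phi>'_def inner_diff_left linear_scale[OF lin] inner_commute[of h])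
    qed
    then obtain t where t: "0 < t" "t < 1" "\<phi> 1 - \<phi> 0 = (1 - 0) * \<phi>' t"
      using MVT2[of 0 1 \<phi> \<phi>'] by auto
    have "\<bar>\<phi>' t\<bar> \<le> norm (G (x + t *\<^sub>R h) - G x - A (t *\<^sub>R h)) * norm h"
      unfolding \<phi>'_def by (rule Cauchy_Schwarz_ineq2)
    also have "\<dots> \<le> (e * norm (t *\<^sub>R h)) * norm h"
      using d2(2)[of "x + t *\<^sub>R h"] small[of t] t by (intro mult_right_mono) auto
    also have "\<dots> \<le> (e * norm h) * norm h"
      using t e mult_left_le_one_le[of "norm h" t] by (intro mult_right_mono mult_left_mono) auto
    finally show ?thesis
      using t(3) by (simp add: \<phi>_def power2_eq_square mult.assoc)
  qed
  then show ?thesis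
    unfolding eventually_nhds_metric using d1(1) d2(1)
    by (intro exI[of _ "min d1 d2"]) (auto simp: dist_norm)
qed

text \<open>Composing with the nearest-point projection, which is 1-Lipschitz, extends each
  component of \<open>G\<close> from the closed ball to a globally Lipschitz function and changes
  nothing inside the ball.\<close>

lemma negligible_not_differentiable_lipschitz:
  fixes G :: "'a::euclidean_space \<Rightarrow> 'b::euclidean_space"
  assumes lip: "K-lipschitz_on (cball x0 r) G" and r: "0 < r"
  shows "negligible {x \<in> ball x0 r. \<not> G differentiable at x}"
proof -
  define c where "c = closest_point (cball x0 r)"
  define g where "g b x = G (c x) \<bullet> b" for b x
  have cin: "c x \<in> cball x0 r" for x
    unfolding c_def by (rule closest_point_in_set) (use r in auto)
  have clip: "dist (c x) (c y) \<le> dist x y" for x y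
    unfolding c_def by (rule closest_point_lipschitz) (use r in auto)
  have glip: "K-lipschitz_on UNIV (g b)" if "b \<in> Basis" for b
  proof (rule lipschitz_onI)
    fix x y
    have K: "0 \<le> K" using lip by (simp add: lipschitz_on_def)
    have "dist (g b x) (g b y) = \<bar>(G (c x) - G (c y)) \<bullet> b\<bar>"
      by (simp add: g_def dist_real_def inner_diff_left)
    also have "\<dots> \<le> dist (G (c x)) (G (c y))"
      using that by (simp add: Basis_le_norm dist_norm)
    also have "\<dots> \<le> K * dist (c x) (c y)"
      using lip cin by (simp add: lipschitz_on_def)
    also have "\<dots> \<le> K * dist x y" using clip K by (intro mult_left_mono)
    finally show "dist (g b x) (g b y) \<le> K * dist x y" .
  qed (use lip in \<open>simp add: lipschitz_on_def\<close>)
  have "negligible (\<Union>b\<in>Basis. {x. \<not> g b differentiable at x})"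
    using rademacher[OF glip] by (intro negligible_Union) auto
  moreover have "G differentiable at x" if x: "x \<in> ball x0 r" "\<And>b. b \<in> Basis \<Longrightarrow> g b differentiable at x" for x
  proof -
    have "(\<lambda>y. G (c y)) differentiable at x"
      using x(2) unfolding g_def by (subst differentiable_componentwise_within) auto
    then obtain D where D: "((\<lambda>y. G (c y)) has_derivative D) (at x)"
      by (auto simp: differentiable_def)
    have "(G has_derivative D) (at x)"
      by (rule has_derivative_transform_within_open[OF D open_ball x(1)])
         (simp add: c_def closest_point_self)
    then show ?thesis by (auto simp: differentiable_def)
  qed
  ultimately show ?thesis
    by (elim negligible_subset) blast
qed


text \<open>Let v(x) be the supremum over \<open>y\<close> of
  \<open>u y - c * (norm (x - y))\<^sup>2\<close>, the sup-convolution. At a maximum point it is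
  touched from below by a paraboloid (freeze \<open>y\<close>) and from above by one (maximality and
  the bound on \<open>W\<close>), both with gradient \<open>p + G x\<close>. Two-sided touching with
  fixed openings makes this gradient a Lipschitz function of the touching point, and
  \<open>G\<close> is Lipschitz as well. So \<open>p\<close> depends on the maximum point in a
  locally Lipschitz way.\<close>

lemma perturbed_maximum_slope_bound:
  fixes u W :: "'a::euclidean_space \<Rightarrow> real"
  assumes dW: "\<And>x. x \<in> cball x0 r \<Longrightarrow> (W has_derivative (\<lambda>h. G x \<bullet> h)) (at x)"
    and lip: "K-lipschitz_on (cball x0 r) G" and c: "0 \<le> c"
  defines "\<Phi> \<equiv> \<lambda>p x y. u y - c * (norm (x - y))\<^sup>2 - W x - p \<bullet> (x - x0)"
  assumes max1: "\<And>x y. x \<in> cball x0 r \<Longrightarrow> y \<in> cball x0 r \<Longrightarrow> \<Phi> p1 x y \<le> \<Phi> p1 x1 y1"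
    and max2: "\<And>x y. x \<in> cball x0 r \<Longrightarrow> y \<in> cball x0 r \<Longrightarrow> \<Phi> p2 x y \<le> \<Phi> p2 x2 y2"
    and x1: "x1 \<in> ball x0 r" and x2: "x2 \<in> ball x0 r"
    and y1: "y1 \<in> cball x0 r" and y2: "y2 \<in> cball x0 r"
    and near: "norm (x2 - x1) < r - dist x0 x1"
  shows "norm (p2 - p1) \<le> (3 * K + 4 * c) * norm (x2 - x1)"
proof -
  define B where "B = cball x0 r"
  define d where "d = norm (x2 - x1)"
  have K: "0 \<le> K" using lip by (simp add: lipschitz_on_def)
  have xB: "x1 \<in> B" "x2 \<in> B" "y1 \<in> B" "y2 \<in> B"
    using x1 x2 y1 y2 by (auto simp: B_def)
  define s1 where "s1 = u y1 - c * (norm (x1 - y1))\<^sup>2"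
  define s2 where "s2 = u y2 - c * (norm (x2 - y2))\<^sup>2"
  \<comment> \<open>First-order condition in the first variable alone, where the function is
    smooth.\<close>
  have crit: "p + G x = (2 * c) *\<^sub>R (y - x)"
    if max: "\<And>z. z \<in> B \<Longrightarrow> \<Phi> p z y \<le> \<Phi> p x y" and x: "x \<in> ball x0 r" for p x y
  proof -
    have "((\<lambda>z. (norm (z - y))\<^sup>2) has_derivative (\<lambda>h. 2 * ((x - y) \<bullet> h))) (at x)"
      unfolding power2_norm_eq_inner by (auto intro!: derivative_eq_intros simp: inner_commute)
    then have "((\<lambda>z. \<Phi> p z y) has_derivative (\<lambda>h. 0 - c * (2 * ((x - y) \<bullet> h)) - G x \<bullet> h - p \<bullet> (h - 0))) (at x)"
      unfolding \<Phi>_def using x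
      by (intro has_derivative_diff has_derivative_const has_derivative_mult_right dW
          has_derivative_inner_right has_derivative_ident) auto
    then have der: "((\<lambda>z. \<Phi> p z y) has_derivative (\<lambda>h. - (c * (2 * ((x - y) \<bullet> h))) - G x \<bullet> h - p \<bullet> h)) (at x)"
      by simp
    have "(\<lambda>h. - (c * (2 * ((x - y) \<bullet> h))) - G x \<bullet> h - p \<bullet> h) = (\<lambda>h. 0)"
      by (rule differential_zero_maxmin[OF _ _ der, where S="ball x0 r"]) (use x max in \<open>auto simp: B_def\<close>)
    then have "((2 * c) *\<^sub>R (y - x) - (p + G x)) \<bullet> h = 0" for h
      by (drule_tac fun_cong[of _ _ h]) (simp add: inner_diff_left inner_add_left algebra_simps)
    from this[of "(2 * c) *\<^sub>R (y - x) - (p + G x)"] show ?thesis by simp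
  qed
  have q1: "p1 + G x1 = (2 * c) *\<^sub>R (y1 - x1)"
    by (rule crit) (use max1 xB x1 in \<open>auto simp: B_def\<close>)
  have q2: "p2 + G x2 = (2 * c) *\<^sub>R (y2 - x2)"
    by (rule crit) (use max2 xB x2 in \<open>auto simp: B_def\<close>)
  have W1: "W z - W x1 \<le> G x1 \<bullet> (z - x1) + K * (norm (z - x1))\<^sup>2" if "z \<in> B" for z
    using gradient_first_order_bound[OF convex_cball dW lip, of x1 z] xB that unfolding B_def by auto
  have W2: "W z - W x2 \<le> G x2 \<bullet> (z - x2) + K * (norm (z - x2))\<^sup>2" if "z \<in> B" for z
    using gradient_first_order_bound[OF convex_cball dW lip, of x2 z] xB that unfolding B_def by auto
  \<comment> \<open>The lower paraboloid based at \<open>x2\<close> stays below the upper paraboloid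
    based at \<open>x1\<close>: test the first maximum with the pair \<open>(z, y2)\<close>.\<close>
  have sup1: "s2 + (p2 + G x2) \<bullet> (z - x2) - c * (norm (z - x2))\<^sup>2
      \<le> s1 + (p1 + G x1) \<bullet> (z - x1) + K * (norm (z - x1))\<^sup>2" if z: "z \<in> B" for z
  proof -
    have "u y2 - c * (norm (z - y2))\<^sup>2 - W z - p1 \<bullet> (z - x0) \<le> s1 - W x1 - p1 \<bullet> (x1 - x0)"
      using max1[of z y2] z xB by (simp add: \<Phi>_def s1_def B_def)
    moreover have "c * (norm (z - y2))\<^sup>2 = c * (norm (x2 - y2))\<^sup>2 - (p2 + G x2) \<bullet> (z - x2) + c * (norm (z - x2))\<^sup>2"
      unfolding q2 power2_norm_eq_inner by (simp add: inner_diff_left inner_diff_right inner_commute algebra_simps)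
    ultimately show ?thesis
      using W1[OF z] by (simp add: s2_def inner_diff_right inner_add_left algebra_simps)
  qed
  have sup2: "s1 \<le> s2 + (p2 + G x2) \<bullet> (x1 - x2) + K * d\<^sup>2"
  proof -
    have "s1 - W x1 - p2 \<bullet> (x1 - x0) \<le> s2 - W x2 - p2 \<bullet> (x2 - x0)"
      using max2[of x1 y1] xB by (simp add: \<Phi>_def s1_def s2_def B_def)
    then show ?thesis
      using W2[of x1] xB by (simp add: d_def norm_minus_commute inner_diff_right inner_add_left algebra_simps)
  qed
  let ?q = "(p2 + G x2) - (p1 + G x1)"
  \<comment> \<open>Insert \<open>sup2\<close> into \<open>sup1\<close> and move from
    \<open>x1\<close> a distance \<open>t\<close> in the direction of \<open>?q\<close>, the
    difference of the two gradients, where the gap between the linear parts grows fastest.\<close>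
  have main: "t * norm ?q \<le> K * d\<^sup>2 + c * (t + d)\<^sup>2 + K * t\<^sup>2" if t: "0 < t" "t < r - dist x0 x1" for t
  proof (cases "?q = 0")
    case False
    define z where "z = x1 + (t / norm ?q) *\<^sub>R ?q"
    have zx: "norm (z - x1) = t" using False t by (simp add: z_def)
    have "z \<in> B"
    proof -
      have "dist x0 z \<le> dist x0 x1 + dist x1 z" by (rule dist_triangle)
      then show ?thesis using zx t by (simp add: B_def dist_norm norm_minus_commute)
    qed
    have "norm (z - x2) \<le> norm (z - x1) + norm (x2 - x1)"
      by (metis norm_minus_commute norm_triangle_ineq add_diff_cancel diff_add_cancel add_diff_eq)
    then have "(norm (z - x2))\<^sup>2 \<le> (t + d)\<^sup>2"
      using zx by (intro power_mono) (auto simp: d_def)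
    then have cz: "c * (norm (z - x2))\<^sup>2 \<le> c * (t + d)\<^sup>2" using c by (rule mult_left_mono)
    have "?q \<bullet> (z - x1) \<le> K * d\<^sup>2 + c * (norm (z - x2))\<^sup>2 + K * t\<^sup>2"
      using sup1[OF \<open>z \<in> B\<close>] sup2 unfolding zx
      by (simp add: inner_diff_left inner_diff_right algebra_simps)
    moreover have "?q \<bullet> (z - x1) = t * norm ?q"
      using False by (simp add: z_def power2_norm_eq_inner[symmetric] power2_eq_square)
    ultimately show ?thesis using cz by simp
  qed (use t K c in auto)
  \<comment> \<open>The choice \<open>t = d\<close> is admissible by \<open>near\<close> and gives
    \<open>K + 4 * c + K\<close>. Passing from \<open>?q\<close> to \<open>p2 - p1\<close> adds
    another \<open>K\<close> for \<open>G\<close>.\<close>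
  have "norm ?q \<le> (2 * K + 4 * c) * d"
  proof (cases "d = 0")
    case False
    then have "0 < d" by (simp add: d_def)
    have "d * norm ?q \<le> d * ((2 * K + 4 * c) * d)"
      using main[OF \<open>0 < d\<close>] near by (simp add: d_def power2_eq_square algebra_simps)
    then show ?thesis using \<open>0 < d\<close> by (rule mult_left_le_imp_le)
  next
    case True
    \<comment> \<open>If the two points coincide, \<open>t = d\<close> is void; arbitrarily small
      \<open>t\<close> shows that \<open>?q\<close> vanishes.\<close>
    define t0 where "t0 = r - dist x0 x1"
    have t0: "0 < t0" using x1 by (simp add: t0_def)
    have "norm ?q \<le> 0"
    proof (rule field_le_epsilon)
      fix e :: real assume e: "0 < e"
      define t where "t = min (t0 / 2) (e / (K + c + 1))"
      have t: "0 < t" "t < t0" using t0 e K c by (auto simp: t_def min_less_iff_disj)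
      have "t * norm ?q \<le> t * ((K + c) * t)"
        using main[of t] t True by (simp add: t0_def power2_eq_square algebra_simps)
      then have "norm ?q \<le> (K + c) * t" using t(1) by (rule mult_left_le_imp_le)
      also have "\<dots> \<le> (K + c + 1) * (e / (K + c + 1))"
        using K c e t by (intro mult_mono) (auto simp: t_def)
      also have "\<dots> = e" using K c by simp
      finally show "norm ?q \<le> 0 + e" by simp
    qed
    then show ?thesis using True by simp
  qed
  moreover have "norm (G x2 - G x1) \<le> K * d"
    using lip xB by (auto simp: lipschitz_on_def dist_norm d_def B_def)
  moreover have "p2 - p1 = ?q - (G x2 - G x1)" by simp
  then have "norm (p2 - p1) \<le> norm ?q + norm (G x2 - G x1)" by (metis norm_triangle_ineq4)
  ultimately show ?thesis by (simp add: d_def algebra_simps)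
qed


text \<open>Doubling the variables regularises \<open>u\<close> by a sup-convolution, so that the maxima of
  the perturbed function, as functions of the slope \<open>p\<close>, have locally Lipschitz inverse;
  they fill a set that is not negligible.\<close>

lemma perturbed_touching_point:
  fixes u W :: "'a::euclidean_space \<Rightarrow> real"
  assumes r: "0 < r" and usc: "usc_on (cball x0 r) u"
    and dW: "\<And>x. x \<in> cball x0 r \<Longrightarrow> (W has_derivative (\<lambda>h. G x \<bullet> h)) (at x)"
    and lip: "K-lipschitz_on (cball x0 r) G"
    and center: "W x0 \<le> u x0"
    and sphere: "\<And>x. x \<in> sphere x0 r \<Longrightarrow> u x < W x"
    and N: "negligible N" and \<kappa>: "0 < \<kappa>"
  obtains x y p where "x \<in> ball x0 r" "x \<notin> N" "y \<in> ball x0 r" "norm p < \<kappa>" "dist x y < \<kappa>"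
    "W x - \<kappa> < u y"
    "\<forall>\<^sub>F h in nhds 0. u (y + h) \<le> u y + W (x + h) - W x + p \<bullet> h"
proof -
  define B where "B = cball x0 r"
  define \<Phi> where "\<Phi> c p x y = u y - c * (norm (x - y))\<^sup>2 - W x - p \<bullet> (x - x0)" for c p x y
  have B: "compact B" "B \<noteq> {}" "x0 \<in> B" using r by (auto simp: B_def)
  have contW: "continuous_on B W"
    using dW has_derivative_continuous continuous_at_imp_continuous_on unfolding B_def by blast
  define isM where "isM c p x y \<longleftrightarrow> x \<in> B \<and> y \<in> B \<and> (\<forall>x'\<in>B. \<forall>y'\<in>B. \<Phi> c p x' y' \<le> \<Phi> c p x y)" for c p x y
  have exM: "\<exists>x y. isM c p x y" for c p
  proof -
    have "usc_on (B \<times> B) (\<lambda>z. u (snd z) + (- (c * (norm (fst z - snd z))\<^sup>2)) + (- W (fst z)) + (- (p \<bullet> (fst z - x0))))"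
      by (intro usc_on_add_continuous usc_on_snd continuous_intros continuous_on_compose2[OF contW])
         (use usc in \<open>auto simp: B_def\<close>)
    then have usc2: "usc_on (B \<times> B) (\<lambda>z. \<Phi> c p (fst z) (snd z))"
      by (simp add: \<Phi>_def)
    have "B \<times> B \<noteq> {}" using B(2) by auto
    from usc_on_attains_sup[OF compact_Times[OF B(1) B(1)] this usc2]
    obtain z where z: "z \<in> B \<times> B" "\<forall>z'\<in>B \<times> B. \<Phi> c p (fst z') (snd z') \<le> \<Phi> c p (fst z) (snd z)" ..
    then have "isM c p (fst z) (snd z)" unfolding isM_def by auto
    then show ?thesis by blast
  qed
  obtain xu where xu: "\<And>y. y \<in> B \<Longrightarrow> u y \<le> u xu"
    using usc_on_attains_sup[OF B(1,2)] usc unfolding B_def by blast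
  obtain xw where xw: "\<And>y. y \<in> B \<Longrightarrow> W xw \<le> W y"
    using continuous_attains_inf[OF B(1,2) contW] by blast
  define good where "good x y \<longleftrightarrow> x \<in> ball x0 r \<and> y \<in> ball x0 r \<and> dist x y < \<kappa> \<and> W x - \<kappa> < u y" for x y
  \<comment> \<open>One penalty constant has to work for a whole ball of slopes. If none did, maxima
    with penalty n and slopes tending to 0 would stay bad; along a subsequence both variables
    converge to one point, where \<open>W \<le> u\<close> by semicontinuity, so it is interior by
    \<open>sphere\<close> and the maxima are good after all.\<close>
  have "\<exists>n. \<forall>p x y. norm p < 1 / real (Suc n) \<longrightarrow> isM (real n) p x y \<longrightarrow> good x y"
  proof (rule ccontr)
    assume "\<not> ?thesis"
    then obtain p x y where bad: "\<And>n. norm (p n) < 1 / real (Suc n)" "\<And>n. isM (real n) (p n) (x n) (y n)"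
      "\<And>n. \<not> good (x n) (y n)"
      by metis
    have xyB: "x n \<in> B" "y n \<in> B" for n using bad(2) by (auto simp: isM_def)
    have "\<exists>\<xi>\<in>B. \<exists>\<sigma>. strict_mono \<sigma> \<and> (x \<circ> \<sigma>) \<longlonglongrightarrow> \<xi>"
      using compact_imp_seq_compact[OF B(1)] xyB(1) unfolding seq_compact_def by blast
    then obtain \<xi> \<sigma> where \<sigma>: "\<xi> \<in> B" "strict_mono \<sigma>" "(x \<circ> \<sigma>) \<longlonglongrightarrow> \<xi>"
      by blast
    define X Y P where "X k = x (\<sigma> k)" and "Y k = y (\<sigma> k)" and "P k = p (\<sigma> k)" for k
    have XB: "X k \<in> B" "Y k \<in> B" for k using xyB by (auto simp: X_def Y_def)
    have Xlim: "X \<longlonglongrightarrow> \<xi>" using \<sigma>(3) by (simp add: X_def[abs_def] o_def)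
    \<comment> \<open>Comparison with the pair \<open>(x0, x0)\<close>, at which penalty and tilt
      vanish.\<close>
    have val: "0 \<le> u (Y k) - real (\<sigma> k) * (norm (X k - Y k))\<^sup>2 - W (X k) - P k \<bullet> (X k - x0)" for k
    proof -
      have "\<Phi> (real (\<sigma> k)) (P k) x0 x0 \<le> \<Phi> (real (\<sigma> k)) (P k) (X k) (Y k)"
        using bad(2)[of "\<sigma> k"] B(3) by (simp add: isM_def X_def Y_def P_def)
      moreover have "0 \<le> \<Phi> (real (\<sigma> k)) (P k) x0 x0"
        using center by (simp add: \<Phi>_def)
      ultimately show ?thesis by (simp add: \<Phi>_def)
    qed
    have Psmall: "norm (P k) \<le> 1 / real (Suc k)" for k
    proof -
      have "k \<le> \<sigma> k" using \<sigma>(2) by (rule seq_suble)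
      then have "1 / real (Suc (\<sigma> k)) \<le> 1 / real (Suc k)" by (simp add: field_simps)
      then show ?thesis using bad(1)[of "\<sigma> k"] by (simp add: P_def)
    qed
    have Plim: "P \<longlonglongrightarrow> 0"
      by (rule tendsto_norm_zero_cancel, rule tendsto_sandwich[OF _ _ tendsto_const LIMSEQ_inverse_real_of_nat])
         (use Psmall in \<open>auto simp: inverse_eq_divide\<close>)
    have pterm: "(\<lambda>k. P k \<bullet> (X k - x0)) \<longlonglongrightarrow> 0 \<bullet> (\<xi> - x0)"
      by (intro tendsto_intros Plim Xlim)
    define M where "M = u xu - W xw + r"
    have pb: "\<bar>P k \<bullet> (X k - x0)\<bar> \<le> r" for k
    proof -
      have "\<bar>P k \<bullet> (X k - x0)\<bar> \<le> norm (P k) * norm (X k - x0)" by (rule Cauchy_Schwarz_ineq2)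
      also have "\<dots> \<le> 1 * r"
      proof (intro mult_mono)
        show "norm (P k) \<le> 1" using Psmall[of k] by (rule order_trans) simp
      qed (use XB[of k] r in \<open>auto simp: B_def dist_norm norm_minus_commute\<close>)
      finally show ?thesis by simp
    qed
    have dist2: "real k * (norm (X k - Y k))\<^sup>2 \<le> M" for k
    proof -
      have "real k * (norm (X k - Y k))\<^sup>2 \<le> real (\<sigma> k) * (norm (X k - Y k))\<^sup>2"
        using seq_suble[OF \<sigma>(2), of k] by (intro mult_right_mono) auto
      then show ?thesis
        using val[of k] pb[of k] xu[OF XB(2)[of k]] xw[OF XB(1)[of k]] unfolding M_def by linarith
    qed
    have "(\<lambda>k. (norm (X k - Y k))\<^sup>2) \<longlonglongrightarrow> 0"
    proof (rule tendsto_sandwich[OF _ _ tendsto_const])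
      show "\<forall>\<^sub>F k in sequentially. (norm (X k - Y k))\<^sup>2 \<le> M / real k"
        using eventually_gt_at_top[of 0] by eventually_elim (use dist2 in \<open>simp add: field_simps\<close>)
      show "(\<lambda>k. M / real k) \<longlonglongrightarrow> 0" by (rule lim_const_over_n)
    qed auto
    then have "(\<lambda>k. sqrt ((norm (X k - Y k))\<^sup>2)) \<longlonglongrightarrow> sqrt 0"
      by (rule tendsto_real_sqrt)
    then have diff: "(\<lambda>k. X k - Y k) \<longlonglongrightarrow> 0"
      by - (rule tendsto_norm_zero_cancel, simp)
    have Ylim: "Y \<longlonglongrightarrow> \<xi>"
      using tendsto_diff[OF Xlim diff] by simp
    have Wlim: "(\<lambda>k. W (X k)) \<longlonglongrightarrow> W \<xi>"
      by (rule continuous_on_tendsto_compose[OF contW Xlim \<sigma>(1)]) (use XB in auto)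
    have low: "W (X k) + P k \<bullet> (X k - x0) \<le> u (Y k)" for k
    proof -
      have "0 \<le> real (\<sigma> k) * (norm (X k - Y k))\<^sup>2" by simp
      then show ?thesis using val[of k] by linarith
    qed
    have "W \<xi> \<le> u \<xi>"
    proof (rule ccontr)
      assume "\<not> ?thesis"
      then obtain c where c: "u \<xi> < c" "c < W \<xi>" using dense not_le by blast
      obtain T where T: "open T" "\<xi> \<in> T" "\<forall>y\<in>T \<inter> B. u y < c"
        using usc_onD[OF usc \<sigma>(1)[unfolded B_def] c(1)] unfolding B_def by blast
      have "\<forall>\<^sub>F k in sequentially. Y k \<in> T" using Ylim T(1,2) by (rule topological_tendstoD)
      moreover have "(\<lambda>k. W (X k) + P k \<bullet> (X k - x0)) \<longlonglongrightarrow> W \<xi> + 0 \<bullet> (\<xi> - x0)"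
        by (intro tendsto_add Wlim pterm)
      then have "\<forall>\<^sub>F k in sequentially. c < W (X k) + P k \<bullet> (X k - x0)"
        using c(2) by (auto simp: order_tendsto_iff)
      ultimately have "\<forall>\<^sub>F k in sequentially. False"
      proof eventually_elim
        case (elim k)
        then have "u (Y k) < c" using T(3) XB(2)[of k] by blast
        then show False using elim low[of k] by linarith
      qed
      then show False by simp
    qed
    then have "\<xi> \<in> ball x0 r"
      using sphere[of \<xi>] \<sigma>(1) by (fastforce simp: B_def)
    then have "\<forall>\<^sub>F k in sequentially. X k \<in> ball x0 r" "\<forall>\<^sub>F k in sequentially. Y k \<in> ball x0 r"
      using topological_tendstoD[OF Xlim open_ball] topological_tendstoD[OF Ylim open_ball] by simp_all
    moreover have "\<forall>\<^sub>F k in sequentially. dist (X k) (Y k) < \<kappa>"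
      using tendstoD[OF diff \<kappa>] by (simp add: dist_norm)
    moreover have "\<forall>\<^sub>F k in sequentially. - \<kappa> < P k \<bullet> (X k - x0)"
      using pterm \<kappa> by (auto simp: order_tendsto_iff)
    ultimately have "\<forall>\<^sub>F k in sequentially. good (X k) (Y k)"
    proof eventually_elim
      case (elim k)
      then show ?case using low[of k] by (simp add: good_def)
    qed
    then show False using bad(3) by (auto simp: X_def Y_def)
  qed
  then obtain n where n: "\<And>p x y. norm p < 1 / real (Suc n) \<Longrightarrow> isM (real n) p x y \<Longrightarrow> good x y"
    by blast
  \<comment> \<open>The cap by \<kappa> makes the slope that is finally returned smaller than
    \<kappa>; the other bound keeps all maxima good.\<close>
  define \<rho> where "\<rho> = min \<kappa> (1 / real (Suc n))"
  have \<rho>: "0 < \<rho>" using \<kappa> by (simp add: \<rho>_def)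
  obtain X Y where XY: "\<And>p. isM (real n) p (X p) (Y p)" using exM[of "real n"] by metis
  have good: "good (X p) (Y p)" if "p \<in> ball 0 \<rho>" for p
    using n XY that by (auto simp: \<rho>_def)
  define C where "C = 3 * K + 4 * real n"
  have slope: "norm (p' - p) \<le> C * norm (X p' - X p)"
    if "p \<in> ball 0 \<rho>" "p' \<in> ball 0 \<rho>" "norm (X p' - X p) < r - dist x0 (X p)" for p p'
    unfolding C_def
    by (rule perturbed_maximum_slope_bound[OF dW lip, where u=u and ?y1.0="Y p" and ?y2.0="Y p'"])
       (use that good[OF that(1)] good[OF that(2)] XY[of p] XY[of p'] in \<open>auto simp: good_def isM_def \<Phi>_def B_def\<close>)
  have inj: "inj_on X (ball 0 \<rho>)"
  proof (rule inj_onI)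
    fix p p' assume p: "p \<in> ball 0 \<rho>" "p' \<in> ball 0 \<rho>" "X p = X p'"
    have "norm (p' - p) \<le> 0"
      using slope[OF p(1,2)] p(3) good[OF p(1)] by (simp add: good_def)
    then show "p = p'" by simp
  qed
  have "\<exists>p\<in>ball 0 \<rho>. X p \<notin> N"
  proof (rule ccontr)
    assume "\<not> ?thesis"
    then have "X ` ball 0 \<rho> \<subseteq> N" by auto
    then have neg: "negligible (X ` ball 0 \<rho>)" using N negligible_subset by blast
    \<comment> \<open>The inverse of \<open>X\<close> is locally Lipschitz by \<open>slope\<close>,
      so it maps negligible sets to negligible sets; its image here is a full ball of
      slopes.\<close>
    have "negligible (inv_into (ball 0 \<rho>) X ` (X ` ball 0 \<rho>))"
    proof (rule negligible_locally_Lipschitz_image[OF order_refl neg])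
      fix x assume "x \<in> X ` ball 0 \<rho>"
      then obtain p where p: "p \<in> ball 0 \<rho>" "x = X p" by auto
      have "norm (inv_into (ball 0 \<rho>) X y - inv_into (ball 0 \<rho>) X x) \<le> C * norm (y - x)"
        if y: "y \<in> X ` ball 0 \<rho> \<inter> ball (X p) (r - dist x0 (X p))" for y
      proof -
        obtain p' where p': "p' \<in> ball 0 \<rho>" "y = X p'" using y by auto
        then show ?thesis
          using slope[OF p(1) p'(1)] y p inv_into_f_f[OF inj] by (simp add: dist_norm norm_minus_commute)
      qed
      moreover have "0 < r - dist x0 (X p)" using good[OF p(1)] by (simp add: good_def)
      ultimately show "\<exists>T B. open T \<and> x \<in> T \<and> (\<forall>y\<in>X ` ball 0 \<rho> \<inter> T. norm (inv_into (ball 0 \<rho>) X y - inv_into (ball 0 \<rho>) X x) \<le> B * norm (y - x))"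
        using p(2) by (intro exI[of _ "ball (X p) (r - dist x0 (X p))"] exI[of _ C]) auto
    qed
    then have "negligible (ball (0::'a) \<rho>)"
      using inj by (simp add: inv_into_image_cancel)
    then show False
      using \<rho> open_not_negligible[of "ball (0::'a) \<rho>"] by auto
  qed
  then obtain p where p: "p \<in> ball 0 \<rho>" "X p \<notin> N" by blast
  have g: "X p \<in> ball x0 r" "Y p \<in> ball x0 r" "dist (X p) (Y p) < \<kappa>" "W (X p) - \<kappa> < u (Y p)"
    using good[OF p(1)] by (auto simp: good_def)
  have "\<forall>\<^sub>F h in nhds 0. X p + h \<in> ball x0 r \<and> Y p + h \<in> ball x0 r"
    by (intro eventually_conj eventually_nhds_add_open open_ball g)
  then have "\<forall>\<^sub>F h in nhds 0. u (Y p + h) \<le> u (Y p) + W (X p + h) - W (X p) + p \<bullet> h"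
  proof eventually_elim
    case (elim h)
    \<comment> \<open>Moving both variables by the same \<open>h\<close> leaves the penalty
      unchanged, so the maximum compares increments of \<open>u\<close> at \<open>Y p\<close>
      directly with increments of \<open>W\<close> at \<open>X p\<close>. Expansions of
      \<open>W\<close> at one point thus serve for \<open>u\<close> at the other.\<close>
    then have "\<Phi> (real n) p (X p + h) (Y p + h) \<le> \<Phi> (real n) p (X p) (Y p)"
      using XY[of p] by (auto simp: isM_def B_def)
    then show ?case by (simp add: \<Phi>_def inner_add_right inner_diff_right)
  qed
  then show ?thesis
    using g p by (intro that[of "X p" "Y p" p]) (auto simp: \<rho>_def)
qed

section \<open>Quadratic test functions and the Hopf barrier\<close>

text \<open>The paraboloid with 2-jet \<open>(s, p, M)\<close> at \<open>x\<close>, written in the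
  variable \<open>y\<close>. \<open>M\<close> is its Hessian only when \<open>M\<close> is
  symmetric.\<close>

definition quad :: "real \<Rightarrow> real^'n \<Rightarrow> real^'n^'n \<Rightarrow> real^'n \<Rightarrow> real^'n \<Rightarrow> real" where
  "quad s p M x y = s + p \<bullet> (y - x) + (y - x) \<bullet> (M *v (y - x)) / 2"

lemma has_derivative_grad:
  assumes "f differentiable at x"
  shows "(f has_derivative (\<lambda>h. grad f x \<bullet> h)) (at x)"
proof -
  let ?D = "frechet_derivative f (at x)"
  have D: "(f has_derivative ?D) (at x)"
    using assms frechet_derivative_works by blast
  have "?D h = grad f x \<bullet> h" for h
  proof -
    have "?D h = ?D (\<Sum>i\<in>UNIV. h $ i *\<^sub>R axis i 1)"
      using basis_expansion[of h] by (simp add: scalar_mult_eq_scaleR)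
    also have "\<dots> = (\<Sum>i\<in>UNIV. h $ i * ?D (axis i 1))"
      using has_derivative_linear[OF D] by (simp add: linear_sum linear_scale o_def)
    finally show ?thesis by (simp add: grad_def inner_vec_def mult.commute)
  qed
  then show ?thesis using D by (metis (no_types, lifting) ext)
qed

lemma grad_eqI:
  assumes "(f has_derivative (\<lambda>h. g \<bullet> h)) (at x)"
  shows "grad f x = g"
proof -
  have "frechet_derivative f (at x) = (\<lambda>h. g \<bullet> h)"
    using frechet_derivative_at[OF assms] by simp
  then show ?thesis by (simp add: grad_def inner_axis vec_eq_iff)
qed

lemma symmetric_bilinear:
  assumes "M \<in> Sym"
  shows "v \<bullet> (M *v w) = w \<bullet> (M *v v)"
proof -
  have "v \<bullet> (M *v w) = (transpose M *v v) \<bullet> w"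
    by (simp only: dot_lmul_matrix transpose_matrix_vector)
  also have "transpose M = M" using assms by (simp add: Sym_def)
  finally show ?thesis by (simp only: inner_commute)
qed

lemma has_derivative_quad:
  assumes "M \<in> Sym"
  shows "(quad s p M x has_derivative (\<lambda>h. (p + M *v (y - x)) \<bullet> h)) (at y)"
proof -
  have "((\<lambda>y. M *v (y - x)) has_derivative (\<lambda>h. M *v h)) (at y)"
    by (rule has_derivative_eq_rhs, rule bounded_linear.has_derivative[OF matrix_vector_mul_bounded_linear],
        rule has_derivative_diff[OF has_derivative_ident has_derivative_const]) simp
  then have "(quad s p M x has_derivative
      (\<lambda>h. 0 + p \<bullet> (h - 0) + ((y - x) \<bullet> (M *v h) + (h - 0) \<bullet> (M *v (y - x))) / 2)) (at y)"
    unfolding quad_def[abs_def]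
    by (intro has_derivative_add has_derivative_const has_derivative_inner_right has_derivative_diff
        has_derivative_ident bounded_linear.has_derivative[OF bounded_linear_divide] has_derivative_inner) 
  then show ?thesis
    by (rule has_derivative_eq_rhs)
       (auto simp: fun_eq_iff inner_add_left inner_commute[of "M *v _"] symmetric_bilinear[OF assms])
qed

lemma grad_quad: "M \<in> Sym \<Longrightarrow> grad (quad s p M x) = (\<lambda>y. p + M *v (y - x))"
  by (intro ext grad_eqI has_derivative_quad)

lemma has_derivative_grad_quad:
  assumes "M \<in> Sym"
  shows "(grad (quad s p M x) has_derivative (*v) M) (at y)"
proof -
  have "((\<lambda>y. p + M *v (y - x)) has_derivative (\<lambda>h. 0 + M *v (h - 0))) (at y)"
    by (intro has_derivative_add has_derivative_const
        bounded_linear.has_derivative[OF matrix_vector_mul_bounded_linear] has_derivative_diff has_derivative_ident)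
  then show ?thesis by (simp add: grad_quad[OF assms])
qed

lemma hessian_quad: "M \<in> Sym \<Longrightarrow> hessian (quad s p M x) y = M"
  using frechet_derivative_at[OF has_derivative_grad_quad]
  by (metis hessian_def jacobian_def matrix_of_matrix_vector_mul)

lemma J2_quad: "M \<in> Sym \<Longrightarrow> J2 (quad s p M x) x = (s, p, M)"
  by (simp add: J2_def grad_quad hessian_quad) (simp add: quad_def)

lemma C2_on_quad: "M \<in> Sym \<Longrightarrow> C2_on \<Omega> (quad s p M x)"
  unfolding C2_on_def
  by (auto simp: hessian_quad cong: continuous_on_cong
      intro: differentiableI[OF has_derivative_quad] differentiableI[OF has_derivative_grad_quad])

lemma eventually_nhds_shift:
  fixes x :: "'a::real_normed_vector"
  assumes "\<forall>\<^sub>F h in nhds 0. P (x + h)"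
  shows "\<forall>\<^sub>F y in nhds x. P y"
proof -
  have "((\<lambda>y. y - x) \<longlongrightarrow> x - x) (nhds x)"
    by (intro tendsto_intros filterlim_ident)
  then have "filterlim (\<lambda>y. y - x) (nhds 0) (nhds x)" by simp
  from eventually_compose_filterlim[OF assms this] show ?thesis by simp
qed

text \<open>Quadratic polynomials are of class C^2 on the whole of \<Omega>, so a local paraboloid
  inequality can be fed into the viscosity definition without cut-off. These are the only test
  functions used.\<close>

lemma subsolution_quad:
  assumes "visc_subsolution \<Omega> F U \<psi>" "x \<in> \<Omega>" "M \<in> Sym" "\<psi> x = ereal s"
    and "\<forall>\<^sub>F h in nhds 0. \<psi> (x + h) \<le> ereal (quad s p M x (x + h))"
  shows "(x, s, p, M) \<in> closure U \<and> 1 \<le> F (x, s, p, M)"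
proof -
  have "\<forall>\<^sub>F y in nhds x. \<psi> y \<le> ereal (quad s p M x y)"
    by (rule eventually_nhds_shift) (rule assms(5))
  then have "\<forall>\<^sub>F y in nhds x. \<psi> y - ereal (quad s p M x y) \<le> 0"
    by eventually_elim (simp add: ereal_minus_le)
  moreover have "\<psi> x - ereal (quad s p M x x) = 0"
    using assms(4) by (simp add: quad_def)
  ultimately have "(x, J2 (quad s p M x) x) \<in> closure U \<and> 1 \<le> F (x, J2 (quad s p M x) x)"
    using assms(1,2) C2_on_quad[OF assms(3)] unfolding visc_subsolution_def by blast
  then show ?thesis by (simp add: J2_quad[OF assms(3)])
qed

lemma supersolution_quad:
  assumes "visc_supersolution \<Omega> F U \<psi>" "x \<in> \<Omega>" "M \<in> Sym" "\<psi> x = ereal s"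
    and "\<forall>\<^sub>F h in nhds 0. ereal (quad s p M x (x + h)) \<le> \<psi> (x + h)"
  shows "(x, s, p, M) \<notin> closure U \<or> F (x, s, p, M) \<le> 1"
proof -
  have "\<forall>\<^sub>F y in nhds x. ereal (quad s p M x y) \<le> \<psi> y"
    by (rule eventually_nhds_shift) (rule assms(5))
  then have "\<forall>\<^sub>F y in nhds x. \<psi> y - ereal (quad s p M x y) \<ge> 0"
    by eventually_elim (simp add: ereal_le_minus)
  moreover have "\<psi> x - ereal (quad s p M x x) = 0"
    using assms(4) by (simp add: quad_def)
  ultimately have "(x, J2 (quad s p M x) x) \<notin> closure U \<or> F (x, J2 (quad s p M x) x) \<le> 1"
    using assms(1,2) C2_on_quad[OF assms(3)] unfolding visc_supersolution_def by blast
  then show ?thesis by (simp add: J2_quad[OF assms(3)])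
qed

section \<open>Symmetric matrices and their norms\<close>

definition outer :: "real^'n \<Rightarrow> real^'n^'n" where
  "outer v = (\<chi> i j. v $ i * v $ j)"

lemma outer_mult: "outer v *v h = (v \<bullet> h) *\<^sub>R v"
  by (simp add: outer_def matrix_vector_mult_def vec_eq_iff inner_vec_def sum_distrib_left sum_distrib_right mult_ac)

lemma outer_Sym: "outer v \<in> Sym"
  by (simp add: Sym_def outer_def transpose_def vec_eq_iff mult.commute)

lemma outer_nonneg_def: "nonneg_def (outer v)"
  by (simp add: nonneg_def_def outer_mult inner_commute)

lemma Sym_closed: "closed (Sym :: (real^'n^'n) set)"
proof -
  have eq: "(Sym :: (real^'n^'n) set) = (\<Inter>i. \<Inter>j. {M. M $ i $ j = M $ j $ i})"
    by (auto simp: Sym_def transpose_def vec_eq_iff)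
  show ?thesis
    unfolding eq by (intro closed_INT ballI closed_Collect_eq continuous_intros)
qed

lemma Sym_add: "A \<in> Sym \<Longrightarrow> B \<in> Sym \<Longrightarrow> A + B \<in> Sym"
  and Sym_diff: "A \<in> Sym \<Longrightarrow> B \<in> Sym \<Longrightarrow> A - B \<in> Sym"
  and Sym_scaleR: "A \<in> Sym \<Longrightarrow> c *\<^sub>R A \<in> Sym"
  and Sym_uminus: "A \<in> Sym \<Longrightarrow> - A \<in> Sym"
  and Sym_mat1: "mat 1 \<in> Sym"
  and Sym_symmetrize: "C + transpose C \<in> Sym"
  by (auto simp: Sym_def transpose_def mat_def vec_eq_iff)

lemma norm_outer: "norm (outer v) = (norm v)\<^sup>2"
proof -
  have "outer v $ i = v $ i *\<^sub>R v" for i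
    by (simp add: outer_def vec_eq_iff)
  then have "norm (outer v) = L2_set (\<lambda>i. norm (v $ i) * norm v) UNIV"
    by (simp add: norm_vec_def[of "outer v"])
  also have "\<dots> = norm v * norm v"
    by (simp add: L2_set_left_distrib[symmetric]) (simp add: norm_vec_def[of v])
  finally show ?thesis by (simp add: power2_eq_square)
qed

lemma norm_matrix_le_entries:
  fixes M :: "real^'n^'n"
  assumes "\<And>i j. \<bar>M $ i $ j\<bar> \<le> b"
  shows "norm M \<le> real (CARD('n) * CARD('n)) * b"
proof -
  have "norm M \<le> (\<Sum>i\<in>UNIV. norm (M $ i))"
    unfolding norm_vec_def[of M] by (rule L2_set_le_sum) simp
  also have "\<dots> \<le> (\<Sum>i\<in>(UNIV::'n set). \<Sum>j\<in>(UNIV::'n set). b)"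
    by (intro sum_mono order_trans[OF norm_le_l1_cart]) (use assms in auto)
  finally show ?thesis by simp
qed

lemma norm_has_derivative_lipschitz_le:
  fixes G :: "'a::real_normed_vector \<Rightarrow> 'b::real_normed_vector"
  assumes dG: "(G has_derivative A) (at x)" and lip: "K-lipschitz_on S G" and S: "open S" "x \<in> S"
  shows "norm (A h) \<le> K * norm h"
proof (rule field_le_epsilon)
  fix e :: real assume e: "0 < e"
  define e' where "e' = e / (norm h + 1)"
  have e': "0 < e'" using e by (simp add: e'_def add_nonneg_pos)
  obtain d1 where d1: "d1 > 0" "\<And>y. norm (y - x) < d1 \<Longrightarrow> norm (G y - G x - A (y - x)) \<le> e' * norm (y - x)"
    using dG e' unfolding has_derivative_at_alt by blast
  obtain d2 where d2: "d2 > 0" "ball x d2 \<subseteq> S" using S openE by blast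
  \<comment> \<open>So small that \<open>x + t *\<^sub>R h\<close> stays in the set where both the
    expansion and the Lipschitz bound hold; the added 1 covers \<open>h = 0\<close>.\<close>
  define t where "t = min d1 d2 / (2 * (norm h + 1))"
  have t: "0 < t" using d1 d2 by (simp add: t_def add_nonneg_pos)
  have "norm (t *\<^sub>R h) = t * norm h" using t by simp
  also have "\<dots> < t * (2 * (norm h + 1))"
  proof (rule mult_strict_left_mono[OF _ t])
    have "k < 2 * (k + 1)" if "0 \<le> k" for k :: real using that by simp
    then show "norm h < 2 * (norm h + 1)" using norm_ge_zero by blast
  qed
  also have "\<dots> = min d1 d2" by (simp add: t_def add_nonneg_eq_0_iff)
  finally have small: "norm (t *\<^sub>R h) < min d1 d2" .
  have xS: "x + t *\<^sub>R h \<in> S"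
    using small by (intro subsetD[OF d2(2)]) (simp add: dist_norm)
  have "norm (A (t *\<^sub>R h)) \<le> norm (G (x + t *\<^sub>R h) - G x) + norm (G (x + t *\<^sub>R h) - G x - A (t *\<^sub>R h))"
    using norm_triangle_sub[of "A (t *\<^sub>R h)" "G (x + t *\<^sub>R h) - G x"]
    by (simp only: norm_minus_commute[of "A (t *\<^sub>R h)"])
  also have "norm (G (x + t *\<^sub>R h) - G x) \<le> K * norm (t *\<^sub>R h)"
    using lipschitz_onD[OF lip xS S(2)] by (simp add: dist_norm)
  also have "norm (G (x + t *\<^sub>R h) - G x - A (t *\<^sub>R h)) \<le> e' * norm (t *\<^sub>R h)"
    using d1(2)[of "x + t *\<^sub>R h"] small by simp
  finally have "t * norm (A h) \<le> t * (K * norm h + e' * norm h)"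
    using t by (simp add: linear_scale[OF has_derivative_linear[OF dG]] algebra_simps)
  then have "norm (A h) \<le> K * norm h + e' * norm h" using t by (rule mult_left_le_imp_le)
  also have "e' * norm h \<le> e" using e by (simp add: e'_def divide_le_eq add_nonneg_pos)
  finally show "norm (A h) \<le> K * norm h + e" by simp
qed

text \<open>Cutting off from below replaces the value \<open>-\<infinity>\<close> by a real one and
  preserves upper semicontinuity. With \<open>m\<close> low enough, the touching points never see
  the cut.\<close>

lemma usc_on_real_truncation:
  assumes usc: "USC_on \<Omega> u" and B: "B \<subseteq> \<Omega>"
  shows "usc_on B (\<lambda>x. real_of_ereal (max (u x) (ereal m)))"
proof (rule usc_onI)
  fix x c assume x: "x \<in> B" and c: "real_of_ereal (max (u x) (ereal m)) < c"
  have nin: "u y \<noteq> \<infinity>" if "y \<in> B" for y using usc B that by (auto simp: USC_on_def)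
  have eq: "real_of_ereal (max (u y) (ereal m)) < c \<longleftrightarrow> u y < ereal c \<and> m < c" if "y \<in> B" for y
    using nin[OF that] by (cases "u y") (auto simp: max_def)
  have "\<forall>\<^sub>F y in at x within \<Omega>. u y < ereal c"
    using usc x B c eq[OF x] by (auto simp: USC_on_def)
  then obtain T where T: "open T" "x \<in> T" "\<forall>y\<in>T. y \<noteq> x \<longrightarrow> y \<in> \<Omega> \<longrightarrow> u y < ereal c"
    unfolding eventually_at_topological by blast
  have "\<forall>y\<in>T \<inter> B. real_of_ereal (max (u y) (ereal m)) < c"
  proof
    fix y assume y: "y \<in> T \<inter> B"
    show "real_of_ereal (max (u y) (ereal m)) < c"
    proof (cases "y = x")
      case False
      then have "u y < ereal c" using T(3) y B by blast
      then show ?thesis using y eq[of y] eq[OF x] c by simp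
    qed (simp add: c)
  qed
  then show "\<exists>T. open T \<and> x \<in> T \<and> (\<forall>y\<in>T \<inter> B. real_of_ereal (max (u y) (ereal m)) < c)"
    using T by blast
qed

section \<open>The Hopf barrier and its derivatives\<close>

definition barrier :: "real \<Rightarrow> real \<Rightarrow> real^'n \<Rightarrow> real^'n \<Rightarrow> real" where
  "barrier \<alpha> R z x = exp (- \<alpha> * (norm (x - z))\<^sup>2) - exp (- \<alpha> * R\<^sup>2)"

definition barrier_grad :: "real \<Rightarrow> real^'n \<Rightarrow> real^'n \<Rightarrow> real^'n" where
  "barrier_grad \<alpha> z x = - (2 * \<alpha> * exp (- \<alpha> * (norm (x - z))\<^sup>2)) *\<^sub>R (x - z)"

text \<open>The Hessian of \<open>barrier\<close>: a nonnegative rank-one part of order \<alpha>^2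
  minus a multiple of the identity of order \<alpha>. Away from \<open>z\<close> the first part wins
  for large \<alpha>, and it is the increment to which (F3) is applied.\<close>

definition barrier_hess :: "real \<Rightarrow> real^'n \<Rightarrow> real^'n \<Rightarrow> real^'n^'n" where
  "barrier_hess \<alpha> z x = exp (- \<alpha> * (norm (x - z))\<^sup>2) *\<^sub>R ((4 * \<alpha>\<^sup>2) *\<^sub>R outer (x - z) - (2 * \<alpha>) *\<^sub>R mat 1)"

lemma has_derivative_exp_norm:
  "((\<lambda>x. exp (- \<alpha> * (norm (x - z))\<^sup>2)) has_derivative
    (\<lambda>h. exp (- \<alpha> * (norm (x - z))\<^sup>2) * (- \<alpha> * (2 * ((x - z) \<bullet> h))))) (at x)"
  for z :: "'a::real_inner"
  unfolding power2_norm_eq_inner by (auto intro!: derivative_eq_intros simp: inner_commute)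

lemma has_derivative_barrier:
  "(barrier \<alpha> R z has_derivative (\<lambda>h. barrier_grad \<alpha> z x \<bullet> h)) (at x)"
proof -
  have "(barrier \<alpha> R z has_derivative
      (\<lambda>h. exp (- \<alpha> * (norm (x - z))\<^sup>2) * (- \<alpha> * (2 * ((x - z) \<bullet> h))) - 0)) (at x)"
    unfolding barrier_def[abs_def] by (intro has_derivative_diff has_derivative_exp_norm has_derivative_const)
  then show ?thesis by (simp add: barrier_grad_def mult_ac)
qed

lemma has_derivative_barrier_grad:
  "(barrier_grad \<alpha> z has_derivative (\<lambda>h. barrier_hess \<alpha> z x *v h)) (at x)"
proof -
  let ?e = "exp (- \<alpha> * (norm (x - z))\<^sup>2)"
  have "((\<lambda>x. (- (2 * \<alpha>)) *\<^sub>R exp (- \<alpha> * (norm (x - z))\<^sup>2) *\<^sub>R (x - z)) has_derivative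
     (\<lambda>h. (- (2 * \<alpha>)) *\<^sub>R (?e *\<^sub>R (h - 0) + (?e * (- \<alpha> * (2 * ((x - z) \<bullet> h)))) *\<^sub>R (x - z)))) (at x)"
    by (intro has_derivative_scaleR_right has_derivative_scaleR has_derivative_exp_norm has_derivative_diff
        has_derivative_ident has_derivative_const)
  then show ?thesis
    unfolding barrier_grad_def[abs_def] barrier_hess_def
    by (rule has_derivative_eq_rhs[THEN has_derivative_transform_within_open[OF _ open_UNIV]])
      (auto simp: fun_eq_iff outer_mult algebra_simps power2_eq_square
       matrix_vector_mult_diff_rdistrib scaleR_matrix_vector_assoc[symmetric])
qed

lemma lipschitz_barrier_grad:
  assumes "0 < \<alpha>"
  shows "\<exists>K. K-lipschitz_on (cball x0 r) (barrier_grad \<alpha> z)"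
proof -
  define D where "D = norm x0 + r + norm z"
  define K where "K = 2 * \<alpha> + 4 * \<alpha>\<^sup>2 * D\<^sup>2"
  have "K-lipschitz_on (cball x0 r) (barrier_grad \<alpha> z)"
  proof (rule bounded_derivative_imp_lipschitz[OF has_derivative_at_withinI[OF has_derivative_barrier_grad]])
    fix x assume x: "x \<in> cball x0 r"
    let ?e = "exp (- \<alpha> * (norm (x - z))\<^sup>2)"
    show "onorm (\<lambda>h. barrier_hess \<alpha> z x *v h) \<le> K"
    proof (rule onorm_le)
      fix h
      have "norm (x - z) \<le> D"
        using x norm_triangle_ineq4[of x z] norm_triangle_sub[of x x0] norm_minus_commute[of x x0]
        by (simp add: D_def dist_norm)
      then have nD: "(norm (x - z))\<^sup>2 \<le> D\<^sup>2" by (intro power_mono) auto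
      have "barrier_hess \<alpha> z x *v h = ?e *\<^sub>R ((4 * \<alpha>\<^sup>2 * ((x - z) \<bullet> h)) *\<^sub>R (x - z) - (2 * \<alpha>) *\<^sub>R h)"
        by (simp add: barrier_hess_def outer_mult matrix_vector_mult_diff_rdistrib scaleR_matrix_vector_assoc[symmetric])
      then have "norm (barrier_hess \<alpha> z x *v h) = ?e * norm ((4 * \<alpha>\<^sup>2 * ((x - z) \<bullet> h)) *\<^sub>R (x - z) - (2 * \<alpha>) *\<^sub>R h)"
        by simp
      also have "\<dots> \<le> 1 * norm ((4 * \<alpha>\<^sup>2 * ((x - z) \<bullet> h)) *\<^sub>R (x - z) - (2 * \<alpha>) *\<^sub>R h)"
        using assms by (intro mult_right_mono) auto
      also have "\<dots> \<le> 4 * \<alpha>\<^sup>2 * \<bar>(x - z) \<bullet> h\<bar> * norm (x - z) + 2 * \<alpha> * norm h"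
        using norm_triangle_ineq4[of "(4 * \<alpha>\<^sup>2 * ((x - z) \<bullet> h)) *\<^sub>R (x - z)" "(2 * \<alpha>) *\<^sub>R h"] assms
        by (simp add: abs_mult)
      also have "\<dots> \<le> 4 * \<alpha>\<^sup>2 * (norm (x - z) * norm h) * norm (x - z) + 2 * \<alpha> * norm h"
        by (intro add_right_mono mult_right_mono mult_left_mono Cauchy_Schwarz_ineq2) auto
      also have "\<dots> = (4 * \<alpha>\<^sup>2 * (norm (x - z))\<^sup>2 + 2 * \<alpha>) * norm h"
        by (simp add: power2_eq_square algebra_simps)
      also have "\<dots> \<le> K * norm h"
        using nD assms by (intro mult_right_mono) (auto simp: K_def)
      finally show "norm (barrier_hess \<alpha> z x *v h) \<le> K * norm h" .
    qed
  qed (use assms in \<open>auto simp: K_def\<close>)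
  then show ?thesis ..
qed

section \<open>Jets near a contact point\<close>

text \<open>A point off \<open>Z\<close> but close to it has a nearest point \<open>x0\<close> in
  \<open>Z\<close>. The ball reaching out to \<open>x0\<close> may touch \<open>Z\<close> elsewhere
  too; the ball of half the radius, internally tangent at \<open>x0\<close>, touches only
  there.\<close>

lemma interior_ball_touching:
  fixes \<Omega> Z :: "'a::euclidean_space set"
  assumes \<Omega>: "open \<Omega>" "connected \<Omega>" and Z: "Z \<subseteq> \<Omega>" "open (\<Omega> - Z)"
    and a: "a \<in> Z" and b: "b \<in> \<Omega>" "b \<notin> Z"
  obtains x0 z R where "x0 \<in> Z" "0 < R" "dist z x0 = R" "\<forall>x\<in>cball z R. x \<noteq> x0 \<longrightarrow> x \<in> \<Omega> - Z"
proof -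
  define A where "A = \<Omega> - Z"
  have "\<exists>c\<in>Z. c \<in> closure A"
  proof (rule ccontr)
    assume "\<not> ?thesis"
    then have "A = \<Omega> \<inter> closure A" using closure_subset[of A] by (auto simp: A_def)
    then have "closedin (top_of_set \<Omega>) A" unfolding closedin_closed using closed_closure by blast
    moreover have "openin (top_of_set \<Omega>) A"
      using Z(2) by (intro open_openin_trans) (use \<Omega> in \<open>auto simp: A_def\<close>)
    ultimately have "A = {} \<or> A = \<Omega>" using \<Omega>(2) unfolding connected_clopen by blast
    then show False using a b Z(1) by (auto simp: A_def)
  qed
  then obtain c where c: "c \<in> Z" "c \<in> closure A" by blast
  obtain \<delta> where \<delta>: "\<delta> > 0" "cball c \<delta> \<subseteq> \<Omega>"
    using \<Omega>(1) c(1) Z(1) open_contains_cball by blast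
  \<comment> \<open>With distance below \<open>\<delta> / 2\<close> to \<open>c\<close>, the ball
    around \<open>b'\<close> that reaches its nearest point of \<open>Z\<close> stays inside
    \<open>cball c \<delta>\<close>, where \<open>Z\<close> is closed.\<close>
  obtain b' where b': "b' \<in> A" "dist b' c < \<delta> / 2"
    using c(2) \<delta>(1) unfolding closure_approachable by (meson half_gt_zero)
  have eq: "Z \<inter> cball c \<delta> = cball c \<delta> \<inter> - A" using \<delta>(2) by (auto simp: A_def)
  have "closed (Z \<inter> cball c \<delta>)"
    unfolding eq using Z(2)[folded A_def] by (intro closed_Int closed_Compl closed_cball)
  moreover have "c \<in> Z \<inter> cball c \<delta>" using c \<delta> by auto
  ultimately obtain x0 where x0: "x0 \<in> Z \<inter> cball c \<delta>" "\<And>y. y \<in> Z \<inter> cball c \<delta> \<Longrightarrow> dist b' x0 \<le> dist b' y"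
    using distance_attains_inf[of "Z \<inter> cball c \<delta>" b'] by blast
  define R where "R = dist b' x0 / 2"
  define z where "z = midpoint b' x0"
  have R: "2 * R < \<delta> / 2" using x0(2)[of c] c \<delta> b'(2) by (simp add: R_def)
  have "b' \<noteq> x0" using b' x0 by (auto simp: A_def)
  then have "0 < R" by (simp add: R_def)
  moreover have "dist z x0 = R" by (simp add: z_def R_def dist_midpoint)
  moreover have "x \<in> \<Omega> - Z" if x: "x \<in> cball z R" "x \<noteq> x0" for x
  proof -
    \<comment> \<open>Parallelogram identity: the squared distances from \<open>x\<close> to the
      endpoints of a diameter of the large ball's radius segment add up to at most
      \<open>(2 * R)\<^sup>2\<close>, so a point other than \<open>x0\<close> is strictly closer
      than \<open>2 * R\<close> to \<open>b'\<close>.\<close>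
    have par: "(norm (p + q))\<^sup>2 + (norm (p - q))\<^sup>2 = 2 * (norm p)\<^sup>2 + 2 * (norm q)\<^sup>2" for p q :: 'a
      unfolding power2_norm_eq_inner by (simp add: inner_add_left inner_add_right inner_diff_left inner_diff_right)
    let ?q = "(1/2) *\<^sub>R (b' - x0)"
    have e1: "(x - z) + ?q = x - x0" and e2: "(x - z) - ?q = x - b'"
      by (simp_all add: z_def midpoint_def algebra_simps flip: scaleR_add_left)
    have nq: "norm ?q = R" by (simp add: R_def dist_norm)
    have "(norm (x - x0))\<^sup>2 + (norm (x - b'))\<^sup>2 = 2 * (norm (x - z))\<^sup>2 + 2 * R\<^sup>2"
      using par[of "x - z" ?q] unfolding e1 e2 nq .
    moreover have "(norm (x - z))\<^sup>2 \<le> R\<^sup>2"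
      using x(1) by (intro power_mono) (auto simp: dist_norm norm_minus_commute)
    moreover have "0 < (norm (x - x0))\<^sup>2" using x(2) by simp
    moreover have "(2 * R)\<^sup>2 = 4 * R\<^sup>2" by (simp add: power_mult_distrib)
    ultimately have "(norm (x - b'))\<^sup>2 < (2 * R)\<^sup>2" by linarith
    then have lt: "dist b' x < 2 * R"
      using \<open>0 < R\<close> by (metis dist_norm norm_minus_commute power_less_imp_less_base less_imp_le mult_pos_pos zero_less_numeral)
    then have "dist c x \<le> \<delta>"
      using dist_triangle[of c x b'] b'(2) R by (simp add: dist_commute)
    then show ?thesis
      using x0(2)[of x] lt \<delta>(2) by (auto simp: R_def)
  qed
  ultimately show ?thesis using that x0(1) by blast
qed

text \<open>One second-order expansion of \<open>w\<close> at \<open>x\<close> serves twice: from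
  below for \<open>w\<close> itself, and from above, after subtracting the barrier, for
  \<open>u\<close> at \<open>y\<close> through \<open>touch\<close>. The price is an error
  \<open>e\<close> times the squared norm in each direction.\<close>

lemma jets_at_touching_point:
  fixes w :: "real^'n \<Rightarrow> real" and u :: "real^'n \<Rightarrow> real"
  assumes dw: "\<forall>\<^sub>F y in nhds x. (w has_derivative (\<lambda>h. G y \<bullet> h)) (at y)"
    and dG: "(G has_derivative A) (at x)" and A: "\<And>h. norm (A h) \<le> K * norm h" and e: "0 < e"
    and touch: "\<forall>\<^sub>F h in nhds 0. u (y + h) \<le> u y + (w (x + h) - \<epsilon> * barrier \<alpha> R z (x + h))
        - (w x - \<epsilon> * barrier \<alpha> R z x) + p \<bullet> h"
  shows "\<exists>Y\<in>Sym. norm Y \<le> real (CARD('n) * CARD('n)) * K + 2 * e * norm (mat 1 :: real^'n^'n) \<and>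
    (\<forall>\<^sub>F h in nhds 0. quad (w x) (G x) Y x (x + h) \<le> w (x + h)) \<and>
    (\<forall>\<^sub>F h in nhds 0. u (y + h) \<le> quad (u y) (G x - \<epsilon> *\<^sub>R barrier_grad \<alpha> z x + p)
        (Y - \<epsilon> *\<^sub>R barrier_hess \<alpha> z x + (4 * e) *\<^sub>R mat 1) y (y + h))"
proof -
  define C where "C = matrix A"
  \<comment> \<open>Jets require symmetric matrices, while \<open>A\<close> is just a linear map.
    Symmetrising keeps the quadratic form, which is all that the expansions contain, and the bound
    on the entries.\<close>
  define S where "S = (1/2) *\<^sub>R (C + transpose C)"
  \<comment> \<open>Halved in \<open>quad\<close>, the shift by \<open>2 * e\<close> turns the
    expansion into a lower bound; adding \<open>4 * e\<close> turns the error from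
    \<open>- e\<close> to \<open>+ e\<close> for the upper bound.\<close>
  define Y where "Y = S - (2 * e) *\<^sub>R mat 1"
  have linA: "linear A" using dG has_derivative_linear by blast
  then have AC: "A h = C *v h" for h by (simp add: C_def matrix_works)
  have quadS: "h \<bullet> (S *v h) = h \<bullet> A h" for h
  proof -
    have "h \<bullet> (transpose C *v h) = (h \<bullet> (C *v h))"
      by (metis dot_lmul_matrix inner_commute transpose_matrix_vector)
    then show ?thesis
      by (simp add: S_def AC matrix_vector_mult_add_rdistrib scaleR_matrix_vector_assoc[symmetric] inner_add_right)
  qed
  have "\<bar>C $ i $ j\<bar> \<le> K" for i j
  proof -
    have "C $ i $ j = A (axis j 1) $ i"
      by (simp add: C_def matrix_def)
    also have "\<bar>\<dots>\<bar> \<le> norm (A (axis j 1))" by (rule component_le_norm_cart)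
    also have "\<dots> \<le> K" using A[of "axis j 1"] by simp
    finally show ?thesis .
  qed
  then have CC: "\<bar>C $ i $ j + C $ j $ i\<bar> \<le> K + K" for i j
    by (intro order_trans[OF abs_triangle_ineq] add_mono)
  have Sij: "\<bar>S $ i $ j\<bar> \<le> K" for i j
    using CC[of i j] by (simp add: S_def transpose_def mult.commute)
  have SymS: "S \<in> Sym" unfolding S_def by (intro Sym_scaleR Sym_symmetrize)
  have SymY: "Y \<in> Sym" unfolding Y_def by (intro Sym_diff Sym_scaleR SymS Sym_mat1)
  have nY: "norm Y \<le> real (CARD('n) * CARD('n)) * K + 2 * e * norm (mat 1 :: real^'n^'n)"
    using norm_triangle_ineq4[of S "(2 * e) *\<^sub>R mat 1"] norm_matrix_le_entries[OF Sij] e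
    by (simp add: Y_def)
  have low: "\<forall>\<^sub>F h in nhds 0. quad (w x) (G x) Y x (x + h) \<le> w (x + h)"
    using second_order_taylor[OF dw dG e]
  proof eventually_elim
    case (elim h)
    have "h \<bullet> (Y *v h) / 2 = h \<bullet> A h / 2 - e * (norm h)\<^sup>2"
      by (simp add: Y_def matrix_vector_mult_diff_rdistrib scaleR_matrix_vector_assoc[symmetric]
          inner_diff_right quadS power2_norm_eq_inner field_simps)
    then show ?case using elim unfolding quad_def add_diff_cancel_left' by linarith
  qed
  define W where "W x = w x - \<epsilon> * barrier \<alpha> R z x" for x
  define GW where "GW x = G x - \<epsilon> *\<^sub>R barrier_grad \<alpha> z x" for x
  have dW: "\<forall>\<^sub>F y in nhds x. (W has_derivative (\<lambda>h. GW y \<bullet> h)) (at y)"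
    using dw
  proof eventually_elim
    case (elim y)
    have "(W has_derivative (\<lambda>h. G y \<bullet> h - \<epsilon> * (barrier_grad \<alpha> z y \<bullet> h))) (at y)"
      unfolding W_def by (intro has_derivative_diff elim has_derivative_mult_right has_derivative_barrier)
    then show ?case by (simp add: GW_def inner_diff_left)
  qed
  have dGW: "(GW has_derivative (\<lambda>h. A h - \<epsilon> *\<^sub>R (barrier_hess \<alpha> z x *v h))) (at x)"
    unfolding GW_def by (intro has_derivative_diff dG has_derivative_scaleR_right has_derivative_barrier_grad)
  have up: "\<forall>\<^sub>F h in nhds 0. u (y + h) \<le> quad (u y) (GW x + p)
        (Y - \<epsilon> *\<^sub>R barrier_hess \<alpha> z x + (4 * e) *\<^sub>R mat 1) y (y + h)"
    using second_order_taylor[OF dW dGW e] touch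
  proof eventually_elim
    case (elim h)
    have "h \<bullet> ((Y - \<epsilon> *\<^sub>R barrier_hess \<alpha> z x + (4 * e) *\<^sub>R mat 1) *v h) / 2
        = h \<bullet> (A h - \<epsilon> *\<^sub>R (barrier_hess \<alpha> z x *v h)) / 2 + e * (norm h)\<^sup>2"
      by (simp add: Y_def matrix_vector_mult_diff_rdistrib matrix_vector_mult_add_rdistrib scaleR_matrix_vector_assoc[symmetric]
          inner_diff_right inner_add_right quadS power2_norm_eq_inner field_simps)
    then show ?case using elim unfolding quad_def add_diff_cancel_left' W_def inner_add_left by linarith
  qed
  show ?thesis
    using SymY nY low up unfolding GW_def by blast
qed

lemma barrier_hess_Sym: "barrier_hess \<alpha> z x \<in> Sym"
  unfolding barrier_hess_def by (intro Sym_scaleR Sym_diff outer_Sym Sym_mat1)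

lemma barrier_le_1: "0 < \<alpha> \<Longrightarrow> barrier \<alpha> R z x \<le> 1"
  unfolding barrier_def by (smt (verit) exp_ge_zero exp_le_one_iff mult_nonneg_nonneg zero_le_power2 mult_minus_left)

lemma barrier_neg: "0 < \<alpha> \<Longrightarrow> 0 \<le> R \<Longrightarrow> R < dist z x \<Longrightarrow> barrier \<alpha> R z x < 0"
  unfolding barrier_def by (simp add: dist_norm norm_minus_commute power_strict_mono)

text \<open>An upper jet \<open>(s, p, M)\<close> of \<open>u\<close> at \<open>y\<close> and a
  lower jet \<open>(w x, G x, Y)\<close> of \<open>w\<close> at \<open>x\<close> that differ by
  \<epsilon> times the barrier jet, up to \<kappa>. For the values only the lower bound on
  \<open>s\<close> is recorded; the upper one will follow from \<open>u \<le> w\<close> and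
  continuity of \<open>w\<close>.\<close>

definition approx_touching where
  "approx_touching u w G x0 r0 z R L \<alpha> \<rho> \<epsilon> \<kappa> \<longleftrightarrow> (\<exists>x y s p M Y.
      x \<in> cball x0 r0 \<and> y \<in> cball x0 r0 \<and> dist x0 x < \<rho> \<and> dist x y < \<kappa> \<and> u y = ereal s \<and>
      M \<in> Sym \<and> Y \<in> Sym \<and> norm Y \<le> L \<and>
      (\<forall>\<^sub>F h in nhds 0. u (y + h) \<le> ereal (quad s p M y (y + h))) \<and>
      (\<forall>\<^sub>F h in nhds 0. quad (w x) (G x) Y x (x + h) \<le> w (x + h)) \<and>
      w x - \<epsilon> * barrier \<alpha> R z x - \<kappa> \<le> s \<and>
      norm (p - (G x - \<epsilon> *\<^sub>R barrier_grad \<alpha> z x)) \<le> \<kappa> \<and>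
      norm (M - (Y - \<epsilon> *\<^sub>R barrier_hess \<alpha> z x)) \<le> \<kappa>)"

text \<open>The order of the quantifiers matters. \<open>L\<close> and the geometry precede
  \<alpha>, since \<alpha> will depend on a compact set built from them; \<epsilon> precedes
  \<kappa>, so that \<kappa> can tend to 0 with the barrier term kept fixed.\<close>

lemma touching_jets:
  fixes \<Omega> :: "(real^'n) set" and u :: "real^'n \<Rightarrow> ereal" and w :: "real^'n \<Rightarrow> real"
  assumes \<Omega>: "open \<Omega>" "connected \<Omega>"
    and usc: "USC_on \<Omega> u"
    and dw: "\<And>x. x \<in> \<Omega> \<Longrightarrow> (w has_derivative (\<lambda>h. G x \<bullet> h)) (at x)"
    and lip: "\<And>C. compact C \<Longrightarrow> C \<subseteq> \<Omega> \<Longrightarrow> \<exists>L. L-lipschitz_on C G"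
    and le: "\<And>x. x \<in> \<Omega> \<Longrightarrow> u x \<le> ereal (w x)"
    and a: "a \<in> \<Omega>" "u a = ereal (w a)" and b: "b \<in> \<Omega>" "u b \<noteq> ereal (w b)"
  obtains x0 z R r0 L where "0 < R" "dist z x0 = R" "0 < r0" "cball x0 r0 \<subseteq> \<Omega>"
    "\<forall>\<alpha>>0. \<forall>\<rho>>0. \<exists>\<epsilon>>0. \<epsilon> < \<rho> \<and> (\<forall>\<kappa>>0. approx_touching u w G x0 r0 z R L \<alpha> \<rho> \<epsilon> \<kappa>)"
proof -
  define Z where "Z = {x \<in> \<Omega>. u x = ereal (w x)}"
  have contw: "isCont w x" if "x \<in> \<Omega>" for x using dw[OF that] by (rule has_derivative_continuous)
  have nPInf: "u x \<noteq> \<infinity>" if "x \<in> \<Omega>" for x using usc that by (auto simp: USC_on_def)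
  have oZ: "open (\<Omega> - Z)"
  proof (subst open_subopen, rule ballI)
    fix x assume x: "x \<in> \<Omega> - Z"
    then have "u x < ereal (w x)" using le[of x] by (auto simp: Z_def less_le)
    then obtain c where c: "u x < ereal c" "c < w x" using ereal_dense2 by force
    have "\<forall>\<^sub>F y in at x. u y < ereal c"
      using usc x c(1) at_within_open[OF _ \<Omega>(1), of x] by (auto simp: USC_on_def)
    then have "\<forall>\<^sub>F y in nhds x. u y < ereal c"
      using c(1) by (simp add: eventually_nhds_conv_at)
    moreover have "\<forall>\<^sub>F y in nhds x. c < w y"
      using order_tendstoD(1)[OF isContD[OF contw[of x]] c(2)] x c(2) by (simp add: eventually_nhds_conv_at)
    moreover have "\<forall>\<^sub>F y in nhds x. y \<in> \<Omega>"
      using x \<Omega>(1) by (auto intro: eventually_nhds_in_open)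
    ultimately have "\<forall>\<^sub>F y in nhds x. y \<in> \<Omega> - Z"
    proof eventually_elim
      case (elim y)
      then have "u y < ereal (w y)" using less_trans[of "u y" "ereal c" "ereal (w y)"] by simp
      then show ?case using elim by (auto simp: Z_def)
    qed
    then show "\<exists>T. open T \<and> x \<in> T \<and> T \<subseteq> \<Omega> - Z" unfolding eventually_nhds by blast
  qed
  have ab: "Z \<subseteq> \<Omega>" "a \<in> Z" "b \<notin> Z" using a b by (auto simp: Z_def)
  obtain x0 z R where x0: "x0 \<in> Z" and R: "0 < R" "dist z x0 = R"
    and inside: "\<forall>x\<in>cball z R. x \<noteq> x0 \<longrightarrow> x \<in> \<Omega> - Z"
    by (rule interior_ball_touching[OF \<Omega> ab(1) oZ ab(2) b(1) ab(3)])
  have x0\<Omega>: "x0 \<in> \<Omega>" "u x0 = ereal (w x0)" using x0 by (auto simp: Z_def)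
  obtain r0 where r0: "0 < r0" "cball x0 r0 \<subseteq> \<Omega>"
    using \<Omega>(1) x0\<Omega>(1) open_contains_cball by blast
  obtain K where K: "K-lipschitz_on (cball x0 r0) G" using lip[OF compact_cball r0(2)] by blast
  have "continuous_on (cball x0 r0) w"
    using contw r0(2) by (intro continuous_at_imp_continuous_on) blast
  then obtain xm where xm: "\<And>x. x \<in> cball x0 r0 \<Longrightarrow> w xm \<le> w x"
    using continuous_attains_inf[OF compact_cball, of x0 r0 w] r0(1) by fastforce
  \<comment> \<open>At a touching point \<open>v y\<close> exceeds the minimum of \<open>w\<close>
    minus 2, one unit being lost to \<epsilon> times the barrier and one to \<kappa>. Hence
    \<open>v y\<close> is above \<open>m\<close>, and there the truncation is inactive.\<close>
  define m where "m = w xm - 3"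
  define v where "v x = real_of_ereal (max (u x) (ereal m))" for x
  have v_eq: "ereal (v x) = max (u x) (ereal m)" if "x \<in> \<Omega>" for x
    using nPInf[OF that] by (cases "u x") (auto simp: v_def max_def)
  have v_le: "v x \<le> w x" if "x \<in> cball x0 r0" for x
  proof -
    have "x \<in> \<Omega>" using that r0(2) by blast
    from v_eq[OF this] le[OF this] have "ereal (v x) \<le> ereal (w x)"
      using xm[OF that] by (simp add: m_def)
    then show ?thesis by simp
  qed
  have v_lt: "v x < w x" if "x \<in> cball x0 r0" "x \<in> \<Omega> - Z" for x
  proof -
    have "u x < ereal (w x)" using that(2) le[of x] by (auto simp: Z_def less_le)
    then have "ereal (v x) < ereal (w x)"
      using xm[OF that(1)] that v_eq[of x] by (auto simp: m_def)
    then show ?thesis by simp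
  qed
  have uv: "u x \<le> ereal (v x)" if "x \<in> \<Omega>" for x using v_eq[OF that] by simp
  define I where "I = norm (mat 1 :: real^'n^'n)"
  \<comment> \<open>The summand 1 absorbs the shift of \<open>Y\<close> by \<open>2 * e\<close>
    times the identity.\<close>
  define L where "L = real (CARD('n) * CARD('n)) * K + 1"
  have main: "\<exists>\<epsilon>>0. \<epsilon> < \<rho> \<and> (\<forall>\<kappa>>0. approx_touching u w G x0 r0 z R L \<alpha> \<rho> \<epsilon> \<kappa>)"
    if \<alpha>: "0 < \<alpha>" and \<rho>: "0 < \<rho>" for \<alpha> \<rho>
  proof -
    define r where "r = min r0 (\<rho> / 2)"
    have r: "0 < r" "r \<le> r0" "r < \<rho>" using r0 \<rho> by (auto simp: r_def min_def)
    have sub: "cball x0 r \<subseteq> cball x0 r0" using r by auto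
    then have sub\<Omega>: "cball x0 r \<subseteq> \<Omega>" using r0(2) by blast
    have uscv: "usc_on B v" if "B \<subseteq> \<Omega>" for B
      unfolding v_def[abs_def] by (rule usc_on_real_truncation[OF usc that])
    \<comment> \<open>On this compact set \<open>x0\<close> is missing, so \<open>v < w\<close> with
      a positive gap, which bounds the admissible \<epsilon>.\<close>
    define S where "S = sphere x0 r \<inter> cball z R"
    have Ssub: "S \<subseteq> cball x0 r" by (auto simp: S_def)
    have "\<exists>\<epsilon>>0. \<epsilon> < \<rho> \<and> \<epsilon> < 1 \<and> (\<forall>x\<in>S. v x < w x - \<epsilon>)"
    proof (cases "S = {}")
      case True
      then show ?thesis using \<rho> by (intro exI[of _ "min \<rho> 1 / 2"]) (auto simp: min_def)
    next
      case False
      have cS: "compact S" unfolding S_def by (intro compact_Int compact_sphere compact_cball)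
      have "usc_on S (\<lambda>x. v x + - w x)"
        using Ssub sub\<Omega> contw
        by (intro usc_on_add_continuous uscv continuous_on_minus continuous_at_imp_continuous_on) blast+
      from usc_on_attains_sup[OF cS False this] obtain xs
        where xs: "xs \<in> S" "\<And>y. y \<in> S \<Longrightarrow> v y + - w y \<le> v xs + - w xs" by blast
      have "xs \<noteq> x0" using xs(1) r(1) by (auto simp: S_def)
      then have "v xs < w xs"
        using inside \<open>xs \<noteq> x0\<close> xs(1) Ssub sub by (intro v_lt) (auto simp: S_def)
      define \<epsilon> where "\<epsilon> = min (min \<rho> 1) (w xs - v xs) / 2"
      have "0 < \<epsilon>" "\<epsilon> < \<rho>" "\<epsilon> < 1" "\<epsilon> < w xs - v xs"
        using \<open>v xs < w xs\<close> \<rho> by (auto simp: \<epsilon>_def min_def)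
      moreover have "\<forall>x\<in>S. v x < w x - \<epsilon>"
      proof
        fix x assume "x \<in> S"
        then show "v x < w x - \<epsilon>" using xs(2)[of x] \<open>\<epsilon> < w xs - v xs\<close> by linarith
      qed
      ultimately show ?thesis by blast
    qed
    then obtain \<epsilon> where \<epsilon>: "0 < \<epsilon>" "\<epsilon> < \<rho>" "\<epsilon> < 1" "\<And>x. x \<in> S \<Longrightarrow> v x < w x - \<epsilon>" by blast
    define W where "W x = w x - \<epsilon> * barrier \<alpha> R z x" for x
    define GW where "GW x = G x - \<epsilon> *\<^sub>R barrier_grad \<alpha> z x" for x
    have dW: "(W has_derivative (\<lambda>h. GW x \<bullet> h)) (at x)" if "x \<in> cball x0 r" for x
    proof -
      have x: "x \<in> \<Omega>" using that sub\<Omega> by blast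
      have "(W has_derivative (\<lambda>h. G x \<bullet> h - \<epsilon> * (barrier_grad \<alpha> z x \<bullet> h))) (at x)"
        unfolding W_def by (intro has_derivative_diff dw[OF x] has_derivative_mult_right has_derivative_barrier)
      then show ?thesis by (simp add: GW_def inner_diff_left)
    qed
    obtain K' where K': "K'-lipschitz_on (cball x0 r) (barrier_grad \<alpha> z)"
      using lipschitz_barrier_grad[OF \<alpha>] by blast
    have lipW: "(K + \<bar>\<epsilon>\<bar> * K')-lipschitz_on (cball x0 r) GW"
      unfolding GW_def by (intro lipschitz_on_diff lipschitz_on_subset[OF K sub] lipschitz_on_cmult K')
    have center: "W x0 \<le> v x0"
    proof -
      have "barrier \<alpha> R z x0 = 0" using R by (simp add: barrier_def dist_norm norm_minus_commute)
      moreover have "ereal (w x0) \<le> ereal (v x0)" using uv[OF x0\<Omega>(1)] x0\<Omega>(2) by simp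
      ultimately show ?thesis by (simp add: W_def)
    qed
    \<comment> \<open>Inside the closed ball the gap beats \<epsilon> times the barrier, which is at
      most \<epsilon>. Outside, the barrier is negative, so \<open>W\<close> lies above
      \<open>w\<close> and \<open>v \<le> w\<close> suffices.\<close>
    have sphere: "v x < W x" if x: "x \<in> sphere x0 r" for x
    proof (cases "x \<in> cball z R")
      case True
      then have "v x < w x - \<epsilon>" using x by (intro \<epsilon>(4)) (simp add: S_def)
      moreover have "\<epsilon> * barrier \<alpha> R z x \<le> \<epsilon> * 1"
        using barrier_le_1[OF \<alpha>] \<epsilon>(1) by (intro mult_left_mono) auto
      ultimately show ?thesis by (simp add: W_def)
    next
      case False
      have "\<epsilon> * barrier \<alpha> R z x < 0"
        using False R(1) barrier_neg[OF \<alpha>, of R z x] \<epsilon>(1) by (simp add: mult_pos_neg)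
      moreover have "v x \<le> w x" using x sub by (intro v_le) auto
      ultimately show ?thesis by (simp add: W_def)
    qed
    define N where "N = {x \<in> ball x0 r0. \<not> G differentiable at x}"
    have N: "negligible N" unfolding N_def by (rule negligible_not_differentiable_lipschitz[OF K r0(1)])
    have "approx_touching u w G x0 r0 z R L \<alpha> \<rho> \<epsilon> \<kappa>" if \<kappa>: "0 < \<kappa>" for \<kappa>
    proof -
      \<comment> \<open>The cap 1 serves the choice of \<open>m\<close>.\<close>
      define k where "k = min \<kappa> 1"
      have k: "0 < k" "k \<le> \<kappa>" "k \<le> 1" using \<kappa> by (auto simp: k_def)
      obtain x y p where x: "x \<in> ball x0 r" "x \<notin> N" and y: "y \<in> ball x0 r" and p: "norm p < k"
        and xy: "dist x y < k" and val: "W x - k < v y"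
        and touch: "\<forall>\<^sub>F h in nhds 0. v (y + h) \<le> v y + W (x + h) - W x + p \<bullet> h"
        by (rule perturbed_touching_point[OF r(1) uscv[OF sub\<Omega>] dW lipW center sphere N k(1)])
      have xy0: "x \<in> ball x0 r0" "y \<in> ball x0 r0" using x y r by auto
      have xy\<Omega>: "x \<in> \<Omega>" "y \<in> \<Omega>" using xy0 r0(2) by (auto simp: subset_iff)
      obtain A where A: "(G has_derivative A) (at x)"
        using x(2) xy0(1) unfolding N_def differentiable_def by blast
      have Ab: "norm (A h) \<le> K * norm h" for h
        by (rule norm_has_derivative_lipschitz_le[OF A lipschitz_on_subset[OF K ball_subset_cball] open_ball xy0(1)])
      have dwx: "\<forall>\<^sub>F y in nhds x. (w has_derivative (\<lambda>h. G y \<bullet> h)) (at y)"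
        using eventually_nhds_in_open[OF \<Omega>(1) xy\<Omega>(1)] by eventually_elim (rule dw)
      \<comment> \<open>Makes \<open>4 * e * I \<le> k\<close>, so the matrix error stays below
        \<kappa> and the norm of \<open>Y\<close> below \<open>L\<close>; \<open>I + 1\<close>
        avoids any division by zero.\<close>
      define e where "e = k / (4 * (I + 1))"
      have I: "0 \<le> I" by (simp add: I_def)
      have e: "0 < e" "4 * e * I \<le> k"
        using k I by (auto simp: e_def divide_simps mult_left_mono)
      have touch': "\<forall>\<^sub>F h in nhds 0. v (y + h) \<le> v y + (w (x + h) - \<epsilon> * barrier \<alpha> R z (x + h))
        - (w x - \<epsilon> * barrier \<alpha> R z x) + p \<bullet> h"
        using touch by (simp add: W_def)
      obtain Y where Y: "Y \<in> Sym" "norm Y \<le> real (CARD('n) * CARD('n)) * K + 2 * e * I"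
        and low: "\<forall>\<^sub>F h in nhds 0. quad (w x) (G x) Y x (x + h) \<le> w (x + h)"
        and up: "\<forall>\<^sub>F h in nhds 0. v (y + h) \<le> quad (v y) (G x - \<epsilon> *\<^sub>R barrier_grad \<alpha> z x + p)
          (Y - \<epsilon> *\<^sub>R barrier_hess \<alpha> z x + (4 * e) *\<^sub>R mat 1) y (y + h)"
        using jets_at_touching_point[OF dwx A Ab e(1) touch'] unfolding I_def by blast
      define M where "M = Y - \<epsilon> *\<^sub>R barrier_hess \<alpha> z x + (4 * e) *\<^sub>R mat 1"
      have "M \<in> Sym"
        unfolding M_def by (intro Sym_add Sym_diff Sym_scaleR Y barrier_hess_Sym Sym_mat1)
      have "2 * e * I \<le> 1" using e k I by linarith
      then have nY: "norm Y \<le> L" using Y(2) by (simp add: L_def)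
      have uy: "u y = ereal (v y)"
      proof -
        have "\<epsilon> * barrier \<alpha> R z x \<le> \<epsilon> * 1"
          using barrier_le_1[OF \<alpha>] \<epsilon>(1) by (intro mult_left_mono) auto
        then have "m < v y"
          using val xm[of x] xy0(1) \<epsilon>(3) k(3) by (simp add: W_def m_def)
        then have "ereal m < ereal (v y)" by simp
        then show ?thesis unfolding v_eq[OF xy\<Omega>(2)] by (auto simp: max_def split: if_splits)
      qed
      from up eventually_nhds_add_open[OF \<Omega>(1) xy\<Omega>(2)] have up': "\<forall>\<^sub>F h in nhds 0. u (y + h) \<le> ereal (quad (v y) (G x - \<epsilon> *\<^sub>R barrier_grad \<alpha> z x + p) M y (y + h))"
      proof eventually_elim
        case (elim h)
        then show ?case using uv[of "y + h"] by (intro order_trans[OF uv]) (auto simp: M_def)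
      qed
      have "norm (M - (Y - \<epsilon> *\<^sub>R barrier_hess \<alpha> z x)) \<le> \<kappa>"
        using e k by (simp add: M_def I_def)
      moreover have "norm (G x - \<epsilon> *\<^sub>R barrier_grad \<alpha> z x + p - (G x - \<epsilon> *\<^sub>R barrier_grad \<alpha> z x)) \<le> \<kappa>"
        using p k by simp
      moreover have "w x - \<epsilon> * barrier \<alpha> R z x - \<kappa> \<le> v y" using val k by (simp add: W_def)
      moreover have "x \<in> cball x0 r0" "y \<in> cball x0 r0" "dist x0 x < \<rho>" "dist x y < \<kappa>"
        using xy0 x r xy k by auto
      ultimately show ?thesis
        using \<open>M \<in> Sym\<close> Y(1) nY low up' uy unfolding approx_touching_def by blast
    qed
    then show ?thesis using \<epsilon>(1,2) by blast
  qed
  show ?thesis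
    by (rule that[OF R r0]) (use main in blast)
qed

lemma quad_uminus: "quad (- s) (- p) (- M) x y = - quad s p M x y"
  using matrix_vector_mult_diff_rdistrib[of 0 M "y - x"] by (simp add: quad_def)

lemma LSC_on_imp_USC_on_uminus: "LSC_on \<Omega> \<psi> \<Longrightarrow> USC_on \<Omega> (\<lambda>x. - \<psi> x)"
  unfolding LSC_on_def USC_on_def by (auto simp: ereal_uminus_less_reorder ereal_uminus_eq_reorder)

lemma C11_gradient_bounded:
  assumes f: "C11_loc_on \<Omega> f" and C: "compact C" "C \<subseteq> \<Omega>"
  shows "\<exists>b. \<forall>x\<in>C. \<bar>f x\<bar> + norm (grad f x) \<le> b"
proof -
  obtain L where "L-lipschitz_on C (grad f)" using f C unfolding C11_loc_on_def by blast
  then have g: "continuous_on C (grad f)" by (rule lipschitz_on_continuous_on)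
  have "continuous_on C f"
    using f C(2) has_derivative_continuous[OF has_derivative_grad] unfolding C11_loc_on_def
    by (intro continuous_at_imp_continuous_on) blast
  with g have "continuous_on C (\<lambda>x. \<bar>f x\<bar> + norm (grad f x))" by (intro continuous_intros)
  then have "bounded ((\<lambda>x. \<bar>f x\<bar> + norm (grad f x)) ` C)"
    using C(1) compact_continuous_image compact_imp_bounded by blast
  then obtain b where "\<forall>y\<in>(\<lambda>x. \<bar>f x\<bar> + norm (grad f x)) ` C. norm y \<le> b"
    unfolding bounded_iff by blast
  then show ?thesis by (intro exI[of _ b]) force
qed

lemma norm_triple_le: "norm (s, p, M) \<le> \<bar>s\<bar> + norm p + norm M" for s :: real
  using norm_Pair_le[of s "(p, M)"] norm_Pair_le[of p M] by simp

text \<open>A subsolution jet at \<open>x1\<close> and a supersolution jet at \<open>x2\<close>,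
  with the barrier taken at a third point \<open>x\<close>, so that either function may be the
  regular one. The disjunction with \<open>B\<close> bounds the regular function's jet. The
  inequality with \<open>f\<close> stands for \<psi>1 \<le> \<psi>2, which cannot be used across two
  points; it becomes \<open>s1 \<le> s2\<close> when the points merge. Symmetry of \<open>M2\<close>
  is recorded because \<open>U\<close> is open only relative to the jet space.\<close>

definition approx_jet_pair where
  "approx_jet_pair F U f x0 r0 z R B \<alpha> \<rho> \<epsilon> \<kappa> \<longleftrightarrow> (\<exists>x x1 x2 s1 p1 M1 s2 p2 M2.
      x1 \<in> cball x0 r0 \<and> x2 \<in> cball x0 r0 \<and> dist x0 x < \<rho> \<and> dist x x1 < \<kappa> \<and> dist x x2 < \<kappa> \<and>
      M2 \<in> Sym \<and> (x1, s1, p1, M1) \<in> closure U \<and> 1 \<le> F (x1, s1, p1, M1) \<and>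
      ((x2, s2, p2, M2) \<notin> closure U \<or> F (x2, s2, p2, M2) \<le> 1) \<and>
      (norm (s1, p1, M1) \<le> B \<or> norm (s2, p2, M2) \<le> B) \<and>
      s1 - s2 \<le> \<bar>f x1 - f x2\<bar> \<and> s2 - \<epsilon> * barrier \<alpha> R z x - \<kappa> \<le> s1 \<and>
      norm (p1 - (p2 - \<epsilon> *\<^sub>R barrier_grad \<alpha> z x)) \<le> \<kappa> \<and>
      norm (M1 - (M2 - \<epsilon> *\<^sub>R barrier_hess \<alpha> z x)) \<le> \<kappa>)"

text \<open>If \<open>\<psi>1\<close> is the regular function, the estimate for \<open>\<psi>2\<close> comes from \<open>touching_jets\<close>
  applied to \<open>- \<psi>2 \<le> - \<psi>1\<close>; the auxiliary point \<open>x\<close> is always the one belonging to the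
  regular function.\<close>

lemma touching_jet_pairs:
  fixes \<Omega> :: "(real^'n) set"
  assumes \<Omega>: "open \<Omega>" "connected \<Omega>"
    and sub: "visc_subsolution \<Omega> F U \<psi>1" and super: "visc_supersolution \<Omega> F U \<psi>2"
    and le: "\<forall>x\<in>\<Omega>. \<psi>1 x \<le> \<psi>2 x"
    and C11: "ereal_C11_loc_on \<Omega> \<psi>1 \<or> ereal_C11_loc_on \<Omega> \<psi>2"
    and a: "a \<in> \<Omega>" "\<psi>1 a = \<psi>2 a" and b: "b \<in> \<Omega>" "\<psi>1 b \<noteq> \<psi>2 b"
  obtains x0 z R r0 B f where "0 < R" "dist z x0 = R" "0 < r0" "cball x0 r0 \<subseteq> \<Omega>"
    "continuous_on (cball x0 r0) f"
    "\<forall>\<alpha>>0. \<forall>\<rho>>0. \<exists>\<epsilon>>0. \<epsilon> < \<rho> \<and> (\<forall>\<kappa>>0. approx_jet_pair F U f x0 r0 z R B \<alpha> \<rho> \<epsilon> \<kappa>)"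
proof -
  have usc: "USC_on \<Omega> \<psi>1" "USC_on \<Omega> (\<lambda>x. - \<psi>2 x)"
    using sub super LSC_on_imp_USC_on_uminus unfolding visc_subsolution_def visc_supersolution_def by auto
  consider f where "C11_loc_on \<Omega> f" "\<And>x. x \<in> \<Omega> \<Longrightarrow> \<psi>2 x = ereal (f x)"
    | f where "C11_loc_on \<Omega> f" "\<And>x. x \<in> \<Omega> \<Longrightarrow> \<psi>1 x = ereal (f x)"
    using C11 unfolding ereal_C11_loc_on_def by blast
  then show ?thesis
  proof cases
    case 1
    note f = 1
    have df: "(f has_derivative (\<lambda>h. grad f x \<bullet> h)) (at x)" if "x \<in> \<Omega>" for x
      using f(1) that unfolding C11_loc_on_def by (blast intro: has_derivative_grad)
    have lip: "\<exists>L. L-lipschitz_on C (grad f)" if "compact C" "C \<subseteq> \<Omega>" for C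
      using f(1) that unfolding C11_loc_on_def by blast
    have le': "\<psi>1 x \<le> ereal (f x)" if "x \<in> \<Omega>" for x using le f(2) that by force
    have a': "\<psi>1 a = ereal (f a)" and b': "\<psi>1 b \<noteq> ereal (f b)" using a b f(2) by auto
    obtain x0 z R r0 L where g: "0 < R" "dist z x0 = R" "0 < r0" "cball x0 r0 \<subseteq> \<Omega>"
      and jets: "\<forall>\<alpha>>0. \<forall>\<rho>>0. \<exists>\<epsilon>>0. \<epsilon> < \<rho> \<and> (\<forall>\<kappa>>0. approx_touching \<psi>1 f (grad f) x0 r0 z R L \<alpha> \<rho> \<epsilon> \<kappa>)"
      by (rule touching_jets[OF \<Omega> usc(1) df lip le' a(1) a' b(1) b'])
    obtain B0 where B0: "\<forall>x\<in>cball x0 r0. \<bar>f x\<bar> + norm (grad f x) \<le> B0"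
      using C11_gradient_bounded[OF f(1) compact_cball g(4)] by blast
    have cf: "continuous_on (cball x0 r0) f"
      using df g(4) has_derivative_continuous by (intro continuous_at_imp_continuous_on) blast
    show ?thesis
    proof (rule that[OF g cf], intro allI impI)
      fix \<alpha> \<rho> :: real assume "0 < \<alpha>" "0 < \<rho>"
      with jets obtain \<epsilon> where \<epsilon>: "0 < \<epsilon>" "\<epsilon> < \<rho>" and
        *: "\<forall>\<kappa>>0. approx_touching \<psi>1 f (grad f) x0 r0 z R L \<alpha> \<rho> \<epsilon> \<kappa>" by blast
      show "\<exists>\<epsilon>>0. \<epsilon> < \<rho> \<and> (\<forall>\<kappa>>0. approx_jet_pair F U f x0 r0 z R (B0 + L) \<alpha> \<rho> \<epsilon> \<kappa>)"
      proof (intro exI[of _ \<epsilon>] conjI \<epsilon> allI impI)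
        fix \<kappa> :: real assume \<kappa>: "0 < \<kappa>"
        from *[rule_format, OF \<kappa>] obtain x y s p M Y where
          h: "x \<in> cball x0 r0" "y \<in> cball x0 r0" "dist x0 x < \<rho>" "dist x y < \<kappa>" "\<psi>1 y = ereal s"
          "M \<in> Sym" "Y \<in> Sym" "norm Y \<le> L"
          "\<forall>\<^sub>F h in nhds 0. \<psi>1 (y + h) \<le> ereal (quad s p M y (y + h))"
          "\<forall>\<^sub>F h in nhds 0. quad (f x) (grad f x) Y x (x + h) \<le> f (x + h)"
          "f x - \<epsilon> * barrier \<alpha> R z x - \<kappa> \<le> s"
          "norm (p - (grad f x - \<epsilon> *\<^sub>R barrier_grad \<alpha> z x)) \<le> \<kappa>"
          "norm (M - (Y - \<epsilon> *\<^sub>R barrier_hess \<alpha> z x)) \<le> \<kappa>"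
          unfolding approx_touching_def by (elim exE conjE)
        have xy: "x \<in> \<Omega>" "y \<in> \<Omega>" using h(1,2) g(4) by blast+
        have "\<forall>\<^sub>F h in nhds 0. ereal (quad (f x) (grad f x) Y x (x + h)) \<le> \<psi>2 (x + h)"
          using h(10) eventually_nhds_add_open[OF \<Omega>(1) xy(1)] by eventually_elim (simp add: f(2))
        from supersolution_quad[OF super xy(1) h(7) f(2)[OF xy(1)] this]
        have 2: "(x, f x, grad f x, Y) \<notin> closure U \<or> F (x, f x, grad f x, Y) \<le> 1" .
        have 1: "(y, s, p, M) \<in> closure U" "1 \<le> F (y, s, p, M)"
          using subsolution_quad[OF sub xy(2) h(6,5,9)] by auto
        have 3: "s - f x \<le> \<bar>f y - f x\<bar>" using le'[OF xy(2)] h(5) by simp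
        have 4: "norm (f x, grad f x, Y) \<le> B0 + L"
          using B0 h(1,8) by (intro order_trans[OF norm_triple_le] add_mono) auto
        have 5: "dist x x < \<kappa>" using \<kappa> by simp
        show "approx_jet_pair F U f x0 r0 z R (B0 + L) \<alpha> \<rho> \<epsilon> \<kappa>"
          unfolding approx_jet_pair_def
          by (rule exI[of _ x], rule exI[of _ y], rule exI[of _ x], rule exI[of _ s], rule exI[of _ p],
              rule exI[of _ M], rule exI[of _ "f x"], rule exI[of _ "grad f x"], rule exI[of _ Y])
             (intro conjI h 1 2 3 5 disjI2[OF 4])
      qed
    qed
  next
    case 2
    note f = 2
    have df: "((\<lambda>x. - f x) has_derivative (\<lambda>h. - grad f x \<bullet> h)) (at x)" if "x \<in> \<Omega>" for x
    proof -
      have "(f has_derivative (\<lambda>h. grad f x \<bullet> h)) (at x)"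
        using f(1) that unfolding C11_loc_on_def by (blast intro: has_derivative_grad)
      from has_derivative_minus[OF this] show ?thesis by simp
    qed
    have lip: "\<exists>L. L-lipschitz_on C (\<lambda>x. - grad f x)" if "compact C" "C \<subseteq> \<Omega>" for C
      using f(1) that unfolding C11_loc_on_def by (metis lipschitz_on_minus)
    have le': "- \<psi>2 x \<le> ereal (- f x)" if "x \<in> \<Omega>" for x
      using le f(2)[OF that] that by (metis ereal_minus_le_minus uminus_ereal.simps(1))
    have a': "- \<psi>2 a = ereal (- f a)" and b': "- \<psi>2 b \<noteq> ereal (- f b)"
      using a b f(2) by (metis uminus_ereal.simps(1), metis ereal_uminus_eq_iff uminus_ereal.simps(1))
    obtain x0 z R r0 L where g: "0 < R" "dist z x0 = R" "0 < r0" "cball x0 r0 \<subseteq> \<Omega>"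
      and jets: "\<forall>\<alpha>>0. \<forall>\<rho>>0. \<exists>\<epsilon>>0. \<epsilon> < \<rho> \<and> (\<forall>\<kappa>>0. approx_touching (\<lambda>x. - \<psi>2 x) (\<lambda>x. - f x) (\<lambda>x. - grad f x) x0 r0 z R L \<alpha> \<rho> \<epsilon> \<kappa>)"
      by (rule touching_jets[OF \<Omega> usc(2) df lip le' a(1) a' b(1) b'])
    obtain B0 where B0: "\<forall>x\<in>cball x0 r0. \<bar>f x\<bar> + norm (grad f x) \<le> B0"
      using C11_gradient_bounded[OF f(1) compact_cball g(4)] by blast
    have cf: "continuous_on (cball x0 r0) f"
    proof -
      have "continuous_on (cball x0 r0) (\<lambda>x. - f x)"
        using df g(4) has_derivative_continuous by (intro continuous_at_imp_continuous_on) blast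
      then show ?thesis using continuous_on_minus by force
    qed
    show ?thesis
    proof (rule that[OF g cf], intro allI impI)
      fix \<alpha> \<rho> :: real assume "0 < \<alpha>" "0 < \<rho>"
      with jets obtain \<epsilon> where \<epsilon>: "0 < \<epsilon>" "\<epsilon> < \<rho>" and
        *: "\<forall>\<kappa>>0. approx_touching (\<lambda>x. - \<psi>2 x) (\<lambda>x. - f x) (\<lambda>x. - grad f x) x0 r0 z R L \<alpha> \<rho> \<epsilon> \<kappa>" by blast
      show "\<exists>\<epsilon>>0. \<epsilon> < \<rho> \<and> (\<forall>\<kappa>>0. approx_jet_pair F U f x0 r0 z R (B0 + L) \<alpha> \<rho> \<epsilon> \<kappa>)"
      proof (intro exI[of _ \<epsilon>] conjI \<epsilon> allI impI)
        fix \<kappa> :: real assume \<kappa>: "0 < \<kappa>"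
        from *[rule_format, OF \<kappa>] obtain x y s p M Y where
          h: "x \<in> cball x0 r0" "y \<in> cball x0 r0" "dist x0 x < \<rho>" "dist x y < \<kappa>" "- \<psi>2 y = ereal s"
          "M \<in> Sym" "Y \<in> Sym" "norm Y \<le> L"
          "\<forall>\<^sub>F h in nhds 0. - \<psi>2 (y + h) \<le> ereal (quad s p M y (y + h))"
          "\<forall>\<^sub>F h in nhds 0. quad (- f x) (- grad f x) Y x (x + h) \<le> - f (x + h)"
          "- f x - \<epsilon> * barrier \<alpha> R z x - \<kappa> \<le> s"
          "norm (p - (- grad f x - \<epsilon> *\<^sub>R barrier_grad \<alpha> z x)) \<le> \<kappa>"
          "norm (M - (Y - \<epsilon> *\<^sub>R barrier_hess \<alpha> z x)) \<le> \<kappa>"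
          unfolding approx_touching_def by (elim exE conjE)
        have xy: "x \<in> \<Omega>" "y \<in> \<Omega>" using h(1,2) g(4) by blast+
        have "\<forall>\<^sub>F h in nhds 0. \<psi>1 (x + h) \<le> ereal (quad (f x) (grad f x) (- Y) x (x + h))"
          using h(10) eventually_nhds_add_open[OF \<Omega>(1) xy(1)]
        proof eventually_elim
          case (elim h)
          then show ?case using quad_uminus[of "- f x" "- grad f x" Y x "x + h"] by (simp add: f(2))
        qed
        from subsolution_quad[OF sub xy(1) Sym_uminus[OF h(7)] f(2)[OF xy(1)] this]
        have 1: "(x, f x, grad f x, - Y) \<in> closure U" "1 \<le> F (x, f x, grad f x, - Y)" by auto
        have \<psi>y: "\<psi>2 y = ereal (- s)" using h(5) by (metis ereal_uminus_uminus uminus_ereal.simps(1))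
        have "\<forall>\<^sub>F h in nhds 0. ereal (quad (- s) (- p) (- M) y (y + h)) \<le> \<psi>2 (y + h)"
          using h(9)
        proof eventually_elim
          case (elim h)
          then show ?case by (cases "\<psi>2 (y + h)") (auto simp: quad_uminus)
        qed
        from supersolution_quad[OF super xy(2) Sym_uminus[OF h(6)] \<psi>y this]
        have 2: "(y, - s, - p, - M) \<notin> closure U \<or> F (y, - s, - p, - M) \<le> 1" .
        have 3: "f x - - s \<le> \<bar>f x - f y\<bar>"
          using le'[OF xy(2)] h(5) by simp
        have 4: "norm (f x, grad f x, - Y) \<le> B0 + L"
          using B0 h(1,8) by (intro order_trans[OF norm_triple_le] add_mono) auto
        have 5: "dist x x < \<kappa>" using \<kappa> by simp
        have 6: "- s - \<epsilon> * barrier \<alpha> R z x - \<kappa> \<le> f x" using h(11) by simp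
        \<comment> \<open>The relation between \<open>p1\<close> and \<open>p2\<close> is invariant
          under exchanging them with a change of sign, so the barrier term keeps its sign although
          both functions were negated. The same holds for the matrices.\<close>
        have 7: "norm (grad f x - (- p - \<epsilon> *\<^sub>R barrier_grad \<alpha> z x)) \<le> \<kappa>"
          using h(12) by (simp add: algebra_simps)
        have 8: "norm (- Y - (- M - \<epsilon> *\<^sub>R barrier_hess \<alpha> z x)) \<le> \<kappa>"
          using h(13) by (simp add: algebra_simps)
        show "approx_jet_pair F U f x0 r0 z R (B0 + L) \<alpha> \<rho> \<epsilon> \<kappa>"
          unfolding approx_jet_pair_def
          by (rule exI[of _ x], rule exI[of _ x], rule exI[of _ y], rule exI[of _ "f x"], rule exI[of _ "grad f x"],
              rule exI[of _ "- Y"], rule exI[of _ "- s"], rule exI[of _ "- p"], rule exI[of _ "- M"])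
             (intro conjI h(1-4) Sym_uminus[OF h(6)] 1 2 3 5 6 7 8 disjI1[OF 4])
      qed
    qed
  qed
qed

section \<open>The limit of the jets\<close>

lemma continuous_on_outer: "continuous_on S outer"
  unfolding outer_def[abs_def] by (intro continuous_intros)

lemma continuous_on_barrier: "continuous_on S (barrier \<alpha> R z)"
  unfolding barrier_def[abs_def] by (intro continuous_intros)

lemma continuous_on_barrier_grad: "continuous_on S (barrier_grad \<alpha> z)"
  unfolding barrier_grad_def[abs_def] by (intro continuous_intros)

lemma continuous_on_barrier_hess: "continuous_on S (barrier_hess \<alpha> z)"
proof -
  have "continuous_on S (\<lambda>x. outer (x - z))"
    by (rule continuous_on_compose2[OF continuous_on_outer[of UNIV]]) (auto intro: continuous_intros)
  then show ?thesis
    unfolding barrier_hess_def[abs_def] by (intro continuous_intros)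
qed

lemma closed_jet_space: "closed (jet_space \<Omega>)"
  unfolding jet_space_def by (intro closed_Times closed_closure closed_UNIV Sym_closed)

lemma openin_jet_topE:
  assumes "openin (jet_top \<Omega>) U"
  obtains T where "open T" "U = jet_space \<Omega> \<inter> T"
  using assms unfolding openin_open by metis

lemma closure_jets_subset:
  assumes "openin (jet_top \<Omega>) U"
  shows "closure U \<subseteq> jet_space \<Omega>"
  by (rule closure_minimal[OF openin_imp_subset[OF assms] closed_jet_space])

text \<open>(F2) excludes the relative boundary. A limit of jets over moving base points may be a
  boundary point of \<open>U\<close> without being one of its slice, hence the boundary is taken
  before the slice.\<close>

lemma in_U_if_F_ge_1:
  assumes U: "openin (jet_top \<Omega>) U" and F2: "condF2 \<Omega> F U"
    and J: "J \<in> closure U" "1 \<le> F J"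
  shows "J \<in> U"
proof (rule ccontr)
  assume nJ: "J \<notin> U"
  obtain x s p M where Jeq: "J = (x, s, p, M)" by (cases J)
  have jet: "J \<in> jet_space \<Omega>" using J(1) closure_jets_subset[OF U] by blast
  have "jet_space \<Omega> \<inter> U = U" using openin_imp_subset[OF U] by blast
  then have "J \<in> jet_top \<Omega> frontier_of U"
    using J(1) nJ jet U by (simp add: frontier_of_def closure_of_subtopology interior_of_openin)
  moreover have "x \<in> closure \<Omega>" using jet by (simp add: Jeq jet_space_def)
  ultimately have "F J < 1"
    using F2 unfolding condF2_def slice_def Jeq by fastforce
  then show False using J(2) by simp
qed

lemma closed_F_ge_1:
  assumes "continuous_on (closure U) F"
  shows "closed {J \<in> closure U. (1::real) \<le> F J}"
proof -
  have "closed (closure U \<inter> F -` {1..})"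
    using assms by (intro continuous_closed_preimage) auto
  moreover have "closure U \<inter> F -` {1..} = {J \<in> closure U. 1 \<le> F J}" by auto
  ultimately show ?thesis by simp
qed

text \<open>The limit \<kappa> \<rightarrow> 0 with \<alpha> and \<epsilon> fixed. The subsolution
  property is closed and passes to the limit. The supersolution alternative is not: it survives when
  the limit jet lies in \<open>U\<close>, because then the approximating jets lie there too and must
  satisfy \<open>F \<le> 1\<close>.\<close>

lemma limit_jet_pair:
  fixes \<Omega> :: "(real^'n) set"
  assumes U: "openin (jet_top \<Omega>) U" and contF: "continuous_on (closure U) F" and F2: "condF2 \<Omega> F U"
    and r0: "cball x0 r0 \<subseteq> \<Omega>" and contf: "continuous_on (cball x0 r0) f" and \<epsilon>: "0 < \<epsilon>" and \<alpha>: "0 < \<alpha>"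
    and approx: "\<forall>\<kappa>>0. approx_jet_pair F U f x0 r0 z R B \<alpha> \<rho> \<epsilon> \<kappa>"
  shows "\<exists>x s1 p M s2. dist x0 x \<le> \<rho> \<and> (x, s1, p, M) \<in> U \<and> 1 \<le> F (x, s1, p, M) \<and>
    s1 \<le> s2 \<and> s2 \<le> s1 + \<epsilon> * barrier \<alpha> R z x \<and>
    (norm (s1, p, M) \<le> B \<or> norm (s2, p + \<epsilon> *\<^sub>R barrier_grad \<alpha> z x, M + \<epsilon> *\<^sub>R barrier_hess \<alpha> z x) \<le> B) \<and>
    ((x, s2, p + \<epsilon> *\<^sub>R barrier_grad \<alpha> z x, M + \<epsilon> *\<^sub>R barrier_hess \<alpha> z x) \<in> U \<longrightarrow>
      F (x, s2, p + \<epsilon> *\<^sub>R barrier_grad \<alpha> z x, M + \<epsilon> *\<^sub>R barrier_hess \<alpha> z x) \<le> 1)"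
proof -
  let ?\<kappa> = "\<lambda>k. 1 / real (Suc k)"
  have \<kappa>: "0 < ?\<kappa> k" "?\<kappa> k \<le> 1" for k by auto
  have \<kappa>lim: "?\<kappa> \<longlonglongrightarrow> 0"
    using LIMSEQ_inverse_real_of_nat by (simp add: inverse_eq_divide)
  have "\<forall>k. approx_jet_pair F U f x0 r0 z R B \<alpha> \<rho> \<epsilon> (?\<kappa> k)" using approx \<kappa>(1) by blast
  then obtain X X1 X2 S1 P1 M1 S2 P2 M2 where *: "\<And>k.
      X1 k \<in> cball x0 r0 \<and> X2 k \<in> cball x0 r0 \<and> dist x0 (X k) < \<rho> \<and> dist (X k) (X1 k) < ?\<kappa> k \<and> dist (X k) (X2 k) < ?\<kappa> k \<and>
      M2 k \<in> Sym \<and> (X1 k, S1 k, P1 k, M1 k) \<in> closure U \<and> 1 \<le> F (X1 k, S1 k, P1 k, M1 k) \<and>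
      ((X2 k, S2 k, P2 k, M2 k) \<notin> closure U \<or> F (X2 k, S2 k, P2 k, M2 k) \<le> 1) \<and>
      (norm (S1 k, P1 k, M1 k) \<le> B \<or> norm (S2 k, P2 k, M2 k) \<le> B) \<and>
      S1 k - S2 k \<le> \<bar>f (X1 k) - f (X2 k)\<bar> \<and> S2 k - \<epsilon> * barrier \<alpha> R z (X k) - ?\<kappa> k \<le> S1 k \<and>
      norm (P1 k - (P2 k - \<epsilon> *\<^sub>R barrier_grad \<alpha> z (X k))) \<le> ?\<kappa> k \<and>
      norm (M1 k - (M2 k - \<epsilon> *\<^sub>R barrier_hess \<alpha> z (X k))) \<le> ?\<kappa> k"
    unfolding approx_jet_pair_def by metis
  have bounded_on: "\<exists>b\<ge>0. \<forall>x\<in>C. norm (g x) \<le> b" if "compact C" "continuous_on C g"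
    for C :: "(real^'n) set" and g :: "real^'n \<Rightarrow> 'b::real_normed_vector"
  proof -
    have "bounded (g ` C)" using that compact_continuous_image compact_imp_bounded by blast
    then obtain b where b: "\<forall>y\<in>g ` C. norm y \<le> b" unfolding bounded_iff by blast
    show ?thesis
      by (rule exI[of _ "\<bar>b\<bar>"]) (use b in \<open>auto intro: order_trans[OF _ abs_ge_self]\<close>)
  qed
  obtain bf where bf: "0 \<le> bf" "\<forall>x\<in>cball x0 r0. norm (f x) \<le> bf"
    using bounded_on[OF compact_cball contf] by blast
  obtain bg where bg: "0 \<le> bg" "\<forall>x\<in>cball x0 \<rho>. norm (barrier_grad \<alpha> z x) \<le> bg"
    using bounded_on[OF compact_cball continuous_on_barrier_grad] by blast
  obtain bh where bh: "0 \<le> bh" "\<forall>x\<in>cball x0 \<rho>. norm (barrier_hess \<alpha> z x) \<le> bh"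
    using bounded_on[OF compact_cball continuous_on_barrier_hess] by blast
  \<comment> \<open>The bound \<open>B\<close> for one jet plus bounds for all differences between
    the two, so that both are controlled whichever one \<open>B\<close> refers to.\<close>
  define D where "D = B + (2 * bf + \<epsilon> + 1) + (\<epsilon> * bg + 1) + (\<epsilon> * bh + 1)"
  have XB: "X k \<in> cball x0 \<rho>" for k using *[of k] by simp
  have dS: "\<bar>S1 k - S2 k\<bar> \<le> 2 * bf + \<epsilon> + 1" for k
  proof -
    have "\<bar>f (X1 k) - f (X2 k)\<bar> \<le> 2 * bf"
      using bf(2) *[of k] by (smt (verit, best) real_norm_def)
    moreover have "\<epsilon> * barrier \<alpha> R z (X k) \<le> \<epsilon> * 1"
      using barrier_le_1[OF \<alpha>] \<epsilon> by (intro mult_left_mono) auto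
    ultimately show ?thesis using *[of k] \<kappa>(2)[of k] \<epsilon> bf(1) by linarith
  qed
  have dP: "norm (P1 k - P2 k) \<le> \<epsilon> * bg + 1" for k
  proof -
    have "norm (P1 k - P2 k) \<le> norm (P1 k - (P2 k - \<epsilon> *\<^sub>R barrier_grad \<alpha> z (X k))) + norm (\<epsilon> *\<^sub>R barrier_grad \<alpha> z (X k))"
      using norm_triangle_ineq4[of "P1 k - (P2 k - \<epsilon> *\<^sub>R barrier_grad \<alpha> z (X k))" "\<epsilon> *\<^sub>R barrier_grad \<alpha> z (X k)"]
      by (simp add: algebra_simps)
    also have "\<dots> \<le> 1 + \<epsilon> * bg"
      using *[of k] \<kappa>(2)[of k] bg(2) XB[of k] \<epsilon> by (intro add_mono) (auto simp: mult_left_mono intro: order_trans)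
    finally show ?thesis by simp
  qed
  have dM: "norm (M1 k - M2 k) \<le> \<epsilon> * bh + 1" for k
  proof -
    have "norm (M1 k - M2 k) \<le> norm (M1 k - (M2 k - \<epsilon> *\<^sub>R barrier_hess \<alpha> z (X k))) + norm (\<epsilon> *\<^sub>R barrier_hess \<alpha> z (X k))"
      using norm_triangle_ineq4[of "M1 k - (M2 k - \<epsilon> *\<^sub>R barrier_hess \<alpha> z (X k))" "\<epsilon> *\<^sub>R barrier_hess \<alpha> z (X k)"]
      by (simp add: algebra_simps)
    also have "\<dots> \<le> 1 + \<epsilon> * bh"
      using *[of k] \<kappa>(2)[of k] bh(2) XB[of k] \<epsilon> by (intro add_mono) (auto simp: mult_left_mono intro: order_trans)
    finally show ?thesis by simp
  qed
  have comps: "norm s \<le> norm (s, p, M) \<and> norm p \<le> norm (s, p, M) \<and> norm M \<le> norm (s, p, M)"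
    for s :: real and p :: "real^'n" and M :: "real^'n^'n"
    using norm_fst_le[of s "(p, M)"] norm_snd_le[of "(p, M)" s] norm_fst_le[of p M] norm_snd_le[of M p]
    by (auto intro: order_trans)
  have bnd: "norm (S1 k) \<le> D \<and> norm (P1 k) \<le> D \<and> norm (M1 k) \<le> D \<and> norm (S2 k) \<le> D" for k
  proof -
    have e: "0 \<le> \<epsilon> * bg" "0 \<le> \<epsilon> * bh" using \<epsilon> bg(1) bh(1) by auto
    have t: "norm (P1 k) \<le> norm (P2 k) + norm (P1 k - P2 k)" "norm (M1 k) \<le> norm (M2 k) + norm (M1 k - M2 k)"
      by (rule norm_triangle_sub)+
    from *[of k] have "norm (S1 k, P1 k, M1 k) \<le> B \<or> norm (S2 k, P2 k, M2 k) \<le> B" by blast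
    then show ?thesis
    proof
      assume "norm (S1 k, P1 k, M1 k) \<le> B"
      then have "norm (S1 k) \<le> B" "norm (P1 k) \<le> B" "norm (M1 k) \<le> B"
        using comps[of "S1 k" "P1 k" "M1 k"] by auto
      then show ?thesis using dS[of k] e \<epsilon> bf(1) unfolding D_def real_norm_def by linarith
    next
      assume "norm (S2 k, P2 k, M2 k) \<le> B"
      then have "norm (S2 k) \<le> B" "norm (P2 k) \<le> B" "norm (M2 k) \<le> B"
        using comps[of "S2 k" "P2 k" "M2 k"] by auto
      then show ?thesis using dS[of k] dP[of k] dM[of k] t e \<epsilon> bf(1) unfolding D_def real_norm_def by linarith
    qed
  qed
  define T where "T k = (X k, S1 k, P1 k, M1 k, S2 k)" for k
  have "compact (cball x0 \<rho> \<times> cball (0::real) D \<times> cball (0::real^'n) D \<times> cball (0::real^'n^'n) D \<times> cball (0::real) D)"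
    by (intro compact_Times compact_cball)
  moreover have "\<forall>k. T k \<in> cball x0 \<rho> \<times> cball 0 D \<times> cball 0 D \<times> cball 0 D \<times> cball 0 D"
    using XB bnd by (auto simp: T_def)
  ultimately obtain l \<sigma> where "l \<in> cball x0 \<rho> \<times> cball (0::real) D \<times> cball (0::real^'n) D \<times> cball (0::real^'n^'n) D \<times> cball (0::real) D"
    "strict_mono \<sigma>" "(T \<circ> \<sigma>) \<longlonglongrightarrow> l"
    unfolding compact_eq_seq_compact_metric seq_compact_def by meson
  then obtain x s1 p M s2 where xl: "x \<in> cball x0 \<rho>" and \<sigma>: "strict_mono \<sigma>" and lim: "(T \<circ> \<sigma>) \<longlonglongrightarrow> (x, s1, p, M, s2)"
    by (cases l) auto
  have limX: "(\<lambda>k. X (\<sigma> k)) \<longlonglongrightarrow> x" using tendsto_fst[OF lim] by (simp add: T_def)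
  have limS1: "(\<lambda>k. S1 (\<sigma> k)) \<longlonglongrightarrow> s1" using tendsto_fst[OF tendsto_snd[OF lim]] by (simp add: T_def)
  have limP1: "(\<lambda>k. P1 (\<sigma> k)) \<longlonglongrightarrow> p" using tendsto_fst[OF tendsto_snd[OF tendsto_snd[OF lim]]] by (simp add: T_def)
  have limM1: "(\<lambda>k. M1 (\<sigma> k)) \<longlonglongrightarrow> M" using tendsto_fst[OF tendsto_snd[OF tendsto_snd[OF tendsto_snd[OF lim]]]] by (simp add: T_def)
  have limS2: "(\<lambda>k. S2 (\<sigma> k)) \<longlonglongrightarrow> s2" using tendsto_snd[OF tendsto_snd[OF tendsto_snd[OF tendsto_snd[OF lim]]]] by (simp add: T_def)
  have \<kappa>\<sigma>: "(\<lambda>k. ?\<kappa> (\<sigma> k)) \<longlonglongrightarrow> 0"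
    using LIMSEQ_subseq_LIMSEQ[OF \<kappa>lim \<sigma>] by (simp add: o_def)
  have shift: "(\<lambda>k. g k - e k) \<longlonglongrightarrow> l" if "g \<longlonglongrightarrow> l" "\<And>k. norm (e k) \<le> ?\<kappa> (\<sigma> k)"
    for g e :: "nat \<Rightarrow> 'b::real_normed_vector" and l
  proof -
    have "e \<longlonglongrightarrow> 0"
      by (rule Lim_null_comparison[OF _ \<kappa>\<sigma>]) (use that(2) in auto)
    from tendsto_diff[OF that(1) this] show ?thesis by simp
  qed
  have limX1: "(\<lambda>k. X1 (\<sigma> k)) \<longlonglongrightarrow> x" and limX2: "(\<lambda>k. X2 (\<sigma> k)) \<longlonglongrightarrow> x"
    using shift[OF limX, of "\<lambda>k. X (\<sigma> k) - X1 (\<sigma> k)"] shift[OF limX, of "\<lambda>k. X (\<sigma> k) - X2 (\<sigma> k)"] *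
    by (auto simp: dist_norm less_imp_le)
  let ?p2 = "p + \<epsilon> *\<^sub>R barrier_grad \<alpha> z x" and ?M2 = "M + \<epsilon> *\<^sub>R barrier_hess \<alpha> z x"
  have limb: "(\<lambda>k. barrier \<alpha> R z (X (\<sigma> k))) \<longlonglongrightarrow> barrier \<alpha> R z x"
    "(\<lambda>k. barrier_grad \<alpha> z (X (\<sigma> k))) \<longlonglongrightarrow> barrier_grad \<alpha> z x"
    "(\<lambda>k. barrier_hess \<alpha> z (X (\<sigma> k))) \<longlonglongrightarrow> barrier_hess \<alpha> z x"
    using continuous_on_tendsto_compose[OF continuous_on_barrier[of UNIV] limX]
      continuous_on_tendsto_compose[OF continuous_on_barrier_grad[of UNIV] limX]
      continuous_on_tendsto_compose[OF continuous_on_barrier_hess[of UNIV] limX] by auto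
  have limP2: "(\<lambda>k. P2 (\<sigma> k)) \<longlonglongrightarrow> ?p2"
  proof -
    have "(\<lambda>k. (P1 (\<sigma> k) + \<epsilon> *\<^sub>R barrier_grad \<alpha> z (X (\<sigma> k)))
      - (P1 (\<sigma> k) - (P2 (\<sigma> k) - \<epsilon> *\<^sub>R barrier_grad \<alpha> z (X (\<sigma> k))))) \<longlonglongrightarrow> ?p2"
      by (intro shift tendsto_add tendsto_scaleR tendsto_const limP1 limb) (use * in blast)
    then show ?thesis by simp
  qed
  have limM2: "(\<lambda>k. M2 (\<sigma> k)) \<longlonglongrightarrow> ?M2"
  proof -
    have "(\<lambda>k. (M1 (\<sigma> k) + \<epsilon> *\<^sub>R barrier_hess \<alpha> z (X (\<sigma> k)))
      - (M1 (\<sigma> k) - (M2 (\<sigma> k) - \<epsilon> *\<^sub>R barrier_hess \<alpha> z (X (\<sigma> k))))) \<longlonglongrightarrow> ?M2"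
      by (intro shift tendsto_add tendsto_scaleR tendsto_const limM1 limb) (use * in blast)
    then show ?thesis by simp
  qed
  have limJ1: "(\<lambda>k. (X1 (\<sigma> k), S1 (\<sigma> k), P1 (\<sigma> k), M1 (\<sigma> k))) \<longlonglongrightarrow> (x, s1, p, M)"
    by (intro tendsto_Pair limX1 limS1 limP1 limM1)
  have limJ2: "(\<lambda>k. (X2 (\<sigma> k), S2 (\<sigma> k), P2 (\<sigma> k), M2 (\<sigma> k))) \<longlonglongrightarrow> (x, s2, ?p2, ?M2)"
    by (intro tendsto_Pair limX2 limS2 limP2 limM2)
  have "(x, s1, p, M) \<in> {J \<in> closure U. 1 \<le> F J}"
    by (rule Lim_in_closed_set[OF closed_F_ge_1[OF contF] _ _ limJ1]) (use * in \<open>auto intro: always_eventually\<close>)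
  then have J1: "1 \<le> F (x, s1, p, M)" "(x, s1, p, M) \<in> U"
    using in_U_if_F_ge_1[OF U F2] by auto
  have xr: "x \<in> cball x0 r0"
    by (rule Lim_in_closed_set[OF closed_cball _ _ limX1]) (use * in \<open>auto simp del: mem_cball intro: always_eventually\<close>)
  have s12: "s1 \<le> s2"
  proof -
    have fl: "(\<lambda>k. f (X1 (\<sigma> k))) \<longlonglongrightarrow> f x" "(\<lambda>k. f (X2 (\<sigma> k))) \<longlonglongrightarrow> f x"
      using continuous_on_tendsto_compose[OF contf limX1 xr] continuous_on_tendsto_compose[OF contf limX2 xr] *
      by (auto simp del: mem_cball)
    have fl': "(\<lambda>k. \<bar>f (X1 (\<sigma> k)) - f (X2 (\<sigma> k))\<bar>) \<longlonglongrightarrow> \<bar>f x - f x\<bar>"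
      by (intro tendsto_intros fl)
    have "(\<lambda>k. S1 (\<sigma> k) - S2 (\<sigma> k)) \<longlonglongrightarrow> s1 - s2" by (intro tendsto_intros limS1 limS2)
    then have "s1 - s2 \<le> \<bar>f x - f x\<bar>"
      by (rule LIMSEQ_le[OF _ fl']) (use * in blast)
    then show ?thesis by simp
  qed
  have s21: "s2 \<le> s1 + \<epsilon> * barrier \<alpha> R z x"
  proof -
    have "(\<lambda>k. S2 (\<sigma> k) - \<epsilon> * barrier \<alpha> R z (X (\<sigma> k)) - ?\<kappa> (\<sigma> k)) \<longlonglongrightarrow> s2 - \<epsilon> * barrier \<alpha> R z x - 0"
      by (intro tendsto_diff tendsto_mult tendsto_const limS2 limb \<kappa>\<sigma>)
    from LIMSEQ_le[OF this limS1] * have "s2 - \<epsilon> * barrier \<alpha> R z x - 0 \<le> s1" by blast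
    then show ?thesis by simp
  qed
  \<comment> \<open>Which jet satisfies the bound may change with \<open>k\<close>; if both limits
    exceeded \<open>B\<close>, so would both jets from some index on.\<close>
  have nB: "norm (s1, p, M) \<le> B \<or> norm (s2, ?p2, ?M2) \<le> B"
  proof (rule ccontr)
    assume "\<not> ?thesis"
    then have "B < norm (s1, p, M)" "B < norm (s2, ?p2, ?M2)" by auto
    moreover have "(\<lambda>k. norm (S1 (\<sigma> k), P1 (\<sigma> k), M1 (\<sigma> k))) \<longlonglongrightarrow> norm (s1, p, M)"
      "(\<lambda>k. norm (S2 (\<sigma> k), P2 (\<sigma> k), M2 (\<sigma> k))) \<longlonglongrightarrow> norm (s2, ?p2, ?M2)"
      by (intro tendsto_norm tendsto_Pair limS1 limP1 limM1 limS2 limP2 limM2)+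
    ultimately have "\<forall>\<^sub>F k in sequentially. B < norm (S1 (\<sigma> k), P1 (\<sigma> k), M1 (\<sigma> k)) \<and> B < norm (S2 (\<sigma> k), P2 (\<sigma> k), M2 (\<sigma> k))"
      by (intro eventually_conj order_tendstoD(1))
    then obtain k where "B < norm (S1 (\<sigma> k), P1 (\<sigma> k), M1 (\<sigma> k)) \<and> B < norm (S2 (\<sigma> k), P2 (\<sigma> k), M2 (\<sigma> k))"
      using eventually_happens' sequentially_bot by blast
    then show False using *[of "\<sigma> k"] by linarith
  qed
  have J2: "F (x, s2, ?p2, ?M2) \<le> 1" if J: "(x, s2, ?p2, ?M2) \<in> U"
  proof -
    obtain V where V: "open V" "U = jet_space \<Omega> \<inter> V" using U by (rule openin_jet_topE)
    have "\<forall>\<^sub>F k in sequentially. (X2 (\<sigma> k), S2 (\<sigma> k), P2 (\<sigma> k), M2 (\<sigma> k)) \<in> V"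
      by (rule topological_tendstoD[OF limJ2 V(1)]) (use J V in blast)
    moreover have "(X2 k, S2 k, P2 k, M2 k) \<in> jet_space \<Omega>" for k
      using *[of k] r0 closure_subset[of \<Omega>] by (auto simp: jet_space_def simp del: mem_cball)
    ultimately have ev: "\<forall>\<^sub>F k in sequentially. (X2 (\<sigma> k), S2 (\<sigma> k), P2 (\<sigma> k), M2 (\<sigma> k)) \<in> closure U"
      using closure_subset[of U] V(2) by (auto elim!: eventually_mono)
    have "(\<lambda>k. F (X2 (\<sigma> k), S2 (\<sigma> k), P2 (\<sigma> k), M2 (\<sigma> k))) \<longlonglongrightarrow> F (x, s2, ?p2, ?M2)"
      by (rule continuous_on_tendsto_compose[OF contF limJ2 _ ev]) (use J closure_subset in blast)
    moreover have "\<forall>\<^sub>F k in sequentially. F (X2 (\<sigma> k), S2 (\<sigma> k), P2 (\<sigma> k), M2 (\<sigma> k)) \<le> 1"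
      using ev by eventually_elim (use * in blast)
    ultimately show ?thesis by (rule tendsto_upperbound) simp
  qed
  show ?thesis
    using xl J1 s12 s21 nB J2 by (intro exI[of _ x] exI[of _ s1] exI[of _ p] exI[of _ M] exI[of _ s2]) auto
qed

section \<open>The strong maximum principle\<close>

theorem theorem2p3:
  fixes \<Omega> :: "(real^'n) set"
    and U :: "'n jet set"
    and F :: "'n jet \<Rightarrow> real"
    and \<psi>1 \<psi>2 :: "real^'n \<Rightarrow> ereal"
  assumes "open \<Omega>" and "connected \<Omega>"
    and "openin (jet_top \<Omega>) U" and "U \<noteq> {}"
    and "continuous_on (closure U) F"
    and "condF1 F U" and "condF2 \<Omega> F U" and "condF3 F U" and "condF4 F U"
    and "visc_subsolution \<Omega> F U \<psi>1"
    and "visc_supersolution \<Omega> F U \<psi>2"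
    and "\<forall>x\<in>\<Omega>. \<psi>1 x \<le> \<psi>2 x"
    and "ereal_C11_loc_on \<Omega> \<psi>1 \<or> ereal_C11_loc_on \<Omega> \<psi>2"
  shows "(\<forall>x\<in>\<Omega>. \<psi>1 x = \<psi>2 x) \<or> (\<forall>x\<in>\<Omega>. \<psi>1 x < \<psi>2 x)"
proof (rule ccontr)
  note U = assms(3) and contF = assms(5) and F1 = assms(6) and F2 = assms(7) and F3 = assms(8) and F4 = assms(9)
  assume "\<not> ?thesis"
  then obtain a b where a: "a \<in> \<Omega>" "\<psi>1 a = \<psi>2 a" and b: "b \<in> \<Omega>" "\<psi>1 b \<noteq> \<psi>2 b"
    using assms(12) by (metis order_le_less)
  obtain x0 z R r0 B f where R: "0 < R" "dist z x0 = R" and r0: "0 < r0" "cball x0 r0 \<subseteq> \<Omega>"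
    and contf: "continuous_on (cball x0 r0) f"
    and pairs: "\<forall>\<alpha>>0. \<forall>\<rho>>0. \<exists>\<epsilon>>0. \<epsilon> < \<rho> \<and> (\<forall>\<kappa>>0. approx_jet_pair F U f x0 r0 z R B \<alpha> \<rho> \<epsilon> \<kappa>)"
    by (rule touching_jet_pairs[OF assms(1,2,10,11,12,13) a b])
  \<comment> \<open>Contains every possible limit jet over \<open>x0\<close>, for all \<alpha> at
    once.\<close>
  define K0 where "K0 = {J \<in> closure U. 1 \<le> F J} \<inter> ({x0} \<times> cball 0 (B + 1))"
  have compK0: "compact K0"
    unfolding K0_def
    by (intro closed_Int_compact closed_F_ge_1[OF contF] compact_Times compact_cball) auto
  have K0U: "K0 \<subseteq> U"
    using in_U_if_F_ge_1[OF U F2] by (auto simp: K0_def)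
  \<comment> \<open>For fixed \<alpha> the parameter \<rho>, and with it \<epsilon>, is sent to 0
    along \<open>1 / real (Suc k)\<close>; a subsequence of the subsolution jets converges to a
    point of \<open>K0\<close>.\<close>
  have seq: "\<exists>\<epsilon> x s1 p M s2 J. (\<forall>k. 0 < \<epsilon> k \<and> (x k, s1 k, p k, M k) \<in> U \<and> 1 \<le> F (x k, s1 k, p k, M k) \<and>
      s1 k \<le> s2 k \<and> s2 k \<le> s1 k + \<epsilon> k * barrier \<alpha> R z (x k) \<and>
      ((x k, s2 k, p k + \<epsilon> k *\<^sub>R barrier_grad \<alpha> z (x k), M k + \<epsilon> k *\<^sub>R barrier_hess \<alpha> z (x k)) \<in> U \<longrightarrow>
        F (x k, s2 k, p k + \<epsilon> k *\<^sub>R barrier_grad \<alpha> z (x k), M k + \<epsilon> k *\<^sub>R barrier_hess \<alpha> z (x k)) \<le> 1)) \<and>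
      J \<in> K0 \<and> \<epsilon> \<longlonglongrightarrow> 0 \<and> (\<lambda>k. (x k, s1 k, p k, M k)) \<longlonglongrightarrow> J"
    if \<alpha>: "0 < \<alpha>" for \<alpha>
  proof -
    let ?\<rho> = "\<lambda>k. 1 / real (Suc k)"
    have \<rho>lim: "?\<rho> \<longlonglongrightarrow> 0"
      using LIMSEQ_inverse_real_of_nat by (simp add: inverse_eq_divide)
    have "\<forall>k. \<exists>\<epsilon> x s1 p M s2. 0 < \<epsilon> \<and> \<epsilon> < ?\<rho> k \<and> dist x0 x \<le> ?\<rho> k \<and> (x, s1, p, M) \<in> U \<and> 1 \<le> F (x, s1, p, M) \<and>
      s1 \<le> s2 \<and> s2 \<le> s1 + \<epsilon> * barrier \<alpha> R z x \<and>
      (norm (s1, p, M) \<le> B \<or> norm (s2, p + \<epsilon> *\<^sub>R barrier_grad \<alpha> z x, M + \<epsilon> *\<^sub>R barrier_hess \<alpha> z x) \<le> B) \<and>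
      ((x, s2, p + \<epsilon> *\<^sub>R barrier_grad \<alpha> z x, M + \<epsilon> *\<^sub>R barrier_hess \<alpha> z x) \<in> U \<longrightarrow>
        F (x, s2, p + \<epsilon> *\<^sub>R barrier_grad \<alpha> z x, M + \<epsilon> *\<^sub>R barrier_hess \<alpha> z x) \<le> 1)"
    proof
      fix k
      have "0 < ?\<rho> k" by simp
      then obtain \<epsilon> where \<epsilon>: "0 < \<epsilon>" "\<epsilon> < ?\<rho> k" "\<forall>\<kappa>>0. approx_jet_pair F U f x0 r0 z R B \<alpha> (?\<rho> k) \<epsilon> \<kappa>"
        using pairs \<alpha> by blast
      show "\<exists>\<epsilon> x s1 p M s2. 0 < \<epsilon> \<and> \<epsilon> < ?\<rho> k \<and> dist x0 x \<le> ?\<rho> k \<and> (x, s1, p, M) \<in> U \<and> 1 \<le> F (x, s1, p, M) \<and>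
      s1 \<le> s2 \<and> s2 \<le> s1 + \<epsilon> * barrier \<alpha> R z x \<and>
      (norm (s1, p, M) \<le> B \<or> norm (s2, p + \<epsilon> *\<^sub>R barrier_grad \<alpha> z x, M + \<epsilon> *\<^sub>R barrier_hess \<alpha> z x) \<le> B) \<and>
      ((x, s2, p + \<epsilon> *\<^sub>R barrier_grad \<alpha> z x, M + \<epsilon> *\<^sub>R barrier_hess \<alpha> z x) \<in> U \<longrightarrow>
        F (x, s2, p + \<epsilon> *\<^sub>R barrier_grad \<alpha> z x, M + \<epsilon> *\<^sub>R barrier_hess \<alpha> z x) \<le> 1)"
        using limit_jet_pair[OF U contF F2 r0(2) contf \<epsilon>(1) \<alpha> \<epsilon>(3)] \<epsilon>(1,2)
        by (intro exI[of _ \<epsilon>]) simp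
    qed
    then obtain \<epsilon> x s1 p M s2 where *: "\<And>k. 0 < \<epsilon> k \<and> \<epsilon> k < ?\<rho> k \<and> dist x0 (x k) \<le> ?\<rho> k \<and> (x k, s1 k, p k, M k) \<in> U \<and> 1 \<le> F (x k, s1 k, p k, M k) \<and>
      s1 k \<le> s2 k \<and> s2 k \<le> s1 k + \<epsilon> k * barrier \<alpha> R z (x k) \<and>
      (norm (s1 k, p k, M k) \<le> B \<or> norm (s2 k, p k + \<epsilon> k *\<^sub>R barrier_grad \<alpha> z (x k), M k + \<epsilon> k *\<^sub>R barrier_hess \<alpha> z (x k)) \<le> B) \<and>
      ((x k, s2 k, p k + \<epsilon> k *\<^sub>R barrier_grad \<alpha> z (x k), M k + \<epsilon> k *\<^sub>R barrier_hess \<alpha> z (x k)) \<in> U \<longrightarrow>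
        F (x k, s2 k, p k + \<epsilon> k *\<^sub>R barrier_grad \<alpha> z (x k), M k + \<epsilon> k *\<^sub>R barrier_hess \<alpha> z (x k)) \<le> 1)"
      by metis
    have \<epsilon>lim: "\<epsilon> \<longlonglongrightarrow> 0"
      by (rule tendsto_sandwich[OF _ _ tendsto_const \<rho>lim]) (use * in \<open>auto intro!: always_eventually less_imp_le\<close>)
    have "(\<lambda>k. x k - x0) \<longlonglongrightarrow> 0"
      by (rule Lim_null_comparison[OF _ \<rho>lim]) (use * in \<open>auto simp: dist_norm norm_minus_commute\<close>)
    then have xlim: "x \<longlonglongrightarrow> x0" by (simp add: LIM_zero_iff)
    define E where "E k = (\<epsilon> k * barrier \<alpha> R z (x k), \<epsilon> k *\<^sub>R barrier_grad \<alpha> z (x k), \<epsilon> k *\<^sub>R barrier_hess \<alpha> z (x k))" for k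
    have blim: "(\<lambda>k. barrier \<alpha> R z (x k)) \<longlonglongrightarrow> barrier \<alpha> R z x0"
      "(\<lambda>k. barrier_grad \<alpha> z (x k)) \<longlonglongrightarrow> barrier_grad \<alpha> z x0"
      "(\<lambda>k. barrier_hess \<alpha> z (x k)) \<longlonglongrightarrow> barrier_hess \<alpha> z x0"
      using continuous_on_tendsto_compose[OF continuous_on_barrier[of UNIV] xlim]
        continuous_on_tendsto_compose[OF continuous_on_barrier_grad[of UNIV] xlim]
        continuous_on_tendsto_compose[OF continuous_on_barrier_hess[of UNIV] xlim] by auto
    have "E \<longlonglongrightarrow> (0 * barrier \<alpha> R z x0, 0 *\<^sub>R barrier_grad \<alpha> z x0, 0 *\<^sub>R barrier_hess \<alpha> z x0)"
      unfolding E_def by (intro tendsto_Pair tendsto_mult tendsto_scaleR \<epsilon>lim blim)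
    then have "(\<lambda>k. norm (E k)) \<longlonglongrightarrow> 0"
      by (intro tendsto_norm_zero) (simp add: zero_prod_def)
    then have "\<forall>\<^sub>F k in sequentially. norm (E k) < 1"
      by (rule order_tendstoD) simp
    then obtain k0 where k0: "\<And>k. k0 \<le> k \<Longrightarrow> norm (E k) < 1"
      unfolding eventually_sequentially by blast
    \<comment> \<open>One of the two jets has norm at most \<open>B\<close>, and they differ by at
      most \<open>norm (E k) < 1\<close>.\<close>
    have bound: "norm (s1 k, p k, M k) \<le> B + 1" if "k0 \<le> k" for k
    proof -
      let ?J2 = "(s2 k, p k + \<epsilon> k *\<^sub>R barrier_grad \<alpha> z (x k), M k + \<epsilon> k *\<^sub>R barrier_hess \<alpha> z (x k))"
      let ?E = "(s2 k - s1 k, \<epsilon> k *\<^sub>R barrier_grad \<alpha> z (x k), \<epsilon> k *\<^sub>R barrier_hess \<alpha> z (x k))"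
      have "\<bar>s2 k - s1 k\<bar> \<le> \<bar>\<epsilon> k * barrier \<alpha> R z (x k)\<bar>" using *[of k] by linarith
      then have "norm ?E \<le> norm (E k)"
        unfolding E_def norm_prod_def by (auto intro!: real_sqrt_le_mono add_mono abs_le_square_iff[THEN iffD1])
      moreover have "norm (s1 k, p k, M k) \<le> norm ?J2 + norm ?E"
        using norm_triangle_ineq4[of ?J2 ?E] by simp
      ultimately show ?thesis using *[of k] k0[OF that] by linarith
    qed
    have "(s1 (k + k0), p (k + k0), M (k + k0)) \<in> cball 0 (B + 1)" for k
      using bound[of "k + k0"] by simp
    then obtain l \<sigma> where l: "strict_mono \<sigma>" "((\<lambda>k. (s1 (k + k0), p (k + k0), M (k + k0))) \<circ> \<sigma>) \<longlonglongrightarrow> l"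
      using compact_cball[of "0 :: real \<times> (real^'n) \<times> (real^'n^'n)" "B + 1"]
      unfolding compact_eq_seq_compact_metric seq_compact_def by meson
    define \<tau> where "\<tau> k = \<sigma> k + k0" for k
    have \<tau>: "strict_mono \<tau>" using l(1) by (auto simp: strict_mono_def \<tau>_def)
    have l\<tau>: "(\<lambda>k. (s1 (\<tau> k), p (\<tau> k), M (\<tau> k))) \<longlonglongrightarrow> l"
      using l(2) by (simp add: \<tau>_def o_def)
    have x\<tau>: "(\<lambda>k. x (\<tau> k)) \<longlonglongrightarrow> x0" and \<epsilon>\<tau>: "(\<lambda>k. \<epsilon> (\<tau> k)) \<longlonglongrightarrow> 0"
      using LIMSEQ_subseq_LIMSEQ[OF xlim \<tau>] LIMSEQ_subseq_LIMSEQ[OF \<epsilon>lim \<tau>] by (simp_all add: o_def)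
    have Jlim: "(\<lambda>k. (x (\<tau> k), s1 (\<tau> k), p (\<tau> k), M (\<tau> k))) \<longlonglongrightarrow> (x0, l)"
      by (intro tendsto_Pair x\<tau> l\<tau>)
    have "(x0, l) \<in> {J \<in> closure U. 1 \<le> F J}"
      by (rule Lim_in_closed_set[OF closed_F_ge_1[OF contF] _ _ Jlim])
         (use * closure_subset in \<open>auto intro!: always_eventually\<close>)
    moreover have "l \<in> cball 0 (B + 1)"
      by (rule Lim_in_closed_set[OF closed_cball _ _ l\<tau>]) (use bound in \<open>auto intro!: always_eventually simp: \<tau>_def\<close>)
    ultimately have "(x0, l) \<in> K0" by (simp add: K0_def)
    with Jlim \<epsilon>\<tau> show ?thesis
      by (intro exI[of _ "\<lambda>k. \<epsilon> (\<tau> k)"] exI[of _ "\<lambda>k. x (\<tau> k)"] exI[of _ "\<lambda>k. s1 (\<tau> k)"] exI[of _ "\<lambda>k. p (\<tau> k)"]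
          exI[of _ "\<lambda>k. M (\<tau> k)"] exI[of _ "\<lambda>k. s2 (\<tau> k)"] exI[of _ "(x0, l)"] conjI allI) (use * in auto)
  qed
  \<comment> \<open>Any \<alpha> yields a limit jet. Nonemptiness is essential for
    \<open>infdist\<close>, whose value for the empty set is 0.\<close>
  have K0ne: "K0 \<noteq> {}" using seq[of 1] by auto
  obtain T where T: "open T" "U = jet_space \<Omega> \<inter> T" using U by (rule openin_jet_topE)
  obtain e where e: "0 < e" "{J. infdist J K0 \<le> e} \<subseteq> T"
    by (rule compact_in_open_separated[OF K0ne compK0 T(1)]) (use K0U T(2) in auto)
  \<comment> \<open>A compact neighbourhood of \<open>K0\<close> in the jet space. Its constants
    \<delta> and \<open>C\<close> come from \<open>K0\<close> alone and so may enter the choice of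
    \<alpha>.\<close>
  define K where "K = jet_space \<Omega> \<inter> {J. infdist J K0 \<le> e}"
  have compK: "compact K"
    unfolding K_def by (intro closed_Int_compact closed_jet_space compact_infdist_le K0ne compK0 e(1))
  have KU: "K \<subseteq> U" using e(2) T(2) by (auto simp: K_def)
  obtain \<delta> where \<delta>: "0 < \<delta>" "\<And>x s p M N. (x, s, p, M) \<in> K \<Longrightarrow> N \<in> Sym \<Longrightarrow> nonneg_def N \<Longrightarrow>
      \<delta> * norm N \<le> F (x, s, p, M + N) - F (x, s, p, M)"
    using F3 compK KU unfolding condF3_def by meson
  obtain C where C: "0 < C" "\<And>x s p M s' p' M'. (x, s, p, M) \<in> K \<Longrightarrow> (x, s', p', M') \<in> K \<Longrightarrow>
      \<bar>F (x, s, p, M) - F (x, s', p', M')\<bar> \<le> C * (\<bar>s - s'\<bar> + norm (p - p') + norm (M - M'))"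
    using F4 compK KU unfolding condF4_def by meson
  define I where "I = norm (mat 1 :: real^'n^'n)"
  have I: "0 \<le> I" by (simp add: I_def)
  \<comment> \<open>With \<open>R / 2 \<le> d \<le> 2 * R\<close> the gain in (F3) is at least
    \<open>\<delta> * R\<^sup>2 * \<alpha>\<^sup>2\<close> and, as \<open>1 \<le> \<alpha>\<close>,
    the loss in (F4) at most \<open>\<alpha> * C * (1 + 4 * R + 2 * I)\<close>. The choice makes the
    first one larger.\<close>
  define \<alpha> where "\<alpha> = 1 + C * (1 + 4 * R + 2 * I) / (\<delta> * R\<^sup>2)"
  have \<alpha>: "1 \<le> \<alpha>" "0 < \<alpha>" "C * (1 + 4 * R + 2 * I) < \<delta> * R\<^sup>2 * \<alpha>"
  proof -
    have "0 \<le> C * (1 + 4 * R + 2 * I) / (\<delta> * R\<^sup>2)" using C \<delta> R I by simp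
    then show "1 \<le> \<alpha>" "0 < \<alpha>" by (auto simp: \<alpha>_def)
    have q: "q * (1 + A / q) = q + A" if "0 < q" for q A :: real
      using that by (simp add: distrib_left)
    have "0 < \<delta> * R\<^sup>2" using \<delta>(1) R(1) by simp
    with q[OF this, of "C * (1 + 4 * R + 2 * I)"] show "C * (1 + 4 * R + 2 * I) < \<delta> * R\<^sup>2 * \<alpha>"
      unfolding \<alpha>_def by linarith
  qed
  obtain \<epsilon> x s1 p M s2 J where *: "\<And>k. 0 < \<epsilon> k \<and> (x k, s1 k, p k, M k) \<in> U \<and> 1 \<le> F (x k, s1 k, p k, M k) \<and>
      s1 k \<le> s2 k \<and> s2 k \<le> s1 k + \<epsilon> k * barrier \<alpha> R z (x k) \<and>
      ((x k, s2 k, p k + \<epsilon> k *\<^sub>R barrier_grad \<alpha> z (x k), M k + \<epsilon> k *\<^sub>R barrier_hess \<alpha> z (x k)) \<in> U \<longrightarrow>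
        F (x k, s2 k, p k + \<epsilon> k *\<^sub>R barrier_grad \<alpha> z (x k), M k + \<epsilon> k *\<^sub>R barrier_hess \<alpha> z (x k)) \<le> 1)"
    and J: "J \<in> K0" and \<epsilon>lim: "\<epsilon> \<longlonglongrightarrow> 0" and Jlim: "(\<lambda>k. (x k, s1 k, p k, M k)) \<longlonglongrightarrow> J"
    using seq[OF \<alpha>(2)] by blast
  obtain sl pl Ml where Jeq: "J = (x0, sl, pl, Ml)" using J by (cases J) (auto simp: K0_def)
  note Jl = Jlim[unfolded Jeq]
  have xlim: "x \<longlonglongrightarrow> x0" and slim: "s1 \<longlonglongrightarrow> sl" and plim: "p \<longlonglongrightarrow> pl" and Mlim: "M \<longlonglongrightarrow> Ml"
    using tendsto_fst[OF Jl] tendsto_fst[OF tendsto_snd[OF Jl]] tendsto_fst[OF tendsto_snd[OF tendsto_snd[OF Jl]]]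
      tendsto_snd[OF tendsto_snd[OF tendsto_snd[OF Jl]]] by simp_all
  define ex where "ex k = exp (- \<alpha> * (norm (x k - z))\<^sup>2)" for k
  \<comment> \<open>The rank-one part of \<epsilon> times the barrier Hessian.
    \<open>M k + N k\<close> therefore differs from the supersolution matrix by a multiple of the
    identity only, of order \<alpha> instead of \<alpha>^2.\<close>
  define N where "N k = (\<epsilon> k * ex k * (4 * \<alpha>\<^sup>2)) *\<^sub>R outer (x k - z)" for k
  have blim: "(\<lambda>k. barrier \<alpha> R z (x k)) \<longlonglongrightarrow> barrier \<alpha> R z x0"
    "(\<lambda>k. barrier_grad \<alpha> z (x k)) \<longlonglongrightarrow> barrier_grad \<alpha> z x0"
    "(\<lambda>k. barrier_hess \<alpha> z (x k)) \<longlonglongrightarrow> barrier_hess \<alpha> z x0"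
    "(\<lambda>k. outer (x k - z)) \<longlonglongrightarrow> outer (x0 - z)"
    using continuous_on_tendsto_compose[OF continuous_on_barrier[of UNIV] xlim]
      continuous_on_tendsto_compose[OF continuous_on_barrier_grad[of UNIV] xlim]
      continuous_on_tendsto_compose[OF continuous_on_barrier_hess[of UNIV] xlim]
      continuous_on_tendsto_compose[OF continuous_on_outer[of UNIV] tendsto_diff[OF xlim tendsto_const[of z]]] by auto
  have exlim: "ex \<longlonglongrightarrow> exp (- \<alpha> * (norm (x0 - z))\<^sup>2)"
    unfolding ex_def by (intro tendsto_intros xlim)
  have "N \<longlonglongrightarrow> (0 * exp (- \<alpha> * (norm (x0 - z))\<^sup>2) * (4 * \<alpha>\<^sup>2)) *\<^sub>R outer (x0 - z)"
    unfolding N_def by (intro tendsto_scaleR tendsto_mult tendsto_const \<epsilon>lim exlim blim)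
  then have Nlim: "N \<longlonglongrightarrow> 0" by simp
  have "(\<lambda>k. M k + N k) \<longlonglongrightarrow> Ml + 0" by (intro tendsto_add Mlim Nlim)
  then have JNlim: "(\<lambda>k. (x k, s1 k, p k, M k + N k)) \<longlonglongrightarrow> J"
    unfolding Jeq by (intro tendsto_Pair xlim slim plim) simp
  have s2lim: "s2 \<longlonglongrightarrow> sl"
  proof (rule tendsto_sandwich[OF _ _ slim])
    have "(\<lambda>k. s1 k + \<epsilon> k * barrier \<alpha> R z (x k)) \<longlonglongrightarrow> sl + 0 * barrier \<alpha> R z x0"
      by (intro tendsto_intros slim \<epsilon>lim blim)
    then show "(\<lambda>k. s1 k + \<epsilon> k * barrier \<alpha> R z (x k)) \<longlonglongrightarrow> sl" by simp
  qed (use * in \<open>auto intro!: always_eventually\<close>)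
  have "(\<lambda>k. (x k, s2 k, p k + \<epsilon> k *\<^sub>R barrier_grad \<alpha> z (x k), M k + \<epsilon> k *\<^sub>R barrier_hess \<alpha> z (x k)))
      \<longlonglongrightarrow> (x0, sl, pl + 0 *\<^sub>R barrier_grad \<alpha> z x0, Ml + 0 *\<^sub>R barrier_hess \<alpha> z x0)"
    by (intro tendsto_Pair tendsto_add tendsto_scaleR xlim s2lim plim Mlim \<epsilon>lim blim)
  then have J2lim: "(\<lambda>k. (x k, s2 k, p k + \<epsilon> k *\<^sub>R barrier_grad \<alpha> z (x k), M k + \<epsilon> k *\<^sub>R barrier_hess \<alpha> z (x k))) \<longlonglongrightarrow> J"
    by (simp add: Jeq)
  have near: "\<forall>\<^sub>F k in sequentially. infdist (Q k) K0 \<le> e" if "Q \<longlonglongrightarrow> J" for Q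
    using tendstoD[OF that e(1)]
  proof eventually_elim
    case (elim k)
    then show ?case using infdist_le[OF J, of "Q k"] by linarith
  qed
  have "\<forall>\<^sub>F k in sequentially. dist (x k) x0 < R / 2"
    by (rule tendstoD[OF xlim]) (use R in simp)
  with near[OF Jlim] near[OF JNlim] near[OF J2lim]
  have "\<forall>\<^sub>F k in sequentially. infdist (x k, s1 k, p k, M k) K0 \<le> e \<and> infdist (x k, s1 k, p k, M k + N k) K0 \<le> e \<and>
    infdist (x k, s2 k, p k + \<epsilon> k *\<^sub>R barrier_grad \<alpha> z (x k), M k + \<epsilon> k *\<^sub>R barrier_hess \<alpha> z (x k)) K0 \<le> e \<and> dist (x k) x0 < R / 2"
    by eventually_elim simp
  then obtain k where k: "infdist (x k, s1 k, p k, M k) K0 \<le> e" "infdist (x k, s1 k, p k, M k + N k) K0 \<le> e"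
    "infdist (x k, s2 k, p k + \<epsilon> k *\<^sub>R barrier_grad \<alpha> z (x k), M k + \<epsilon> k *\<^sub>R barrier_hess \<alpha> z (x k)) K0 \<le> e"
    "dist (x k) x0 < R / 2"
    using eventually_happens'[OF sequentially_bot] by blast
  define d where "d = norm (x k - z)"
  have d: "R / 2 \<le> d" "d \<le> 2 * R"
    using dist_triangle[of "x k" z x0] dist_triangle[of z x0 "x k"] k(4) R
    by (auto simp: d_def dist_norm norm_minus_commute)
  have pos: "0 < \<epsilon> k" "0 < ex k" using *[of k] by (auto simp: ex_def)
  define c where "c = \<epsilon> k * ex k"
  have c: "0 < c" using pos by (simp add: c_def)
  have jet: "(x k, s1 k, p k, M k) \<in> jet_space \<Omega>" using * T(2) by blast
  have SymN: "N k \<in> Sym" unfolding N_def by (intro Sym_scaleR outer_Sym)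
  have nonnegN: "nonneg_def (N k)"
    using outer_nonneg_def[of "x k - z"] pos
    by (auto simp: N_def nonneg_def_def scaleR_matrix_vector_assoc[symmetric])
  have in1: "(x k, s1 k, p k, M k) \<in> K" using jet k(1) by (simp add: K_def)
  have in2: "(x k, s1 k, p k, M k + N k) \<in> K"
    using jet k(2) SymN by (simp add: K_def jet_space_def Sym_add)
  have in3: "(x k, s2 k, p k + \<epsilon> k *\<^sub>R barrier_grad \<alpha> z (x k), M k + \<epsilon> k *\<^sub>R barrier_hess \<alpha> z (x k)) \<in> K"
    using jet k(3) by (simp add: K_def jet_space_def Sym_add Sym_scaleR barrier_hess_Sym)
  let ?F3 = "F (x k, s2 k, p k + \<epsilon> k *\<^sub>R barrier_grad \<alpha> z (x k), M k + \<epsilon> k *\<^sub>R barrier_hess \<alpha> z (x k))"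
  have F3le: "?F3 \<le> 1" using * in3 KU by blast
  have e1: "norm (N k) = c * (4 * \<alpha>\<^sup>2 * d\<^sup>2)"
    using c by (simp add: N_def norm_outer d_def c_def[symmetric])
  \<comment> \<open>Dropping the constant \<open>exp (- \<alpha> * R\<^sup>2)\<close> from the
    barrier gives the value difference the same factor \<open>c\<close> as the other terms.\<close>
  have e2: "\<bar>s1 k - s2 k\<bar> \<le> c"
  proof -
    have "\<epsilon> k * barrier \<alpha> R z (x k) \<le> \<epsilon> k * ex k"
      using pos by (intro mult_left_mono) (auto simp: barrier_def ex_def)
    then show ?thesis unfolding c_def using *[of k] by linarith
  qed
  have e3: "norm (p k - (p k + \<epsilon> k *\<^sub>R barrier_grad \<alpha> z (x k))) = c * (2 * \<alpha> * d)"
    using pos \<alpha>(2) by (simp add: barrier_grad_def c_def d_def ex_def)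
  have e4: "norm (M k + N k - (M k + \<epsilon> k *\<^sub>R barrier_hess \<alpha> z (x k))) = c * (2 * \<alpha> * I)"
  proof -
    have "M k + N k - (M k + \<epsilon> k *\<^sub>R barrier_hess \<alpha> z (x k)) = (c * (2 * \<alpha>)) *\<^sub>R mat 1"
      by (simp add: N_def barrier_hess_def c_def ex_def scaleR_diff_right mult.assoc)
    then show ?thesis using c \<alpha>(2) by (simp add: I_def)
  qed
  \<comment> \<open>Adding \<open>N k\<close> to the subsolution jet raises \<open>F\<close> above 1
    by (F3), while (F4) bounds the drop from there to the supersolution jet, where
    \<open>F \<le> 1\<close>.\<close>
  have "\<delta> * norm (N k) \<le> F (x k, s1 k, p k, M k + N k) - F (x k, s1 k, p k, M k)"
    by (rule \<delta>(2)[OF in1 SymN nonnegN])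
  also have "\<dots> \<le> F (x k, s1 k, p k, M k + N k) - ?F3"
    using *[of k] F3le by linarith
  also have "\<dots> \<le> C * (\<bar>s1 k - s2 k\<bar> + norm (p k - (p k + \<epsilon> k *\<^sub>R barrier_grad \<alpha> z (x k)))
      + norm (M k + N k - (M k + \<epsilon> k *\<^sub>R barrier_hess \<alpha> z (x k))))"
    using C(2)[OF in2 in3] by linarith
  also have "\<dots> \<le> C * (c + c * (2 * \<alpha> * d) + c * (2 * \<alpha> * I))"
    unfolding e3 e4 using C(1) e2 by (intro mult_left_mono add_right_mono) auto
  \<comment> \<open>Both sides are proportional to \<open>c\<close>, hence to \<epsilon>, which
    drops out.\<close>
  finally have "c * (\<delta> * (4 * \<alpha>\<^sup>2 * d\<^sup>2)) \<le> c * (C * (1 + 2 * \<alpha> * d + 2 * \<alpha> * I))"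
    unfolding e1 by (simp add: algebra_simps)
  then have "\<delta> * (4 * \<alpha>\<^sup>2 * d\<^sup>2) \<le> C * (1 + 2 * \<alpha> * d + 2 * \<alpha> * I)"
    using c by (rule mult_left_le_imp_le)
  also have "\<dots> \<le> C * (\<alpha> * 1 + \<alpha> * (4 * R) + \<alpha> * (2 * I))"
  proof (intro mult_left_mono add_mono)
    have "\<alpha> * d \<le> \<alpha> * (2 * R)" using \<alpha>(2) d(2) by (intro mult_left_mono) auto
    then show "2 * \<alpha> * d \<le> \<alpha> * (4 * R)" by (simp add: mult_ac)
  qed (use \<alpha> C in auto)
  also have "\<dots> = \<alpha> * (C * (1 + 4 * R + 2 * I))" by (simp add: algebra_simps)
  also have "\<dots> < \<alpha> * (\<delta> * R\<^sup>2 * \<alpha>)" using \<alpha> by (intro mult_strict_left_mono)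
  also have "\<dots> = \<delta> * (4 * \<alpha>\<^sup>2 * (R / 2)\<^sup>2)" by (simp add: power2_eq_square)
  also have "\<dots> \<le> \<delta> * (4 * \<alpha>\<^sup>2 * d\<^sup>2)"
    using \<delta>(1) d(1) R(1) by (intro mult_left_mono power_mono) auto
  finally show False by simp
qed

end
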